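(* Let $d$ and $n$ satisfy $n=\tilde\Omega(d)$. Then there exists a 2-dimensional $(d,\delta)$-LPHS with $\delta=\tilde O(d^{-7/8})$. There is also a non-cyclic 2-dimensional LPHS with the same parameters.
   Context: Let $\Sigma_b=\{0,1\}^b$. A 2-dimensional input is $x\in\Sigma_b^{\mathbb{Z}_n^2}$ (entries $x[i,j]$, $i,j\in\mathbb{Z}_n$). For $(r_1,r_2)$, $x\ll(r_1,r_2)$ is the cyclic shift given by $(x\ll(r_1,r_2))[i,j]=x[i+r_1,j+r_2]$ (indices mod $n$). A (cyclic) 2-dimensional $(d,\delta)$-LPHS is a function $h:\Sigma_b^{\mathbb{Z}_n^2}\to\mathbb{Z}_n^2$ computable by $d$ adaptive queries of entries of its input such that for each unit vector $e\in\{(1,0),(0,1)\}$, $\Pr_x[h(x)\neq h(x\ll e)+e]\le\delta$ for uniformly random $x$. In the non-cyclic variant the output lies in $\mathbb{Z}^2$ and $x\ll e$ is replaced by the randomized non-cyclic shift $x\lll e$, which removes the first row (resp. column) in the direction of $e$, shifts the remaining entries by one in that direction, and fills the newly created last row (resp. column) with fresh uniformly random symbols. $h$ may be randomized with randomness shared between the two evaluations. $\tilde O,\tilde\Omega$ hide polylogarithmic factors. *)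

theory Defs
  imports "HOL-Probability.Probability"
begin

text \<open>
  The alphabet \<open>{0,1}^b\<close> is the set of bit lists of length \<open>b\<close>. The index group \<open>Z_n \<times> Z_n\<close>
  is represented by the integer pairs with both entries in \<open>{0..<n}\<close>; integer pairs are also
  the outputs of non-cyclic hash functions, so both variants share one type. Inputs are
  extensional functions on the index set, hence there are exactly \<open>2^(b n^2)\<close> of them.
\<close>

type_synonym index = "int \<times> int"
type_synonym input = "index \<Rightarrow> bool list"

definition alphabet :: "nat \<Rightarrow> bool list set" where
  "alphabet b = {w. length w = b}"

definition grid :: "nat \<Rightarrow> index set" where
  "grid n = {0..<int n} \<times> {0..<int n}"

definition inputs :: "nat \<Rightarrow> nat \<Rightarrow> input set" where
  "inputs n b = (\<Pi>\<^sub>E p \<in> grid n. alphabet b)"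

definition unit_vectors :: "index set" where
  "unit_vectors = {(1, 0), (0, 1)}"

definition wrap :: "nat \<Rightarrow> index \<Rightarrow> index" where
  "wrap n p = (fst p mod int n, snd p mod int n)"

definition cyclic_shift :: "nat \<Rightarrow> index \<Rightarrow> input \<Rightarrow> input" where
  "cyclic_shift n r x = (\<lambda>p\<in>grid n. x (wrap n (p + r)))"

text \<open>
  For a unit vector \<open>e\<close>, \<open>fresh_cells n e\<close> is the last row (or column) in direction \<open>e\<close>, whose
  entries have no source in the unshifted input and are drawn anew.
\<close>

definition fresh_cells :: "nat \<Rightarrow> index \<Rightarrow> index set" where
  "fresh_cells n e = {p \<in> grid n. p + e \<notin> grid n}"

definition noncyclic_shift :: "nat \<Rightarrow> nat \<Rightarrow> index \<Rightarrow> input \<Rightarrow> input pmf" where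
  "noncyclic_shift n b e x =
     map_pmf (\<lambda>y. \<lambda>p\<in>grid n. if p \<in> fresh_cells n e then y p else x (p + e))
       (pmf_of_set (\<Pi>\<^sub>E p \<in> fresh_cells n e. alphabet b))"

text \<open>Adaptive query algorithms are decision trees; a node branches on the answer to its query.\<close>

datatype ('q, 'a, 'r) query_tree =
    Output 'r
  | Query 'q "'a \<Rightarrow> ('q, 'a, 'r) query_tree"

primrec run :: "('q, 'a, 'r) query_tree \<Rightarrow> ('q \<Rightarrow> 'a) \<Rightarrow> 'r" where
  "run (Output r) x = r"
| "run (Query q k) x = run (k (x q)) x"

primrec queries :: "('q, 'a, 'r) query_tree \<Rightarrow> ('q \<Rightarrow> 'a) \<Rightarrow> 'q list" where
  "queries (Output r) x = []"
| "queries (Query q k) x = q # queries (k (x q)) x"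

definition computable_with_queries :: "nat \<Rightarrow> nat \<Rightarrow> nat \<Rightarrow> (input \<Rightarrow> index) \<Rightarrow> bool" where
  "computable_with_queries n b d h \<longleftrightarrow>
     (\<exists>t. \<forall>x\<in>inputs n b. run t x = h x \<and>
            length (queries t x) \<le> d \<and> set (queries t x) \<subseteq> grid n)"

text \<open>
  A randomized hash function is a distribution \<open>H\<close> on deterministic ones (a point mass in the
  deterministic case). A single \<open>h\<close> drawn from \<open>H\<close> is used for both evaluations: this is the
  shared randomness.
\<close>

definition cyclic_lphs :: "nat \<Rightarrow> nat \<Rightarrow> nat \<Rightarrow> real \<Rightarrow> (input \<Rightarrow> index) pmf \<Rightarrow> bool" where
  "cyclic_lphs n b d \<delta> H \<longleftrightarrow>
     (\<forall>h\<in>set_pmf H. computable_with_queries n b d h \<and> (\<forall>x\<in>inputs n b. h x \<in> grid n)) \<and>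
     (\<forall>e\<in>unit_vectors.
        pmf (do { h \<leftarrow> H;
                  x \<leftarrow> pmf_of_set (inputs n b);
                  return_pmf (h x \<noteq> wrap n (h (cyclic_shift n e x) + e)) }) True \<le> \<delta>)"

definition noncyclic_lphs :: "nat \<Rightarrow> nat \<Rightarrow> nat \<Rightarrow> real \<Rightarrow> (input \<Rightarrow> index) pmf \<Rightarrow> bool" where
  "noncyclic_lphs n b d \<delta> H \<longleftrightarrow>
     (\<forall>h\<in>set_pmf H. computable_with_queries n b d h) \<and>
     (\<forall>e\<in>unit_vectors.
        pmf (do { h \<leftarrow> H;
                  x \<leftarrow> pmf_of_set (inputs n b);
                  x' \<leftarrow> noncyclic_shift n b e x;
                  return_pmf (h x \<noteq> h x' + e) }) True \<le> \<delta>)"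

end

theory Submission
  imports Defs
begin

text \<open>
  Hash every horizontal window of \<open>O(log d)\<close> entries by a shared random function. Unless two windows
  coincide, this turns the input into a field of independent symbols \<open>(\<xi>, m)\<close>, where \<open>\<xi>\<close> is
  uniform on \<open>{-L..L}\<close> and \<open>m = 0\<close> (a mark) has probability \<open>1/M\<close>. A walk moves one column to the
  right at a time, and vertically by the \<open>\<xi>\<close> of the current cell; two walks that meet stay together.
  A stage walks for \<open>T \<approx> d\<close> columns and then stops at the next mark.

  The distance of two walks that have not met is a symmetric random walk on the integers with steps of
  size \<open>L\<close>, so from distance \<open>D\<close> the walks fail to meet with probability about
  \<open>(L + D/L) / sqrt T\<close>, and the expected distance of the outputs, counted as \<open>0\<close> if they
  agree, stays of order \<open>D + L\<^sup>2\<close>. With \<open>d = t\<^sup>8\<close>, three stages with \<open>L = 1, t\<^sup>2, t\<^sup>3\<close> and \<open>M = L t\<^sup>4\<close> fail with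
  probability \<open>t\<^sup>-\<^sup>4\<close>, \<open>t\<^sup>-\<^sup>2\<close>, \<open>t\<^sup>-\<^sup>1\<close>, each conditionally on the previous failures: in total
  \<open>t\<^sup>-\<^sup>7 = d powr (-7/8)\<close>. All cells that are read lie in a square smaller than the grid, hence cyclic and
  non-cyclic shifts have the same effect.
\<close>

section \<open>Averages over finite sets and product spaces\<close>

text \<open>The step sizes come from a balance. A stage entered at distance D fails with probability
  about (L + D/L) / t^4, least for L^2 = D. Expected distances, counted as 0 on agreement, must be
  divided by the probability of the failures so far, so D is of order 1, then t^4, then t^6. This
  gives L = 1, t^2, t^3, and L'^2 = M for the step size L' of the next stage. The law of the
  distance given failure is never described: a cost \<open>\<alpha> + \<beta> * distance\<close>,
  charged to disagreeing outputs, is carried from the last stage back to the first, because a stage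
  turns every cost of this form into another one.

  Walks that start in different columns also end in different columns after T steps, even if they
  have met. A mark is a place determined by the field alone, so both can stop at it. Each walk is
  confined to a band around its own start, which keeps all reads in a finite region. Merged walks
  may have different bands; therefore a stage accepts only if the confined walk agrees with the
  unconfined one.\<close>

definition avg :: "'a set \<Rightarrow> ('a \<Rightarrow> real) \<Rightarrow> real" where
  "avg A f = (\<Sum>a\<in>A. f a) / real (card A)"

lemma avg_mono: "(\<And>a. a \<in> A \<Longrightarrow> f a \<le> g a) \<Longrightarrow> avg A f \<le> avg A g"
  unfolding avg_def by (intro divide_right_mono sum_mono) auto

lemma avg_cong: "(\<And>a. a \<in> A \<Longrightarrow> f a = g a) \<Longrightarrow> avg A f = avg A g"
  unfolding avg_def by simp

lemma avg_const: "finite A \<Longrightarrow> A \<noteq> {} \<Longrightarrow> avg A (\<lambda>_. c) = c"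
  by (simp add: avg_def)

lemma avg_add: "avg A (\<lambda>a. f a + g a) = avg A f + avg A g"
  by (simp add: avg_def sum.distrib add_divide_distrib)

lemma avg_diff: "avg A (\<lambda>a. f a - g a) = avg A f - avg A g"
  by (simp add: avg_def sum_subtractf diff_divide_distrib)

lemma avg_cmult: "avg A (\<lambda>a. c * f a) = c * avg A f"
  by (simp add: avg_def sum_distrib_left)

lemma avg_divide: "avg A (\<lambda>a. f a / c) = avg A f / c"
  by (simp add: avg_def sum_divide_distrib[symmetric] mult.commute)

lemma avg_sum: "avg A (\<lambda>a. \<Sum>i\<in>I. f i a) = (\<Sum>i\<in>I. avg A (f i))"
  unfolding avg_def by (simp add: sum.swap[of _ I] sum_divide_distrib)

lemma avg_swap: "avg A (\<lambda>a. avg B (f a)) = avg B (\<lambda>b. avg A (\<lambda>a. f a b))"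
  unfolding avg_def by (simp add: sum_divide_distrib[symmetric] sum.swap[of _ A] mult.commute)

lemma avg_le_const: "finite A \<Longrightarrow> A \<noteq> {} \<Longrightarrow> (\<And>a. a \<in> A \<Longrightarrow> f a \<le> c) \<Longrightarrow> avg A f \<le> c"
  using avg_mono[of A f "\<lambda>_. c"] by (simp add: avg_const)

lemma avg_times:
  "avg (A \<times> B) f = avg A (\<lambda>a. avg B (\<lambda>b. f (a, b)))"
  unfolding avg_def
  by (simp add: sum.cartesian_product card_cartesian_product sum_divide_distrib[symmetric] mult.commute)

lemma avg_reindex: "bij_betw h A B \<Longrightarrow> avg B f = avg A (\<lambda>a. f (h a))"
  unfolding avg_def by (simp add: sum.reindex_bij_betw[symmetric] bij_betw_same_card[symmetric])

lemma avg_PiE_insert: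
  assumes "p \<notin> J"
  shows "avg (PiE (insert p J) (\<lambda>_. S)) f = avg S (\<lambda>\<sigma>. avg (PiE J (\<lambda>_. S)) (\<lambda>Z. f (Z(p := \<sigma>))))"
proof -
  have "bij_betw (\<lambda>(\<sigma>, Z). Z(p := \<sigma>)) (S \<times> PiE J (\<lambda>_. S)) (PiE (insert p J) (\<lambda>_. S))"
    unfolding bij_betw_def using inj_combinator[OF assms, of "\<lambda>_. S"] by (simp add: PiE_insert_eq)
  from avg_reindex[OF this, of f] show ?thesis
    by (simp add: avg_times)
qed

text \<open>Fubini for one coordinate: as \<open>F \<sigma>\<close> ignores \<open>p\<close>, the
  value at \<open>p\<close> can be sampled separately. Every step that exposes a single cell, of a
  field or of an input, goes through this lemma.\<close>

lemma avg_reveal: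
  assumes I: "p \<in> I" and S: "finite S" "S \<noteq> {}"
    and indep: "\<And>\<sigma> \<tau> Z. F \<sigma> (Z(p := \<tau>)) = F \<sigma> Z"
  shows "avg (PiE I (\<lambda>_. S)) (\<lambda>Z. F (Z p) Z) = avg S (\<lambda>\<sigma>. avg (PiE I (\<lambda>_. S)) (F \<sigma>))"
proof -
  define J where "J = I - {p}"
  have IJ: "I = insert p J" "p \<notin> J" using I by (auto simp: J_def)
  show ?thesis
    unfolding IJ(1) avg_PiE_insert[OF IJ(2)] using S by (simp add: indep avg_const)
qed

lemma avg_PiE_restrict:
  assumes "finite K" "finite S" "S \<noteq> {}" "J \<inter> K = {}"
  shows "avg (PiE (J \<union> K) (\<lambda>_. S)) (\<lambda>Z. f (restrict Z J)) = avg (PiE J (\<lambda>_. S)) f"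
  using assms(1,4)
proof (induction K)
  case empty
  have "avg (PiE J (\<lambda>_. S)) (\<lambda>Z. f (restrict Z J)) = avg (PiE J (\<lambda>_. S)) f"
    by (intro avg_cong) (auto simp: PiE_restrict)
  then show ?case by (simp only: Un_empty_right)
next
  case (insert p K)
  have r: "restrict (Z(p := \<sigma>)) J = restrict Z J" for Z :: "'a \<Rightarrow> 'b" and \<sigma>
    using insert by (intro restrict_ext) auto
  have "p \<notin> J \<union> K" using insert by auto
  then have "avg (PiE (insert p (J \<union> K)) (\<lambda>_. S)) (\<lambda>Z. f (restrict Z J))
      = avg (PiE (J \<union> K) (\<lambda>_. S)) (\<lambda>Z. f (restrict Z J))"
    using assms by (subst avg_PiE_insert) (auto simp: r avg_const)
  also have "\<dots> = avg (PiE J (\<lambda>_. S)) f" using insert by (intro insert.IH) auto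
  finally show ?case by (simp only: Un_insert_right)
qed

text \<open>A uniformly random function read at distinct arguments gives independent uniform values.
  This turns hashed windows into a uniform field once the windows are distinct.\<close>

lemma avg_PiE_pullback:
  assumes W: "finite W" "w ` J \<subseteq> W" and inj: "inj_on w J" and S: "finite S" "S \<noteq> {}"
  shows "avg (PiE W (\<lambda>_. S)) (\<lambda>G. f (\<lambda>p\<in>J. G (w p))) = avg (PiE J (\<lambda>_. S)) f"
proof -
  have b: "bij_betw (\<lambda>G. \<lambda>p\<in>J. G (w p)) (PiE (w ` J) (\<lambda>_. S)) (PiE J (\<lambda>_. S))"
  proof (rule bij_betw_byWitness[where f' = "\<lambda>Z. \<lambda>y\<in>w ` J. Z (inv_into J w y)"]; intro ballI subsetI ext)
    fix G y assume G: "G \<in> PiE (w ` J) (\<lambda>_. S)"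
    show "(\<lambda>y\<in>w ` J. (\<lambda>p\<in>J. G (w p)) (inv_into J w y)) y = G y"
    proof (cases "y \<in> w ` J")
      case True
      then show ?thesis using inv_into_into[of y w J] f_inv_into_f[of y w J] by simp
    next
      case False
      then show ?thesis using PiE_arb[OF G False] by simp
    qed
  next
    fix Z p assume Z: "Z \<in> PiE J (\<lambda>_. S)"
    show "(\<lambda>p\<in>J. (\<lambda>y\<in>w ` J. Z (inv_into J w y)) (w p)) p = Z p"
      using inv_into_f_f[OF inj, of p] PiE_arb[OF Z, of p] by (cases "p \<in> J") simp_all
  next
    fix Z assume "Z \<in> (\<lambda>G. \<lambda>p\<in>J. G (w p)) ` PiE (w ` J) (\<lambda>_. S)"
    then show "Z \<in> PiE J (\<lambda>_. S)" by auto
  next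
    fix G assume "G \<in> (\<lambda>Z. \<lambda>y\<in>w ` J. Z (inv_into J w y)) ` PiE J (\<lambda>_. S)"
    then obtain Z where Z: "Z \<in> PiE J (\<lambda>_. S)" "G = (\<lambda>y\<in>w ` J. Z (inv_into J w y))" by blast
    have "Z (inv_into J w y) \<in> S" if "y \<in> w ` J" for y
      using inv_into_into[OF that] Z(1) by (rule PiE_mem[rotated])
    then show "G \<in> PiE (w ` J) (\<lambda>_. S)" unfolding Z(2) by simp
  qed
  have r: "(\<lambda>p\<in>J. restrict G (w ` J) (w p)) = (\<lambda>p\<in>J. G (w p))" for G :: "'a \<Rightarrow> 'c"
    by (intro restrict_ext) auto
  have "avg (PiE J (\<lambda>_. S)) f = avg (PiE (w ` J) (\<lambda>_. S)) (\<lambda>G. f (\<lambda>p\<in>J. G (w p)))"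
    by (rule avg_reindex[OF b])
  also have "\<dots> = avg (PiE (w ` J \<union> (W - w ` J)) (\<lambda>_. S)) (\<lambda>G. f (\<lambda>p\<in>J. restrict G (w ` J) (w p)))"
    using W S by (intro avg_PiE_restrict[symmetric]) auto
  also have "w ` J \<union> (W - w ` J) = W" using W by auto
  finally show ?thesis by (simp only: r)
qed

lemma pmf_bind_of_set_avg:
  assumes "finite A" "A \<noteq> {}"
  shows "pmf (pmf_of_set A \<bind> f) True = avg A (\<lambda>a. pmf (f a) True)"
  using assms by (simp add: pmf_bind_pmf_of_set avg_def)

section \<open>Walks on a field of symbols\<close>

type_synonym symbol = "int \<times> nat"

definition near :: "nat \<Rightarrow> int \<Rightarrow> int \<Rightarrow> bool" where
  "near R r0 r \<longleftrightarrow> \<bar>r - r0\<bar> \<le> int R"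

text \<open>Leaving the band freezes the walk instead of aborting it, so the end point alone shows
  whether the band was ever left (\<open>walk_ok_mono\<close>).\<close>

primrec walk :: "(int \<Rightarrow> bool) \<Rightarrow> (index \<Rightarrow> symbol) \<Rightarrow> nat \<Rightarrow> index \<Rightarrow> index" where
  "walk ok Z 0 p = p"
| "walk ok Z (Suc k) p =
    (if ok (snd p) then walk ok Z k (fst p + 1, snd p + fst (Z p)) else p)"

primrec first_mark :: "(int \<Rightarrow> bool) \<Rightarrow> (index \<Rightarrow> symbol) \<Rightarrow> nat \<Rightarrow> index \<Rightarrow> index option" where
  "first_mark ok Z 0 p = None"
| "first_mark ok Z (Suc k) p =
    (if ok (snd p) then
       if snd (Z p) = 0 then Some p else first_mark ok Z k (fst p + 1, snd p + fst (Z p))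
     else None)"

text \<open>The \<open>U\<close> columns after \<open>p1\<close> are walked in full before the mark
  is sought. Acceptance thus certifies that no band interfered, and the search equals the one along
  the unconfined walk (\<open>first_mark_free\<close>), which merged walks share.\<close>

definition stage :: "nat \<Rightarrow> nat \<Rightarrow> nat \<Rightarrow> (index \<Rightarrow> symbol) \<Rightarrow> index \<Rightarrow> index option" where
  "stage T R U Z p =
    (let p1 = walk (near R (snd p)) Z T p; ok = near U (snd p1) in
     if near R (snd p) (snd p1) \<and> ok (snd (walk ok Z U p1)) then first_mark ok Z U p1 else None)"

lemma near_refl [simp]: "near R r r"
  by (simp add: near_def)

lemma walk_frozen: "\<not> ok (snd p) \<Longrightarrow> walk ok Z k p = p"
  by (cases k) auto

lemma walk_add: "walk ok Z (j + k) p = walk ok Z k (walk ok Z j p)"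
  by (induction j arbitrary: p) (auto simp: walk_frozen)

lemma walk_ok_start: "ok (snd (walk ok Z k p)) \<Longrightarrow> ok (snd p)"
  by (cases k) (auto split: if_splits)

lemma walk_ok_mono: "ok (snd (walk ok Z k p)) \<Longrightarrow> j \<le> k \<Longrightarrow> ok (snd (walk ok Z j p))"
  using walk_add[of ok Z j "k - j" p] walk_ok_start[of ok Z "k - j"] by simp

lemma walk_fst: "ok (snd (walk ok Z k p)) \<Longrightarrow> fst (walk ok Z k p) = fst p + int k"
  by (induction k arbitrary: p) (auto split: if_splits)

lemma walk_fst_bounds: "fst p \<le> fst (walk ok Z k p)" "fst (walk ok Z k p) \<le> fst p + int k"
proof -
  have "fst p \<le> fst (walk ok Z k p) \<and> fst (walk ok Z k p) \<le> fst p + int k"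
  proof (induction k arbitrary: p)
    case (Suc k)
    show ?case using Suc[of "(fst p + 1, snd p + fst (Z p))"] by auto
  qed simp
  then show "fst p \<le> fst (walk ok Z k p)" "fst (walk ok Z k p) \<le> fst p + int k" by auto
qed

lemma walk_free: "ok (snd (walk ok Z k p)) \<Longrightarrow> walk ok Z k p = walk (\<lambda>_. True) Z k p"
  by (induction k arbitrary: p) (auto split: if_splits)

lemma walk_cong:
  assumes "\<And>c r. fst p \<le> c \<Longrightarrow> c < fst p + int k \<Longrightarrow> ok r \<Longrightarrow> Z (c, r) = Z' (c, r)"
  shows "walk ok Z k p = walk ok Z' k p"
  using assms
proof (induction k arbitrary: p)
  case (Suc k)
  have "Z p = Z' p" if "ok (snd p)" using Suc.prems[of "fst p" "snd p"] that by simp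
  moreover have "walk ok Z k (fst p + 1, r) = walk ok Z' k (fst p + 1, r)" for r
    using Suc.prems by (intro Suc.IH) auto
  ultimately show ?case by simp
qed simp

lemma walk_upd: "fst q < fst p \<Longrightarrow> walk ok (Z(q := \<tau>)) k p = walk ok Z k p"
  by (rule walk_cong) auto

lemma first_mark_cong:
  assumes "\<And>c r. fst p \<le> c \<Longrightarrow> c < fst p + int k \<Longrightarrow> ok r \<Longrightarrow> Z (c, r) = Z' (c, r)"
  shows "first_mark ok Z k p = first_mark ok Z' k p"
  using assms
proof (induction k arbitrary: p)
  case (Suc k)
  have "Z p = Z' p" if "ok (snd p)" using Suc.prems[of "fst p" "snd p"] that by simp
  moreover have "first_mark ok Z k (fst p + 1, r) = first_mark ok Z' k (fst p + 1, r)" for r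
    using Suc.prems by (intro Suc.IH) auto
  ultimately show ?case by simp
qed simp

lemma first_mark_upd: "fst q < fst p \<Longrightarrow> first_mark ok (Z(q := \<tau>)) k p = first_mark ok Z k p"
  by (rule first_mark_cong) auto

lemma first_mark_SomeD:
  "first_mark ok Z k p = Some a \<Longrightarrow> fst p \<le> fst a \<and> fst a < fst p + int k \<and> ok (snd a)"
proof (induction k arbitrary: p)
  case (Suc k)
  then show ?case
    using Suc.IH[of "(fst p + 1, snd p + fst (Z p))"] by (auto split: if_splits)
qed simp

lemma first_mark_add:
  assumes "ok (snd (walk ok Z j p))" "\<And>i. i < j \<Longrightarrow> snd (Z (walk ok Z i p)) \<noteq> 0"
  shows "first_mark ok Z (j + k) p = first_mark ok Z k (walk ok Z j p)"
  using assms
proof (induction j arbitrary: p)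
  case (Suc j)
  have ok: "ok (snd p)" using Suc.prems(1) walk_ok_start by blast
  have "snd (Z p) \<noteq> 0" using Suc.prems(2)[of 0] by simp
  moreover have "snd (Z (walk ok Z i (fst p + 1, snd p + fst (Z p)))) \<noteq> 0" if "i < j" for i
    using Suc.prems(2)[of "Suc i"] that ok by simp
  ultimately show ?case using Suc ok by simp
qed simp

lemma first_mark_mono: "first_mark ok Z k p = Some a \<Longrightarrow> k \<le> k' \<Longrightarrow> first_mark ok Z k' p = Some a"
proof (induction k arbitrary: p k')
  case (Suc k)
  then show ?case by (cases k') (auto split: if_splits)
qed simp

lemma first_mark_free:
  "ok (snd (walk ok Z k p)) \<Longrightarrow> first_mark ok Z k p = first_mark (\<lambda>_. True) Z k p"
  by (induction k arbitrary: p) (auto split: if_splits)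

lemma stage_SomeD:
  assumes "stage T R U Z p = Some a"
  shows "near R (snd p) (snd (walk (near R (snd p)) Z T p))"
    and "fst (walk (near R (snd p)) Z T p) = fst p + int T"
    and "fst p + int T \<le> fst a" "fst a < fst p + int T + int U"
    and "\<bar>snd a - snd (walk (near R (snd p)) Z T p)\<bar> \<le> int U"
    and "\<bar>snd a - snd p\<bar> \<le> int (R + U)"
proof -
  define p1 where "p1 = walk (near R (snd p)) Z T p"
  have *: "near R (snd p) (snd p1)" "first_mark (near U (snd p1)) Z U p1 = Some a"
    using assms by (auto simp: stage_def p1_def Let_def split: if_splits)
  show 1: "near R (snd p) (snd (walk (near R (snd p)) Z T p))" using * p1_def by simp
  show 2: "fst (walk (near R (snd p)) Z T p) = fst p + int T" by (rule walk_fst[of "near R (snd p)", OF 1])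
  show "fst p + int T \<le> fst a" "fst a < fst p + int T + int U"
    using first_mark_SomeD[OF *(2)] 2 by (auto simp: p1_def)
  show "\<bar>snd a - snd (walk (near R (snd p)) Z T p)\<bar> \<le> int U"
    using first_mark_SomeD[OF *(2)] by (auto simp: p1_def near_def)
  then show "\<bar>snd a - snd p\<bar> \<le> int (R + U)"
    using *(1) unfolding p1_def near_def by linarith
qed

definition strip :: "nat \<Rightarrow> nat \<Rightarrow> index \<Rightarrow> index set" where
  "strip w v p = {fst p..<fst p + int w} \<times> {snd p - int v..snd p + int v}"

lemma stage_cong:
  assumes "\<And>q. q \<in> strip (T + U) (R + U) p \<Longrightarrow> Z q = Z' q"
  shows "stage T R U Z p = stage T R U Z' p"
proof -
  define p1 where "p1 = walk (near R (snd p)) Z T p"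
  have p1: "p1 = walk (near R (snd p)) Z' T p"
    unfolding p1_def by (intro walk_cong assms) (auto simp: strip_def near_def)
  show ?thesis
  proof (cases "near R (snd p) (snd p1)")
    case True
    then have "fst p1 = fst p + int T" unfolding p1_def by (rule walk_fst)
    \<comment> \<open>The second band is centred at the end of the first walk, so the margins add up
      to \<open>R + U\<close>.\<close>
    then have *: "Z (c, r) = Z' (c, r)"
      if "fst p1 \<le> c" "c < fst p1 + int U" "near U (snd p1) r" for c r
      using that True by (intro assms) (auto simp: strip_def near_def)
    show ?thesis
      using walk_cong[of p1 U "near U (snd p1)" Z Z'] first_mark_cong[of p1 U "near U (snd p1)" Z Z'] *
      unfolding stage_def p1[symmetric] p1_def[symmetric] by (simp add: Let_def)
  next
    case False
    then show ?thesis unfolding stage_def p1[symmetric] p1_def[symmetric] by (simp add: Let_def)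
  qed
qed

section \<open>Translation invariance of a stage\<close>

definition translate :: "index \<Rightarrow> (index \<Rightarrow> symbol) \<Rightarrow> index \<Rightarrow> symbol" where
  "translate e Z p = Z (p + e)"

lemma walk_translate:
  "walk (\<lambda>r. ok (r + snd e)) (translate e Z) k p + e = walk ok Z k (p + e)"
proof (induction k arbitrary: p)
  case (Suc k)
  show ?case
    using Suc[of "(fst p + 1, snd p + fst (Z (p + e)))"]
    by (cases p; cases e) (auto simp: translate_def algebra_simps)
qed simp

lemma first_mark_translate:
  "map_option (\<lambda>p. p + e) (first_mark (\<lambda>r. ok (r + snd e)) (translate e Z) k p) = first_mark ok Z k (p + e)"
proof (induction k arbitrary: p)
  case (Suc k)
  show ?case
    using Suc[of "(fst p + 1, snd p + fst (Z (p + e)))"]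
    by (cases p; cases e) (auto simp: translate_def algebra_simps)
qed simp

lemma near_translate: "near R (r0 + t) (r + t) = near R r0 r"
  by (simp add: near_def)

text \<open>Bands are relative to the starting row, so nothing in a stage refers to absolute
  coordinates: shifting the field amounts to moving the start.\<close>

lemma stage_translate:
  "map_option (\<lambda>p. p + e) (stage T R U (translate e Z) p) = stage T R U Z (p + e)"
proof -
  have w: "(\<lambda>r. near R' (snd q + snd e) (r + snd e)) = near R' (snd q)" for R' q
    by (simp add: near_translate)
  have 1: "walk (near R' (snd q)) (translate e Z) k q + e = walk (near R' (snd q + snd e)) Z k (q + e)" for R' q k
    using walk_translate[of "near R' (snd q + snd e)" e Z k q] by (simp add: w)
  have 2: "map_option (\<lambda>p. p + e) (first_mark (near R' (snd q)) (translate e Z) k q)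
      = first_mark (near R' (snd q + snd e)) Z k (q + e)" for R' q k
    using first_mark_translate[of e "near R' (snd q + snd e)" Z k q] by (simp add: w)
  define p1 where "p1 = walk (near R (snd p)) (translate e Z) T p"
  have p1: "walk (near R (snd p + snd e)) Z T (p + e) = p1 + e" using 1 p1_def by simp
  define p2 where "p2 = walk (near U (snd p1)) (translate e Z) U p1"
  have p2: "walk (near U (snd p1 + snd e)) Z U (p1 + e) = p2 + e" using 1 p2_def by simp
  show ?thesis
    unfolding stage_def p1_def[symmetric] snd_add p1 p2_def[symmetric] p2 Let_def
    by (simp add: p2_def[symmetric] p2 near_translate 2)
qed

section \<open>Walks on a uniformly random field\<close>

definition steps :: "nat \<Rightarrow> int set" where
  "steps L = {- int L..int L}"

definition symbols :: "nat \<Rightarrow> nat \<Rightarrow> symbol set" where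
  "symbols L M = steps L \<times> {0..<M}"

definition field_avg :: "index set \<Rightarrow> nat \<Rightarrow> nat \<Rightarrow> ((index \<Rightarrow> symbol) \<Rightarrow> real) \<Rightarrow> real" where
  "field_avg Reg L M f = avg (\<Pi>\<^sub>E p\<in>Reg. symbols L M) f"

lemma finite_steps [simp]: "finite (steps L)" and steps_nonempty [simp]: "steps L \<noteq> {}"
  by (auto simp: steps_def)

lemma finite_symbols [simp]: "finite (symbols L M)"
  by (simp add: symbols_def)

lemma symbols_nonempty [simp]: "M \<ge> 1 \<Longrightarrow> symbols L M \<noteq> {}"
  by (simp add: symbols_def)

lemma sum_steps_odd:
  assumes "\<And>x. g (- x) = - g x"
  shows "(\<Sum>x\<in>steps L. g x) = (0::real)"
proof -
  have "(\<Sum>x\<in>steps L. g x) = (\<Sum>x\<in>steps L. g (- x))"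
    by (rule sum.reindex_bij_witness[of _ uminus uminus]) (auto simp: steps_def)
  also have "\<dots> = - (\<Sum>x\<in>steps L. g x)" by (simp add: assms sum_negf)
  finally show ?thesis by simp
qed

lemma avg_steps_odd: "(\<And>x. g (- x) = - g x) \<Longrightarrow> avg (steps L) g = 0"
  by (simp add: avg_def sum_steps_odd)

lemma avg_symbols_fst: "M \<ge> 1 \<Longrightarrow> avg (symbols L M) (\<lambda>\<sigma>. g (fst \<sigma>)) = avg (steps L) g"
  by (simp add: symbols_def avg_times avg_const)

lemma avg_symbols_mark: "M \<ge> 1 \<Longrightarrow> avg (symbols L M) (\<lambda>\<sigma>. of_bool (snd \<sigma> = 0)) = 1 / real M"
proof -
  assume "M \<ge> 1"
  then have "(\<Sum>m\<in>{0..<M}. of_bool (m = 0) :: real) = 1"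
    by (simp add: of_bool_def sum.delta)
  then show ?thesis by (simp add: symbols_def avg_times avg_const) (simp add: avg_def)
qed

text \<open>The \<open>sinh\<close> term of the addition formula is odd in the step and averages to
  0, so a step multiplies the exponential moment by at most \<open>cosh (a * L)\<close>.\<close>

lemma avg_steps_cosh: "avg (steps L) (\<lambda>\<xi>. cosh (a * (y + real_of_int \<xi>))) \<le> cosh (a * y) * cosh (a * real L)"
proof -
  have "avg (steps L) (\<lambda>\<xi>. cosh (a * (y + real_of_int \<xi>)))
      = cosh (a * y) * avg (steps L) (\<lambda>\<xi>. cosh (a * real_of_int \<xi>))
        + sinh (a * y) * avg (steps L) (\<lambda>\<xi>. sinh (a * real_of_int \<xi>))"
    by (simp add: distrib_left cosh_add avg_add avg_cmult)
  also have "avg (steps L) (\<lambda>\<xi>. sinh (a * real_of_int \<xi>)) = 0"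
    by (rule avg_steps_odd) simp
  also have "avg (steps L) (\<lambda>\<xi>. cosh (a * real_of_int \<xi>)) \<le> cosh (a * real L)"
  proof (rule avg_le_const)
    fix \<xi> assume "\<xi> \<in> steps L"
    then have "\<bar>real_of_int \<xi>\<bar> \<le> real L" by (auto simp: steps_def abs_le_iff)
    then have "\<bar>a * real_of_int \<xi>\<bar> \<le> \<bar>a * real L\<bar>" by (simp add: abs_mult mult_left_mono)
    then have "cosh \<bar>a * real_of_int \<xi>\<bar> \<le> cosh \<bar>a * real L\<bar>" by (subst cosh_real_nonneg_le_iff) auto
    then show "cosh (a * real_of_int \<xi>) \<le> cosh (a * real L)" by (simp add: cosh_real_abs)
  qed auto
  finally show ?thesis by (simp add: mult_left_mono)
qed

lemma cosh_le_exp_sq: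
  fixes b :: real
  assumes "0 \<le> b" "b \<le> 1"
  shows "cosh b \<le> exp (b\<^sup>2)"
proof -
  have "exp b \<le> 1 + b + b\<^sup>2" using exp_bound[of b] assms by simp
  moreover have "exp (- b) \<le> 1 - b + b\<^sup>2"
  proof -
    have "1 \<le> (1 + b) * (1 - b + b\<^sup>2)" using assms by (simp add: algebra_simps power2_eq_square)
    also have "\<dots> \<le> exp b * (1 - b + b\<^sup>2)"
      using assms exp_ge_add_one_self[of b] by (intro mult_right_mono) auto
    finally show ?thesis by (simp add: exp_minus field_simps)
  qed
  ultimately have "cosh b \<le> 1 + b\<^sup>2" by (simp add: cosh_def)
  also have "\<dots> \<le> exp (b\<^sup>2)" using exp_ge_add_one_self[of "b\<^sup>2"] by simp
  finally show ?thesis .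
qed

lemma field_avg_mono: "(\<And>Z. f Z \<le> g Z) \<Longrightarrow> field_avg Reg L M f \<le> field_avg Reg L M g"
  unfolding field_avg_def by (rule avg_mono)

lemma field_avg_add: "field_avg Reg L M (\<lambda>Z. f Z + g Z) = field_avg Reg L M f + field_avg Reg L M g"
  unfolding field_avg_def by (rule avg_add)

lemma field_avg_cmult: "field_avg Reg L M (\<lambda>Z. c * f Z) = c * field_avg Reg L M f"
  unfolding field_avg_def by (rule avg_cmult)

lemma field_avg_sum: "field_avg Reg L M (\<lambda>Z. \<Sum>i\<in>I. f i Z) = (\<Sum>i\<in>I. field_avg Reg L M (f i))"
  unfolding field_avg_def by (rule avg_sum)

section \<open>Expectations along a single walk\<close>

locale uniform_field =
  fixes Reg :: "index set" and L M :: nat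
  assumes fin: "finite Reg" and L: "L \<ge> 1" and M: "M \<ge> 1"
begin

abbreviation E :: "((index \<Rightarrow> symbol) \<Rightarrow> real) \<Rightarrow> real" where
  "E \<equiv> field_avg Reg L M"

lemma fields: "finite (\<Pi>\<^sub>E p\<in>Reg. symbols L M)" "(\<Pi>\<^sub>E p\<in>Reg. symbols L M) \<noteq> {}"
  using fin M by (auto intro!: finite_PiE simp: PiE_eq_empty_iff)

lemma E_const: "E (\<lambda>_. c) = c"
  unfolding field_avg_def using fields by (rule avg_const)

lemma E_le_const: "(\<And>Z. f Z \<le> c) \<Longrightarrow> E f \<le> c"
  using field_avg_mono[of f "\<lambda>_. c" Reg L M] by (simp add: E_const)

lemma E_reveal:
  assumes "p \<in> Reg" "\<And>\<sigma> \<tau> Z. F \<sigma> (Z(p := \<tau>)) = F \<sigma> Z"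
  shows "E (\<lambda>Z. F (Z p) Z) = avg (symbols L M) (\<lambda>\<sigma>. E (F \<sigma>))"
  unfolding field_avg_def using assms M by (intro avg_reveal) auto

text \<open>Backward induction: \<open>V j r\<close> bounds the expectation when \<open>j\<close>
  columns remain and the walk is in row \<open>r\<close>. A walk never returns to a column, so the
  current cell can be revealed independently of everything later; \<open>upd\<close> asks the same
  of \<open>f\<close>. The premise \<open>frozen\<close> covers walks that are stuck at or before
  column \<open>cb\<close>.\<close>

lemma walk_supermartingale:
  assumes Reg: "\<And>r c. ok r \<Longrightarrow> ca \<le> c \<Longrightarrow> c < cb \<Longrightarrow> (c, r) \<in> Reg"
    and upd: "\<And>p q \<tau> Z. fst q < fst p \<Longrightarrow> fst p \<le> cb \<Longrightarrow> f p (Z(q := \<tau>)) = f p Z"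
    and base: "\<And>r. ok r \<Longrightarrow> E (f (cb, r)) \<le> V 0 r"
    and frozen: "\<And>p j. \<not> ok (snd p) \<Longrightarrow> fst p \<le> cb \<Longrightarrow> E (f p) \<le> V j (snd p)"
    and step: "\<And>r j. ok r \<Longrightarrow> avg (steps L) (\<lambda>\<xi>. V j (r + \<xi>)) \<le> V (Suc j) r"
  shows "ca \<le> fst p \<Longrightarrow> fst p + int k = cb \<Longrightarrow> E (\<lambda>Z. f (walk ok Z k p) Z) \<le> V k (snd p)"
proof (induction k arbitrary: p)
  case 0
  then show ?case
    using base[of "snd p"] frozen[of p 0] by (cases p; cases "ok (snd p)") auto
next
  case (Suc k)
  show ?case
  proof (cases "ok (snd p)")
    case True
    define F where "F \<sigma> Z = (let q = walk ok Z k (fst p + 1, snd p + fst \<sigma>) in f q Z)" for \<sigma> :: symbol and Z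
    have "p \<in> Reg" using Reg[OF True, of "fst p"] Suc.prems by simp
    moreover have "F \<sigma> (Z(p := \<tau>)) = F \<sigma> Z" for \<sigma> \<tau> Z
    proof -
      have w: "walk ok (Z(p := \<tau>)) k (fst p + 1, snd p + fst \<sigma>) = walk ok Z k (fst p + 1, snd p + fst \<sigma>)"
        by (rule walk_upd) simp
      show ?thesis
        unfolding F_def w Let_def
        using walk_fst_bounds[where p = "(fst p + 1, snd p + fst \<sigma>)" and ok = ok and Z = Z and k = k] Suc.prems by (intro upd) auto
    qed
    ultimately have "E (\<lambda>Z. F (Z p) Z) = avg (symbols L M) (\<lambda>\<sigma>. E (F \<sigma>))" by (rule E_reveal)
    also have "\<dots> \<le> avg (symbols L M) (\<lambda>\<sigma>. V k (snd p + fst \<sigma>))"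
      using Suc.IH[of "(fst p + 1, snd p + x)" for x] Suc.prems
      by (intro avg_mono) (simp add: F_def[abs_def] Let_def)
    also have "\<dots> = avg (steps L) (\<lambda>\<xi>. V k (snd p + \<xi>))" using M by (rule avg_symbols_fst)
    also have "\<dots> \<le> V (Suc k) (snd p)" by (rule step[OF True])
    finally show ?thesis using True by (simp add: F_def[abs_def] Let_def)
  next
    case False
    then show ?thesis using frozen[OF False] Suc.prems by simp
  qed
qed

text \<open>A Chernoff bound from the supermartingale with \<open>cosh (a * y)\<close>,
  \<open>a = 1 / (L * s)\<close>: a step costs a factor of at most
  \<open>exp (1 / s\<^sup>2)\<close>, hence \<open>k\<close> steps a factor of at most e. Because
  exits are frozen, exits at any time are counted.\<close>

lemma frozen_prob:
  fixes s :: real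
  assumes Reg: "strip k R p \<subseteq> Reg" and s: "s \<ge> 1" "real k \<le> s\<^sup>2"
  shows "E (\<lambda>Z. of_bool (\<not> near R (snd p) (snd (walk (near R (snd p)) Z k p)))) \<le> 6 * exp (- real R / (L * s))"
proof -
  define a where "a = 1 / (L * s)"
  have a: "a > 0" "a * L = 1 / s" using s L by (auto simp: a_def field_simps)
  define y where "y r = real_of_int (r - snd p)" for r
  define V where "V j r = exp (1 / s\<^sup>2) ^ j * cosh (a * y r) / cosh (a * real R)" for j :: nat and r
  have "E (\<lambda>Z. of_bool (\<not> near R (snd p) (snd (walk (near R (snd p)) Z k p)))) \<le> V k (snd p)"
  proof (rule walk_supermartingale[where f = "\<lambda>p' Z. of_bool (\<not> near R (snd p) (snd p'))" and ca = "fst p" and cb = "fst p + int k"])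
    show "(c, r) \<in> Reg" if "near R (snd p) r" "fst p \<le> c" "c < fst p + int k" for r c
      using that by (intro subsetD[OF Reg]) (auto simp: strip_def near_def)
    show "E (\<lambda>Z. of_bool (\<not> near R (snd p) (snd (fst p + int k, r)))) \<le> V 0 r" if "near R (snd p) r" for r
      using that by (simp add: E_const V_def)
    show "E (\<lambda>Z. of_bool (\<not> near R (snd p) (snd p'))) \<le> V j (snd p')" if "\<not> near R (snd p) (snd p')" for p' j
    proof -
      have "\<bar>a * real R\<bar> \<le> \<bar>a * y (snd p')\<bar>"
        using that a by (auto simp: near_def y_def abs_mult)
      then have "cosh \<bar>a * real R\<bar> \<le> cosh \<bar>a * y (snd p')\<bar>" by (subst cosh_real_nonneg_le_iff) auto
      then have "cosh (a * real R) \<le> cosh (a * y (snd p'))" by (simp only: cosh_real_abs)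
      moreover have "1 \<le> exp (1 / s\<^sup>2) ^ j" by (intro one_le_power) simp
      ultimately have "1 * cosh (a * real R) \<le> exp (1 / s\<^sup>2) ^ j * cosh (a * y (snd p'))"
        by (intro mult_mono) auto
      then show ?thesis using that by (simp add: E_const V_def cosh_real_pos field_simps)
    qed
    show "avg (steps L) (\<lambda>\<xi>. V j (r + \<xi>)) \<le> V (Suc j) r" for r j
    proof -
      have "avg (steps L) (\<lambda>\<xi>. cosh (a * y (r + \<xi>))) \<le> cosh (a * y r) * cosh (a * real L)"
        using avg_steps_cosh[of L a "y r"] by (simp add: y_def algebra_simps)
      also have "\<dots> \<le> cosh (a * y r) * exp (1 / s\<^sup>2)"
        using cosh_le_exp_sq[of "1 / s"] s unfolding a by (intro mult_left_mono) (auto simp: power_divide)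
      finally have "exp (1 / s\<^sup>2) ^ j / cosh (a * real R) * avg (steps L) (\<lambda>\<xi>. cosh (a * y (r + \<xi>)))
          \<le> exp (1 / s\<^sup>2) ^ j / cosh (a * real R) * (cosh (a * y r) * exp (1 / s\<^sup>2))"
        by (rule mult_left_mono) (simp add: less_imp_le[OF cosh_real_pos])
      moreover have "avg (steps L) (\<lambda>\<xi>. V j (r + \<xi>))
          = exp (1 / s\<^sup>2) ^ j / cosh (a * real R) * avg (steps L) (\<lambda>\<xi>. cosh (a * y (r + \<xi>)))"
        unfolding avg_cmult[symmetric] V_def by (intro avg_cong) simp
      ultimately show ?thesis by (simp add: V_def mult_ac)
    qed
  qed auto
  also have "V k (snd p) \<le> exp 1 / cosh (a * real R)"
  proof -
    have "exp (1 / s\<^sup>2) ^ k = exp (real k / s\<^sup>2)" by (simp add: exp_of_nat_mult[symmetric])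
    also have "\<dots> \<le> exp 1" using s by simp
    finally show ?thesis by (simp add: V_def y_def divide_right_mono less_imp_le[OF cosh_real_pos])
  qed
  \<comment> \<open>6 = 2 * 3, from \<open>exp x \<le> 2 * cosh x\<close> and e \<le> 3.\<close>
  also have "\<dots> \<le> 6 * exp (- (a * real R))"
  proof -
    have "exp (a * real R) \<le> 2 * cosh (a * real R)" by (simp add: cosh_def)
    then have "exp 1 * exp (a * real R) \<le> 3 * (2 * cosh (a * real R))"
      using exp_le by (intro mult_mono) auto
    then show ?thesis by (simp add: exp_minus field_simps cosh_real_pos)
  qed
  finally show ?thesis by (simp add: a_def)
qed

text \<open>The route to the cell reached after \<open>j\<close> steps depends on earlier columns
  only, so the mark in that cell is still fresh.\<close>

lemma mark_prob:
  assumes Reg: "\<And>r c. ok r \<Longrightarrow> fst p \<le> c \<Longrightarrow> c \<le> fst p + int j \<Longrightarrow> (c, r) \<in> Reg"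
  shows "E (\<lambda>Z. of_bool (ok (snd (walk ok Z j p)) \<and> snd (Z (walk ok Z j p)) = 0)) \<le> 1 / real M"
proof (rule walk_supermartingale[where f = "\<lambda>q Z. of_bool (ok (snd q) \<and> snd (Z q) = 0)" and V = "\<lambda>_ _. 1 / real M" and ca = "fst p" and cb = "fst p + int j"])
  show "E (\<lambda>Z. of_bool (ok (snd (fst p + int j, r)) \<and> snd (Z (fst p + int j, r)) = 0)) \<le> 1 / real M" if "ok r" for r
    using E_reveal[of "(fst p + int j, r)" "\<lambda>\<sigma> Z. of_bool (snd \<sigma> = 0)"] Reg[OF that] M that
    by (simp add: E_const avg_symbols_mark)
qed (use Reg in \<open>auto simp: E_const avg_const\<close>)

text \<open>The bound for the remaining columns is uniform in the row, so the step taken from the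
  current cell is irrelevant and each column contributes the factor
  \<open>1 - 1 / M\<close>.\<close>

lemma no_mark_prob:
  assumes Reg: "\<And>r c. ok r \<Longrightarrow> fst p \<le> c \<Longrightarrow> c < fst p + int k \<Longrightarrow> (c, r) \<in> Reg"
  shows "E (\<lambda>Z. of_bool (ok (snd (walk ok Z k p)) \<and> first_mark ok Z k p = None)) \<le> (1 - 1 / real M) ^ k"
  using assms
proof (induction k arbitrary: p)
  case 0
  then show ?case by (simp add: E_le_const)
next
  case (Suc k)
  have nn: "0 \<le> 1 - 1 / real M" using M by simp
  show ?case
  proof (cases "ok (snd p)")
    case True
    define G where "G \<xi> Z = (of_bool (ok (snd (walk ok Z k (fst p + 1, snd p + \<xi>))) \<and>
        first_mark ok Z k (fst p + 1, snd p + \<xi>) = None) :: real)" for \<xi> Z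
    define F where "F \<sigma> Z = of_bool (snd \<sigma> \<noteq> 0) * G (fst \<sigma>) Z" for \<sigma> :: symbol and Z
    have "p \<in> Reg" using Suc.prems[OF True, of "fst p"] by simp
    moreover have "F \<sigma> (Z(p := \<tau>)) = F \<sigma> Z" for \<sigma> \<tau> Z
      by (simp add: F_def G_def walk_upd first_mark_upd)
    ultimately have "E (\<lambda>Z. F (Z p) Z) = avg (symbols L M) (\<lambda>\<sigma>. E (F \<sigma>))" by (rule E_reveal)
    also have "\<dots> \<le> avg (symbols L M) (\<lambda>\<sigma>. (1 - of_bool (snd \<sigma> = 0)) * (1 - 1 / real M) ^ k)"
    proof (rule avg_mono)
      fix \<sigma> :: symbol
      have "E (G (fst \<sigma>)) \<le> (1 - 1 / real M) ^ k"
        unfolding G_def using Suc.prems by (intro Suc.IH) auto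
      then show "E (F \<sigma>) \<le> (1 - of_bool (snd \<sigma> = 0)) * (1 - 1 / real M) ^ k"
        by (simp add: F_def[abs_def] field_avg_cmult E_const)
    qed
    also have "\<dots> = avg (symbols L M) (\<lambda>\<sigma>. (1 - 1 / real M) ^ k - (1 - 1 / real M) ^ k * of_bool (snd \<sigma> = 0))"
      by (intro avg_cong) (simp add: algebra_simps)
    also have "\<dots> = (1 - 1 / real M) ^ Suc k"
      using M by (simp only: avg_diff avg_cmult avg_symbols_mark) (simp add: avg_const algebra_simps)
    also have "(\<lambda>Z. F (Z p) Z) = (\<lambda>Z. of_bool (ok (snd (walk ok Z (Suc k) p)) \<and> first_mark ok Z (Suc k) p = None))"
      using True by (auto simp: F_def G_def fun_eq_iff)
    finally show ?thesis .
  next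
    case False
    then show ?thesis using nn by (simp add: E_const)
  qed
qed

end

section \<open>Rejection, early marks and displacement in one stage\<close>

context uniform_field
begin

text \<open>The Markov property at column \<open>fst p + T\<close>: a functional that ignores
  earlier columns is estimated from a deterministic start, uniformly over the rows of the
  band.\<close>

lemma after_walk_bound:
  assumes Reg: "strip T R p \<subseteq> Reg" and b: "0 \<le> b"
    and upd: "\<And>p q \<tau> Z. fst q < fst p \<Longrightarrow> g p (Z(q := \<tau>)) = g p Z"
    and base: "\<And>r. near R (snd p) r \<Longrightarrow> E (g (fst p + int T, r)) \<le> b"
  shows "E (\<lambda>Z. of_bool (near R (snd p) (snd (walk (near R (snd p)) Z T p))) * g (walk (near R (snd p)) Z T p) Z) \<le> b"
proof (rule walk_supermartingale[where f = "\<lambda>q Z. of_bool (near R (snd p) (snd q)) * g q Z" and ca = "fst p"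
    and cb = "fst p + int T" and V = "\<lambda>_ _. b"])
  show "(c, r) \<in> Reg" if "near R (snd p) r" "fst p \<le> c" "c < fst p + int T" for r c
    using that by (intro subsetD[OF Reg]) (auto simp: strip_def near_def)
qed (use base upd b in \<open>auto simp: E_const avg_const\<close>)

text \<open>The three terms are the three ways to reject: leaving the first band, leaving the second
  band, finding no mark.\<close>

lemma stage_None_prob:
  fixes s s' :: real
  assumes Reg: "strip (T + U) (R + U) p \<subseteq> Reg"
    and s: "s \<ge> 1" "real T \<le> s\<^sup>2" and s': "s' \<ge> 1" "real U \<le> s'\<^sup>2"
  shows "E (\<lambda>Z. of_bool (stage T R U Z p = None))
    \<le> 6 * exp (- real R / (L * s)) + (6 * exp (- real U / (L * s')) + (1 - 1 / real M) ^ U)"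
proof -
  let ?ok = "near R (snd p)"
  let ?w = "\<lambda>Z. walk ?ok Z T p"
  define g where "g q Z = (of_bool (\<not> near U (snd q) (snd (walk (near U (snd q)) Z U q)))
      + of_bool (near U (snd q) (snd (walk (near U (snd q)) Z U q)) \<and> first_mark (near U (snd q)) Z U q = None) :: real)" for q Z
  have "E (\<lambda>Z. of_bool (stage T R U Z p = None))
      \<le> E (\<lambda>Z. of_bool (\<not> ?ok (snd (?w Z))) + of_bool (?ok (snd (?w Z))) * g (?w Z) Z)"
    by (rule field_avg_mono) (auto simp: stage_def Let_def g_def)
  also have "\<dots> = E (\<lambda>Z. of_bool (\<not> ?ok (snd (?w Z)))) + E (\<lambda>Z. of_bool (?ok (snd (?w Z))) * g (?w Z) Z)"
    by (rule field_avg_add)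
  also have "E (\<lambda>Z. of_bool (\<not> ?ok (snd (?w Z)))) \<le> 6 * exp (- real R / (L * s))"
    by (rule frozen_prob[OF _ s]) (use Reg in \<open>auto simp: strip_def\<close>)
  also have "E (\<lambda>Z. of_bool (?ok (snd (?w Z))) * g (?w Z) Z) \<le> 6 * exp (- real U / (L * s')) + (1 - 1 / real M) ^ U"
  proof (rule after_walk_bound)
    show "strip T R p \<subseteq> Reg" using Reg by (auto simp: strip_def)
    show "0 \<le> 6 * exp (- real U / (L * s')) + (1 - 1 / real M) ^ U" using M by simp
    show "g p (Z(q := \<tau>)) = g p Z" if "fst q < fst p" for p q \<tau> Z
      using that by (simp add: g_def walk_upd first_mark_upd)
    show "E (g (fst p + int T, r)) \<le> 6 * exp (- real U / (L * s')) + (1 - 1 / real M) ^ U" if "near R (snd p) r" for r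
    proof -
      let ?q = "(fst p + int T, r)"
      have sub: "strip U U ?q \<subseteq> Reg"
      proof
        fix x assume "x \<in> strip U U ?q"
        then show "x \<in> Reg" using that by (intro subsetD[OF Reg]) (auto simp: strip_def near_def)
      qed
      have "E (\<lambda>Z. of_bool (\<not> near U (snd ?q) (snd (walk (near U (snd ?q)) Z U ?q)))) \<le> 6 * exp (- real U / (L * s'))"
        by (rule frozen_prob[OF sub s'])
      moreover have "E (\<lambda>Z. of_bool (near U (snd ?q) (snd (walk (near U (snd ?q)) Z U ?q)) \<and> first_mark (near U (snd ?q)) Z U ?q = None)) \<le> (1 - 1 / real M) ^ U"
        by (rule no_mark_prob, rule subsetD[OF sub]) (auto simp: strip_def near_def)
      ultimately show ?thesis unfolding g_def[abs_def] field_avg_add by linarith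
    qed
  qed
  finally show ?thesis by simp
qed

text \<open>A union bound over at most \<open>u\<close> cells. They will be the cells between the
  end points of two merged walks, where a mark stops only the search that begins further
  left.\<close>

lemma early_mark_prob:
  assumes Reg: "strip (T + U) (R + U) p \<subseteq> Reg"
  shows "E (\<lambda>Z. let q = walk (near R (snd p)) Z T p in of_bool (near R (snd p) (snd q) \<and>
      (\<exists>j<min u U. near U (snd q) (snd (walk (near U (snd q)) Z j q)) \<and> snd (Z (walk (near U (snd q)) Z j q)) = 0)))
    \<le> real u / real M"
proof -
  let ?w = "\<lambda>Z. walk (near R (snd p)) Z T p"
  define g where "g q Z = (of_bool (\<exists>j<min u U. near U (snd q) (snd (walk (near U (snd q)) Z j q)) \<and> snd (Z (walk (near U (snd q)) Z j q)) = 0) :: real)" for q Z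
  have "E (\<lambda>Z. of_bool (near R (snd p) (snd (?w Z))) * g (?w Z) Z) \<le> real u / real M"
  proof (rule after_walk_bound)
    show "strip T R p \<subseteq> Reg" using Reg by (auto simp: strip_def)
    show "g p (Z(q := \<tau>)) = g p Z" if "fst q < fst p" for p q \<tau> Z
    proof -
      have "walk (near U (snd p)) Z j p \<noteq> q" for j
        using walk_fst_bounds(1)[of p "near U (snd p)" Z j] that by auto
      then show ?thesis using that by (simp add: g_def walk_upd)
    qed
    show "E (g (fst p + int T, r)) \<le> real u / real M" if "near R (snd p) r" for r
    proof -
      define q where "q = (fst p + int T, r)"
      define m where "m j Z = (of_bool (near U (snd q) (snd (walk (near U (snd q)) Z j q)) \<and> snd (Z (walk (near U (snd q)) Z j q)) = 0) :: real)" for j Z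
      have sub: "strip U U q \<subseteq> Reg"
      proof
        fix x assume "x \<in> strip U U q"
        then show "x \<in> Reg" using that by (intro subsetD[OF Reg]) (auto simp: strip_def near_def q_def)
      qed
      have "E (m j) \<le> 1 / real M" if "j < U" for j
        unfolding m_def[abs_def] using that
        by (intro mark_prob, intro subsetD[OF sub]) (auto simp: strip_def near_def)
      then have "(\<Sum>j<min u U. E (m j)) \<le> (\<Sum>j<min u U. 1 / real M)" by (intro sum_mono) auto
      also have "\<dots> \<le> real u / real M" using M by (simp add: divide_right_mono)
      also have "(\<Sum>j<min u U. E (m j)) = E (\<lambda>Z. \<Sum>j<min u U. m j Z)" by (rule field_avg_sum[symmetric])
      finally have "E (\<lambda>Z. \<Sum>j<min u U. m j Z) \<le> real u / real M" .
      moreover have "E (g q) \<le> E (\<lambda>Z. \<Sum>j<min u U. m j Z)"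
      proof (rule field_avg_mono)
        fix Z
        show "g q Z \<le> (\<Sum>j<min u U. m j Z)"
        proof (cases "\<exists>j<min u U. m j Z = 1")
          case True
          then obtain j where "j < min u U" "m j Z = 1" by blast
          then have "1 \<le> (\<Sum>j<min u U. m j Z)"
            using member_le_sum[of j "{..<min u U}" "\<lambda>j. m j Z"] by (simp add: m_def)
          then show ?thesis by (simp add: g_def)
        next
          case False
          then have "g q Z = 0" by (auto simp: g_def m_def)
          moreover have "0 \<le> (\<Sum>j<min u U. m j Z)" by (intro sum_nonneg) (simp add: m_def)
          ultimately show ?thesis by simp
        qed
      qed
      ultimately show ?thesis by (simp add: q_def)
    qed
  qed simp
  then show ?thesis by (simp add: g_def Let_def of_bool_conj)
qed

lemma avg_steps_sq:
  "avg (steps L) (\<lambda>\<xi>. (real_of_int (y + \<xi>))\<^sup>2) \<le> (real_of_int y)\<^sup>2 + (real L)\<^sup>2"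
proof -
  have "avg (steps L) (\<lambda>\<xi>. (real_of_int (y + \<xi>))\<^sup>2)
      = avg (steps L) (\<lambda>\<xi>. (real_of_int y)\<^sup>2 + (2 * real_of_int y * real_of_int \<xi> + (real_of_int \<xi>)\<^sup>2))"
    by (intro avg_cong) (simp add: power2_eq_square algebra_simps)
  also have "\<dots> = (real_of_int y)\<^sup>2 + (2 * real_of_int y * avg (steps L) real_of_int + avg (steps L) (\<lambda>\<xi>. (real_of_int \<xi>)\<^sup>2))"
    by (simp only: avg_add avg_cmult) (simp add: avg_const)
  also have "avg (steps L) real_of_int = 0" by (rule avg_steps_odd) simp
  also have "avg (steps L) (\<lambda>\<xi>. (real_of_int \<xi>)\<^sup>2) \<le> (real L)\<^sup>2"
  proof (rule avg_le_const)
    fix \<xi> assume "\<xi> \<in> steps L"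
    then have "\<bar>real_of_int \<xi>\<bar> \<le> real L" by (auto simp: steps_def abs_le_iff)
    then show "(real_of_int \<xi>)\<^sup>2 \<le> (real L)\<^sup>2" by (metis abs_le_square_iff abs_of_nat)
  qed auto
  finally show ?thesis by simp
qed

text \<open>AM-GM in the form 2 L^2 |y| \<le> y^2 + L^4. As the mean square grows by at most L^2 per
  step, the mean displacement is at most 1/2 per column plus a term in L^2. Linearity in the columns
  allows a column offset to be charged to the distance.\<close>

lemma abs_le_sq: "\<bar>y\<bar> \<le> y\<^sup>2 / (2 * (real L)\<^sup>2) + (real L)\<^sup>2 / 2"
proof -
  have "0 \<le> (\<bar>y\<bar> - (real L)\<^sup>2)\<^sup>2" by simp
  then show ?thesis using L by (simp add: power2_diff field_simps)
qed

lemma avg_steps_energy: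
  "avg (steps L) (\<lambda>\<xi>. (real_of_int (y + \<xi>))\<^sup>2 / (2 * (real L)\<^sup>2) + b) \<le> (real_of_int y)\<^sup>2 / (2 * (real L)\<^sup>2) + 1 / 2 + b"
proof -
  have "avg (steps L) (\<lambda>\<xi>. (real_of_int (y + \<xi>))\<^sup>2) / (2 * (real L)\<^sup>2)
      \<le> ((real_of_int y)\<^sup>2 + (real L)\<^sup>2) / (2 * (real L)\<^sup>2)"
    using avg_steps_sq by (intro divide_right_mono) auto
  also have "\<dots> = (real_of_int y)\<^sup>2 / (2 * (real L)\<^sup>2) + 1 / 2" using L by (simp add: add_divide_distrib)
  finally show ?thesis by (simp only: avg_add avg_divide) (simp add: avg_const)
qed

lemma displacement_bound:
  assumes Reg: "\<And>r c. ok r \<Longrightarrow> fst p \<le> c \<Longrightarrow> c < fst p + int k \<Longrightarrow> (c, r) \<in> Reg"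
  shows "E (\<lambda>Z. real_of_int \<bar>snd (walk ok Z k p) - snd p\<bar>) \<le> real k / 2 + (real L)\<^sup>2 / 2"
proof -
  define V where "V j r = (real_of_int (r - snd p))\<^sup>2 / (2 * (real L)\<^sup>2) + (real j / 2 + (real L)\<^sup>2 / 2)" for j :: nat and r
  have V: "real_of_int \<bar>r - snd p\<bar> \<le> V j r" for j r
    using abs_le_sq[of "real_of_int (r - snd p)"] by (simp add: V_def)
  have "E (\<lambda>Z. real_of_int \<bar>snd (walk ok Z k p) - snd p\<bar>) \<le> V k (snd p)"
  proof (rule walk_supermartingale[where f = "\<lambda>q Z. real_of_int \<bar>snd q - snd p\<bar>" and ca = "fst p" and cb = "fst p + int k"])
    show "avg (steps L) (\<lambda>\<xi>. V j (r + \<xi>)) \<le> V (Suc j) r" for r j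
      using avg_steps_energy[of "r - snd p" "real j / 2 + (real L)\<^sup>2 / 2"]
      by (simp add: V_def algebra_simps add_divide_distrib)
  qed (use Reg V in \<open>simp_all add: E_const\<close>)
  then show ?thesis by (simp add: V_def)
qed

section \<open>Two walks on the same field\<close>

definition pair_cost :: "(int \<Rightarrow> bool) \<Rightarrow> (int \<Rightarrow> bool) \<Rightarrow> (int \<Rightarrow> real) \<Rightarrow> index \<Rightarrow> index \<Rightarrow> real" where
  "pair_cost okA okB f p q = (if okA (snd p) \<and> okB (snd q) then f (snd p - snd q) else 0)"

text \<open>Two walks in one column read distinct cells until they meet, so their steps are
  independent and the row difference is a random walk. From then on they stay together while inside
  their bands, whence \<open>f 0 = 0\<close>. Pairs with a frozen member are charged
  nothing.\<close>

lemma pair_supermartingale: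
  assumes RegA: "\<And>r c. okA r \<Longrightarrow> ca \<le> c \<Longrightarrow> c < cb \<Longrightarrow> (c, r) \<in> Reg"
    and RegB: "\<And>r c. okB r \<Longrightarrow> ca \<le> c \<Longrightarrow> c < cb \<Longrightarrow> (c, r) \<in> Reg"
    and f: "f 0 = 0" "\<And>w. f w \<le> V 0 w" and nn: "\<And>j w. j \<le> K \<Longrightarrow> 0 \<le> V j w"
    and step: "\<And>j w. w \<noteq> 0 \<Longrightarrow> j < K \<Longrightarrow> avg (steps L) (\<lambda>\<xi>. avg (steps L) (\<lambda>\<eta>. V j (w + \<xi> - \<eta>))) \<le> V (Suc j) w"
  shows "ca \<le> c \<Longrightarrow> c + int k = cb \<Longrightarrow> k \<le> K \<Longrightarrow>
    E (\<lambda>Z. pair_cost okA okB f (walk okA Z k (c, a)) (walk okB Z k (c, b))) \<le> V k (a - b)"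
proof (induction k arbitrary: c a b)
  case 0
  then show ?case using f nn by (simp add: pair_cost_def E_const)
next
  case (Suc k)
  consider (same) "a = b" | (dead) "a \<noteq> b" "\<not> (okA a \<and> okB b)" | (alive) "a \<noteq> b" "okA a" "okB b" by blast
  then show ?case
  proof cases
    case same
    have "pair_cost okA okB f (walk okA Z (Suc k) (c, a)) (walk okB Z (Suc k) (c, b)) = 0" for Z
    proof (cases "okA (snd (walk okA Z (Suc k) (c, b))) \<and> okB (snd (walk okB Z (Suc k) (c, b)))")
      case True
      \<comment> \<open>With both end points inside their bands, each confined walk equals the free
        walk from the common start.\<close>
      then have "walk okA Z (Suc k) (c, b) = walk okB Z (Suc k) (c, b)"
        using walk_free[of okA Z "Suc k" "(c, b)"] walk_free[of okB Z "Suc k" "(c, b)"] by metis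
      then show ?thesis by (simp only: pair_cost_def same f(1) diff_self if_cancel)
    qed (simp only: pair_cost_def same if_False)
    then show ?thesis using nn Suc.prems by (simp only: E_const)
  next
    case dead
    have "pair_cost okA okB f (walk okA Z (Suc k) (c, a)) (walk okB Z (Suc k) (c, b)) = 0" for Z
      using dead walk_ok_start[of okA Z "Suc k" "(c, a)"] walk_ok_start[of okB Z "Suc k" "(c, b)"]
      by (auto simp: pair_cost_def simp del: walk.simps)
    then show ?thesis using nn Suc.prems by (simp only: E_const)
  next
    case alive
    define G where "G \<xi> \<eta> Z = pair_cost okA okB f (walk okA Z k (c + 1, a + \<xi>)) (walk okB Z k (c + 1, b + \<eta>))" for \<xi> \<eta> Z
    have G: "G \<xi> \<eta> (Z((c, r) := \<tau>)) = G \<xi> \<eta> Z" for \<xi> \<eta> Z r \<tau>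
      by (simp add: G_def walk_upd)
    \<comment> \<open>The two cells are revealed in turn; \<open>a \<noteq> b\<close> makes them
      different coordinates.\<close>
    have "E (\<lambda>Z. G (fst (Z (c, a))) (fst (Z (c, b))) Z)
        = avg (symbols L M) (\<lambda>\<sigma>. E (\<lambda>Z. G (fst \<sigma>) (fst (Z (c, b))) Z))"
      using RegA[OF alive(2), of c] Suc.prems alive(1)
      by (intro E_reveal[of "(c, a)" "\<lambda>\<sigma> Z. G (fst \<sigma>) (fst (Z (c, b))) Z"]) (auto simp: G)
    also have "\<dots> = avg (symbols L M) (\<lambda>\<sigma>. avg (symbols L M) (\<lambda>\<sigma>'. E (G (fst \<sigma>) (fst \<sigma>'))))"
      using RegB[OF alive(3), of c] Suc.prems
      by (intro avg_cong E_reveal[of "(c, b)" "\<lambda>\<sigma>' Z. G (fst \<sigma>) (fst \<sigma>') Z" for \<sigma>]) (auto simp: G)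
    also have "\<dots> = avg (steps L) (\<lambda>\<xi>. avg (steps L) (\<lambda>\<eta>. E (G \<xi> \<eta>)))"
      by (simp only: avg_symbols_fst[OF M, of L "\<lambda>\<eta>. E (G \<xi> \<eta>)" for \<xi>]
          avg_symbols_fst[OF M, of L "\<lambda>\<xi>. avg (steps L) (\<lambda>\<eta>. E (G \<xi> \<eta>))"])
    also have "\<dots> \<le> avg (steps L) (\<lambda>\<xi>. avg (steps L) (\<lambda>\<eta>. V k (a - b + \<xi> - \<eta>)))"
      using Suc.IH[of "c + 1" "a + \<xi>" "b + \<eta>" for \<xi> \<eta>] Suc.prems
      by (intro avg_mono) (simp add: G_def[abs_def] algebra_simps)
    also have "\<dots> \<le> V (Suc k) (a - b)" using alive Suc.prems by (intro step) simp_all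
    finally show ?thesis using alive by (simp add: G_def)
  qed
qed

end

section \<open>Two walks meeting\<close>

text \<open>The distance alone is not a supermartingale near 0, since steps across 0 are reflected.
  The jump at 0 repairs this: where reflection can occur, the walks meet with probability 1 / (2L +
  1), so the jump gains at least 6L, while reflection costs at most 4L.\<close>

definition potential :: "nat \<Rightarrow> int \<Rightarrow> real" where
  "potential L w = (if w = 0 then 0 else \<bar>real_of_int w\<bar> + 18 * (real L)\<^sup>2)"

lemma potential_minus: "potential L (- w) = potential L w"
  by (simp add: potential_def)

lemma card_steps: "card (steps L) = 2 * L + 1"
  by (simp add: steps_def)

lemma avg_steps_id: "avg (steps L) real_of_int = 0"
  by (rule avg_steps_odd) simp

text \<open>Here \<open>v\<close> is the difference after only one of the walks has moved. For
  \<open>v > L\<close> the other step cannot change its sign and only the linear part matters;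
  otherwise \<open>\<eta> = v\<close> is a possible step, at which the walks meet.\<close>

lemma avg_potential:
  assumes L: "L \<ge> 1" and v: "v \<ge> - int L"
  shows "avg (steps L) (\<lambda>\<eta>. potential L (v - \<eta>)) \<le> real_of_int v + 18 * (real L)\<^sup>2"
proof (cases "v \<le> int L")
  case False
  have "avg (steps L) (\<lambda>\<eta>. potential L (v - \<eta>)) = avg (steps L) (\<lambda>\<eta>. (real_of_int v + 18 * (real L)\<^sup>2) - real_of_int \<eta>)"
    using False by (intro avg_cong) (auto simp: potential_def steps_def)
  also have "\<dots> = real_of_int v + 18 * (real L)\<^sup>2"
    by (simp only: avg_diff avg_steps_id) (simp add: avg_const)
  finally show ?thesis by simp
next
  case True
  then have vs: "v \<in> steps L" using v by (simp add: steps_def)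
  have "avg (steps L) (\<lambda>\<eta>. potential L (v - \<eta>))
      \<le> avg (steps L) (\<lambda>\<eta>. (real_of_int v + 18 * (real L)\<^sup>2 + 4 * real L) - real_of_int \<eta> - 18 * (real L)\<^sup>2 * of_bool (\<eta> = v))"
  proof (rule avg_mono)
    fix \<eta> assume "\<eta> \<in> steps L"
    then have "\<bar>v - \<eta>\<bar> \<le> v - \<eta> + 4 * int L" using vs by (auto simp: steps_def)
    then have "\<bar>real_of_int v - real_of_int \<eta>\<bar> \<le> real_of_int v - real_of_int \<eta> + 4 * real L" by linarith
    then show "potential L (v - \<eta>) \<le> (real_of_int v + 18 * (real L)\<^sup>2 + 4 * real L) - real_of_int \<eta> - 18 * (real L)\<^sup>2 * of_bool (\<eta> = v)"
      by (auto simp: potential_def)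
  qed
  also have "\<dots> = real_of_int v + 18 * (real L)\<^sup>2 + 4 * real L - 18 * (real L)\<^sup>2 * avg (steps L) (\<lambda>\<eta>. of_bool (\<eta> = v))"
    by (simp only: avg_diff avg_cmult avg_steps_id) (simp add: avg_const)
  also have "avg (steps L) (\<lambda>\<eta>. of_bool (\<eta> = v)) = 1 / (2 * real L + 1)"
    using vs by (simp add: avg_def card_steps of_bool_def sum.delta)
  also have "4 * real L \<le> 18 * (real L)\<^sup>2 * (1 / (2 * real L + 1))"
    using L by (simp add: field_simps power2_eq_square)
  finally show ?thesis by simp
qed

lemma potential_drift:
  assumes L: "L \<ge> 1" and w: "w \<noteq> 0"
  shows "avg (steps L) (\<lambda>\<xi>. avg (steps L) (\<lambda>\<eta>. potential L (w + \<xi> - \<eta>))) \<le> potential L w"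
proof -
  have pos: "avg (steps L) (\<lambda>\<xi>. avg (steps L) (\<lambda>\<eta>. potential L (u + \<xi> - \<eta>))) \<le> potential L u" if "u > 0" for u
  proof -
    have "avg (steps L) (\<lambda>\<xi>. avg (steps L) (\<lambda>\<eta>. potential L (u + \<xi> - \<eta>)))
        \<le> avg (steps L) (\<lambda>\<xi>. (real_of_int u + 18 * (real L)\<^sup>2) + real_of_int \<xi>)"
    proof (rule avg_mono)
      fix \<xi> assume "\<xi> \<in> steps L"
      then have "u + \<xi> \<ge> - int L" using that by (auto simp: steps_def)
      from avg_potential[OF L this]
      show "avg (steps L) (\<lambda>\<eta>. potential L (u + \<xi> - \<eta>)) \<le> (real_of_int u + 18 * (real L)\<^sup>2) + real_of_int \<xi>" by simp
    qed
    also have "\<dots> = potential L u"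
      using that by (simp only: avg_add avg_steps_id) (simp add: avg_const potential_def)
    finally show ?thesis .
  qed
  show ?thesis
  proof (cases "w > 0")
    case False
    \<comment> \<open>Exchanging the two walks reverses the sign of the difference.\<close>
    have "avg (steps L) (\<lambda>\<xi>. avg (steps L) (\<lambda>\<eta>. potential L (w + \<xi> - \<eta>)))
        = avg (steps L) (\<lambda>\<eta>. avg (steps L) (\<lambda>\<xi>. potential L (w + \<xi> - \<eta>)))" by (rule avg_swap)
    also have "\<dots> = avg (steps L) (\<lambda>\<eta>. avg (steps L) (\<lambda>\<xi>. potential L (- w + \<eta> - \<xi>)))"
      by (intro avg_cong) (simp add: potential_minus[symmetric, of L "_ + _ - _"] algebra_simps)
    also have "\<dots> \<le> potential L w"
      using pos[of "- w"] False w by (simp add: potential_minus)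
    finally show ?thesis .
  qed (rule pos)
qed

definition step_variance :: "nat \<Rightarrow> real" where
  "step_variance L = 2 * avg (steps L) (\<lambda>\<xi>. (real_of_int \<xi>)\<^sup>2)"

lemma step_variance_eq: "step_variance L = 2 * real L * (real L + 1) / 3"
proof -
  have "(\<Sum>\<xi>\<in>steps L. (real_of_int \<xi>)\<^sup>2) = real L * (real L + 1) * (2 * real L + 1) / 3"
  proof (induction L)
    case (Suc L)
    have "steps (Suc L) = insert (int (Suc L)) (insert (- int (Suc L)) (steps L))"
      by (auto simp: steps_def)
    moreover have "int (Suc L) \<notin> insert (- int (Suc L)) (steps L)" "- int (Suc L) \<notin> steps L"
      by (auto simp: steps_def)
    ultimately have "(\<Sum>\<xi>\<in>steps (Suc L). (real_of_int \<xi>)\<^sup>2)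
        = (real_of_int (int (Suc L)))\<^sup>2 + ((real_of_int (- int (Suc L)))\<^sup>2 + (\<Sum>\<xi>\<in>steps L. (real_of_int \<xi>)\<^sup>2))"
      by (simp only: sum.insert finite_insert finite_steps not_False_eq_True)
    also have "\<dots> = 2 * (real L + 1)\<^sup>2 + (\<Sum>\<xi>\<in>steps L. (real_of_int \<xi>)\<^sup>2)"
      by (simp only: of_int_minus power2_minus of_int_of_nat_eq of_nat_Suc) simp
    also have "\<dots> = 2 * (real L + 1)\<^sup>2 + real L * (real L + 1) * (2 * real L + 1) / 3" by (simp only: Suc)
    also have "\<dots> = (real L + 1) * ((real L + 1) + 1) * (2 * (real L + 1) + 1) / 3"
      by (simp add: field_simps power2_eq_square)
    finally show ?case by (simp only: of_nat_Suc add.commute[of 1])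
  qed (simp add: steps_def)
  then show ?thesis by (simp add: step_variance_def avg_def card_steps field_simps)
qed

lemma square_drift:
  "avg (steps L) (\<lambda>\<xi>. avg (steps L) (\<lambda>\<eta>. (real_of_int (w + \<xi> - \<eta>))\<^sup>2)) = (real_of_int w)\<^sup>2 + step_variance L"
proof -
  define q where "q = avg (steps L) (\<lambda>\<xi>. (real_of_int \<xi>)\<^sup>2)"
  have sq: "avg (steps L) (\<lambda>\<eta>. (x + real_of_int \<eta>)\<^sup>2) = x\<^sup>2 + q" for x
  proof -
    have "avg (steps L) (\<lambda>\<eta>. (x + real_of_int \<eta>)\<^sup>2) = avg (steps L) (\<lambda>\<eta>. x\<^sup>2 + 2 * x * real_of_int \<eta> + (real_of_int \<eta>)\<^sup>2)"
      by (intro avg_cong) (simp add: power2_sum)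
    then show ?thesis by (simp only: avg_add avg_cmult avg_steps_id) (simp add: avg_const q_def)
  qed
  have "avg (steps L) (\<lambda>\<eta>. (real_of_int (w + \<xi> - \<eta>))\<^sup>2) = (real_of_int w + real_of_int \<xi>)\<^sup>2 + q" for \<xi>
  proof -
    have "(real_of_int (w + \<xi> - \<eta>))\<^sup>2 = (- real_of_int (w + \<xi>) + real_of_int \<eta>)\<^sup>2" for \<eta>
      by (simp add: power2_eq_square algebra_simps)
    then show ?thesis by (simp only: sq) (simp add: power2_eq_square algebra_simps)
  qed
  then show ?thesis by (simp add: avg_add sq avg_const step_variance_def q_def[symmetric])
qed

context uniform_field
begin

text \<open>The expected distance does not grow with the number of columns, because
  \<open>potential\<close> dominates it and has no upward drift.\<close>

lemma pair_distance_bound: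
  assumes RegA: "\<And>r c'. okA r \<Longrightarrow> c \<le> c' \<Longrightarrow> c' < c + int k \<Longrightarrow> (c', r) \<in> Reg"
    and RegB: "\<And>r c'. okB r \<Longrightarrow> c \<le> c' \<Longrightarrow> c' < c + int k \<Longrightarrow> (c', r) \<in> Reg"
  shows "E (\<lambda>Z. pair_cost okA okB (\<lambda>w. \<bar>real_of_int w\<bar>) (walk okA Z k (c, a)) (walk okB Z k (c, b))) \<le> potential L (a - b)"
  by (rule pair_supermartingale[where V = "\<lambda>_. potential L" and ca = c and cb = "c + int k" and K = k])
    (use RegA RegB potential_drift[OF L] in \<open>auto simp: potential_def\<close>)

text \<open>While the walks have not met, \<open>4 \<rho> * potential - w\<^sup>2\<close> decreases by the variance of a step
  on average; the cut-off at \<open>\<rho>\<close> keeps it nonnegative.\<close>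

lemma pair_unmerged_bound:
  fixes s :: nat
  assumes RegA: "\<And>r c'. okA r \<Longrightarrow> c \<le> c' \<Longrightarrow> c' < c + int K \<Longrightarrow> (c', r) \<in> Reg"
    and RegB: "\<And>r c'. okB r \<Longrightarrow> c \<le> c' \<Longrightarrow> c' < c + int K \<Longrightarrow> (c', r) \<in> Reg"
    and s: "s \<ge> 1" "K \<le> s\<^sup>2" "s\<^sup>2 \<le> 2 * K"
  shows "E (\<lambda>Z. pair_cost okA okB (\<lambda>w. of_bool (w \<noteq> 0)) (walk okA Z K (c, a)) (walk okB Z K (c, b)))
    \<le> 12 / (real L * real s) * (\<bar>real_of_int (a - b)\<bar> + 18 * (real L)\<^sup>2)"
proof -
  define \<rho> where "\<rho> = real L * real s"
  define v where "v = step_variance L"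
  \<comment> \<open>\<open>j\<close> counts the remaining columns. At \<open>j = 0\<close> the value
    is at least 1 for unmerged pairs below the cut-off; at \<open>j = K\<close> the term in
    \<open>v\<close> has vanished and only the starting potential is paid.\<close>
  define W where "W j w = (v * (real K - real j) + 4 * \<rho> * potential L w - (real_of_int w)\<^sup>2) / (v * real K)" for j w
  define V where "V j w = (if w = 0 then 0 else if \<rho> \<le> \<bar>real_of_int w\<bar> then 1 else min 1 (W j w))" for j w
  have L1: "real L \<ge> 1" using L by simp
  have v: "2 * (real L)\<^sup>2 / 3 \<le> v" "v \<le> 4 * (real L)\<^sup>2 / 3" "v > 0"
    using L1 mult_mono[of 1 "real L" "real L" "real L"]
    by (auto simp: v_def step_variance_eq power2_eq_square field_simps intro!: add_pos_pos)
  have "1 \<le> s\<^sup>2" using s(1) by simp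
  then have K: "K \<ge> 1" using s by linarith
  have \<rho>: "\<rho> \<ge> real L" using s L1 by (simp add: \<rho>_def)
  have vK: "v * real K \<le> 3 * \<rho>\<^sup>2"
  proof -
    have "v * real K \<le> (4 * (real L)\<^sup>2 / 3) * (real s)\<^sup>2"
      using v s(2) by (intro mult_mono) (auto simp flip: of_nat_power)
    also have "\<dots> \<le> 3 * \<rho>\<^sup>2" by (simp add: \<rho>_def power_mult_distrib)
    finally show ?thesis .
  qed
  have Wlower: "4 * \<rho> * \<bar>real_of_int w\<bar> - (real_of_int w)\<^sup>2 \<le> v * real K * W j w" if "j \<le> K" "w \<noteq> 0" for j w
  proof -
    have "v * real K * W j w = v * (real K - real j) + 4 * \<rho> * potential L w - (real_of_int w)\<^sup>2"
      using v K by (simp add: W_def)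
    moreover have "0 \<le> v * (real K - real j)" using v that by simp
    moreover have "4 * \<rho> * \<bar>real_of_int w\<bar> \<le> 4 * \<rho> * potential L w"
      using that \<rho> L1 by (intro mult_left_mono) (auto simp: potential_def)
    ultimately show ?thesis by linarith
  qed
  have sq: "4 * \<rho> * x - x\<^sup>2 = x * (4 * \<rho> - x)" for x by (simp add: power2_eq_square algebra_simps)
  have vKp: "0 < v * real K" using v K by simp
  have Wnn: "0 \<le> W j w" if "j \<le> K" "w \<noteq> 0" "\<bar>real_of_int w\<bar> \<le> 4 * \<rho>" for j w
  proof -
    have "0 \<le> \<bar>real_of_int w\<bar> * (4 * \<rho> - \<bar>real_of_int w\<bar>)" using that by (intro mult_nonneg_nonneg) auto
    then have "0 \<le> v * real K * W j w" using Wlower[OF that(1,2)] sq[of "\<bar>real_of_int w\<bar>"] by simp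
    then show ?thesis using vKp by (simp add: zero_le_mult_iff)
  qed
  \<comment> \<open>On [\<rho>, 3\<rho>] the concave function x (4\<rho> - x) is at least 3\<rho>^2,
    its value at both ends, and this is at least v K. A step changes the difference by at most 2L
    \<le> 2\<rho>, so the interval catches every overshoot from below \<rho>.\<close>
  have Wone: "1 \<le> W j w" if "j \<le> K" "\<rho> \<le> \<bar>real_of_int w\<bar>" "\<bar>real_of_int w\<bar> \<le> 3 * \<rho>" for j w
  proof -
    have "w \<noteq> 0" using that \<rho> L1 by auto
    have "0 \<le> (\<bar>real_of_int w\<bar> - \<rho>) * (3 * \<rho> - \<bar>real_of_int w\<bar>)" using that by (intro mult_nonneg_nonneg) auto
    then have "3 * \<rho>\<^sup>2 \<le> \<bar>real_of_int w\<bar> * (4 * \<rho> - \<bar>real_of_int w\<bar>)" by (simp add: power2_eq_square algebra_simps)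
    then have "v * real K * 1 \<le> v * real K * W j w"
      using Wlower[OF that(1) \<open>w \<noteq> 0\<close>] sq[of "\<bar>real_of_int w\<bar>"] vK by simp
    then show ?thesis using vKp by (simp only: mult_le_cancel_left_pos)
  qed
  have VW: "V j w \<le> W j w" if "j \<le> K" "\<bar>real_of_int w\<bar> \<le> 3 * \<rho>" for j w
  proof (cases "w = 0")
    case True
    then show ?thesis using that v by (simp add: V_def W_def potential_def)
  qed (use Wone that in \<open>auto simp: V_def\<close>)
  have main: "E (\<lambda>Z. pair_cost okA okB (\<lambda>w. of_bool (w \<noteq> 0)) (walk okA Z K (c, a)) (walk okB Z K (c, b))) \<le> V K (a - b)"
  proof (rule pair_supermartingale[where ca = c and cb = "c + int K" and K = K])
    show "of_bool (w \<noteq> 0) \<le> V 0 w" for w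
    proof -
      have "1 \<le> W 0 w" if "w \<noteq> 0" "\<bar>real_of_int w\<bar> < \<rho>"
      proof -
        have "0 \<le> \<bar>real_of_int w\<bar> * (4 * \<rho> - \<bar>real_of_int w\<bar>)" using that by (intro mult_nonneg_nonneg) auto
        also have "\<dots> = 4 * \<rho> * \<bar>real_of_int w\<bar> - (real_of_int w)\<^sup>2" using sq[of "\<bar>real_of_int w\<bar>"] by simp
        also have "\<dots> \<le> 4 * \<rho> * potential L w - (real_of_int w)\<^sup>2"
          using that \<rho> L1 by (intro diff_right_mono mult_left_mono) (auto simp: potential_def)
        finally show ?thesis using vKp by (simp add: W_def)
      qed
      then show ?thesis by (auto simp: V_def not_le)
    qed
    show "0 \<le> V j w" if "j \<le> K" for j w using Wnn[OF that, of w] by (auto simp: V_def)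
    show "avg (steps L) (\<lambda>\<xi>. avg (steps L) (\<lambda>\<eta>. V j (w + \<xi> - \<eta>))) \<le> V (Suc j) w" if w: "w \<noteq> 0" and j: "j < K" for j w
    proof -
      have one: "avg (steps L) (\<lambda>\<xi>. avg (steps L) (\<lambda>\<eta>. V j (w + \<xi> - \<eta>))) \<le> 1"
        by (intro avg_le_const) (auto simp: V_def)
      have "avg (steps L) (\<lambda>\<xi>. avg (steps L) (\<lambda>\<eta>. V j (w + \<xi> - \<eta>))) \<le> W (Suc j) w" if "\<bar>real_of_int w\<bar> < \<rho>"
      proof -
        have "avg (steps L) (\<lambda>\<xi>. avg (steps L) (\<lambda>\<eta>. V j (w + \<xi> - \<eta>)))
            \<le> avg (steps L) (\<lambda>\<xi>. avg (steps L) (\<lambda>\<eta>. W j (w + \<xi> - \<eta>)))"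
        proof (intro avg_mono VW)
          fix \<xi> \<eta> assume "\<xi> \<in> steps L" "\<eta> \<in> steps L"
          then have "\<bar>real_of_int (\<xi> - \<eta>)\<bar> \<le> 2 * real L" by (auto simp: steps_def abs_le_iff)
          then show "\<bar>real_of_int (w + \<xi> - \<eta>)\<bar> \<le> 3 * \<rho>" using that \<rho> by linarith
        qed (use j in simp)
        also have "\<dots> = (v * (real K - real j) + 4 * \<rho> * avg (steps L) (\<lambda>\<xi>. avg (steps L) (\<lambda>\<eta>. potential L (w + \<xi> - \<eta>)))
            - avg (steps L) (\<lambda>\<xi>. avg (steps L) (\<lambda>\<eta>. (real_of_int (w + \<xi> - \<eta>))\<^sup>2))) / (v * real K)"
          unfolding W_def by (simp only: avg_divide avg_diff avg_add avg_cmult) (simp add: avg_const)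
        also have "\<dots> \<le> (v * (real K - real j) + 4 * \<rho> * potential L w - ((real_of_int w)\<^sup>2 + v)) / (v * real K)"
          unfolding square_drift v_def[symmetric] using vKp \<rho> L1 potential_drift[OF L w]
          by (intro divide_right_mono diff_right_mono add_left_mono mult_left_mono) auto
        also have "\<dots> = W (Suc j) w" by (simp add: W_def algebra_simps)
        finally show ?thesis .
      qed
      then show ?thesis using one w by (auto simp: V_def)
    qed
  qed (use RegA RegB in auto)
  have VK: "V K w \<le> 4 * \<rho> * (\<bar>real_of_int w\<bar> + 18 * (real L)\<^sup>2) / (v * real K)" for w
  proof -
    have "v * real K \<le> 4 * \<rho> * (\<bar>real_of_int w\<bar> + 18 * (real L)\<^sup>2)" if "\<rho> \<le> \<bar>real_of_int w\<bar>"
    proof -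
      have "0 \<le> 18 * (real L)\<^sup>2" by simp
      then have "\<rho> \<le> \<bar>real_of_int w\<bar> + 18 * (real L)\<^sup>2" using that by linarith
      then have "\<rho> * \<rho> \<le> \<rho> * (\<bar>real_of_int w\<bar> + 18 * (real L)\<^sup>2)" using \<rho> L1 by (intro mult_left_mono) auto
      then have "4 * \<rho>\<^sup>2 \<le> 4 * \<rho> * (\<bar>real_of_int w\<bar> + 18 * (real L)\<^sup>2)" unfolding power2_eq_square mult.assoc by simp
      moreover have "3 * \<rho>\<^sup>2 \<le> 4 * \<rho>\<^sup>2" by simp
      ultimately show ?thesis using vK by (meson order_trans)
    qed
    moreover have "W K w \<le> 4 * \<rho> * (\<bar>real_of_int w\<bar> + 18 * (real L)\<^sup>2) / (v * real K)" if "w \<noteq> 0"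
      using that vKp by (simp add: W_def potential_def divide_right_mono)
    ultimately show ?thesis using vKp \<rho> L1 by (auto simp: V_def min_le_iff_disj)
  qed
  \<comment> \<open>12 = 4 * 3: the bounds v \<ge> 2 L^2 / 3 and K \<ge> s^2 / 2 give v K \<ge> (L
    s)^2 / 3.\<close>
  have factor: "4 * \<rho> * x / (v * real K) \<le> 12 / (real L * real s) * x" if "x \<ge> 0" for x
  proof -
    have "4 * \<rho> * (real L * real s) \<le> 12 * (v * real K)"
    proof -
      have "real (s\<^sup>2) \<le> real (2 * K)" using s(3) by (simp only: of_nat_le_iff)
      then have "real s * real s \<le> 2 * real K" by (simp add: power2_eq_square)
      then have "(2 * (real L)\<^sup>2 / 3) * (real s * real s) \<le> v * (2 * real K)"
        using v \<open>real s * real s \<le> 2 * real K\<close> by (intro mult_mono[of _ v "real s * real s"]) simp_all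
      then show ?thesis by (simp add: \<rho>_def power2_eq_square)
    qed
    then have "4 * \<rho> / (v * real K) \<le> 12 / (real L * real s)"
      using vKp L1 s by (simp add: field_simps)
    from mult_right_mono[OF this that] show ?thesis by simp
  qed
  show ?thesis
    by (rule order_trans[OF main order_trans[OF VK factor]]) simp
qed

end

section \<open>Comparing the outputs of one stage from two starts\<close>

definition grid_dist :: "index \<Rightarrow> index \<Rightarrow> real" where
  "grid_dist p q = real_of_int (\<bar>fst p - fst q\<bar> + \<bar>snd p - snd q\<bar>)"

text \<open>A missing output costs nothing because rejections are counted separately. With
  \<open>\<alpha> = 1\<close> and \<open>\<beta> = 0\<close> this is the indicator of two different
  outputs.\<close>

fun out_cost :: "real \<Rightarrow> real \<Rightarrow> index option \<Rightarrow> index option \<Rightarrow> real" where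
  "out_cost \<alpha> \<beta> (Some a) (Some b) = (if a = b then 0 else \<alpha> + \<beta> * grid_dist a b)"
| "out_cost \<alpha> \<beta> _ _ = 0"

lemma grid_dist_commute: "grid_dist p q = grid_dist q p"
  by (simp add: grid_dist_def abs_minus_commute)

lemma out_cost_commute: "out_cost \<alpha> \<beta> x y = out_cost \<alpha> \<beta> y x"
  by (cases x; cases y) (auto simp: grid_dist_commute)

lemma grid_dist_nonneg: "0 \<le> grid_dist p q"
  by (simp add: grid_dist_def)

definition early_mark :: "nat \<Rightarrow> nat \<Rightarrow> (index \<Rightarrow> symbol) \<Rightarrow> index \<Rightarrow> bool" where
  "early_mark u U Z q \<longleftrightarrow> (\<exists>j<min u U. near U (snd q) (snd (walk (near U (snd q)) Z j q)) \<and>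
      snd (Z (walk (near U (snd q)) Z j q)) = 0)"

text \<open>The start \<open>pA\<close> lies \<open>u\<close> columns to the left, so the other walk
  reaches the column of the end point \<open>q\<close> of A after \<open>K\<close> of its
  \<open>T\<close> steps. If both are in the same cell there, the last \<open>u\<close> steps from
  \<open>pB\<close> follow the path along which the search from \<open>q\<close> runs. Without a
  mark on this piece, both searches find the same one.\<close>

lemma stages_agree:
  assumes A: "stage T R U Z pA = Some a" and B: "stage T R U Z pB = Some b"
    and cols: "fst pB = fst pA + int u" and T: "T = u + K"
    and rows: "snd (walk (near R (snd pA)) Z T pA) = snd (walk (near R (snd pB)) Z K pB)"
    and early: "\<not> early_mark u U Z (walk (near R (snd pA)) Z T pA)"
  shows "a = b"
proof -
  define q where "q = walk (near R (snd pA)) Z T pA"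
  define w where "w j = walk (\<lambda>_. True) Z j q" for j
  note SA = stage_SomeD[OF A] and SB = stage_SomeD[OF B]
  have okB: "near R (snd pB) (snd (walk (near R (snd pB)) Z K pB))"
    using SB(1) by (rule walk_ok_mono) (simp add: T)
  have "fst q = fst (walk (near R (snd pB)) Z K pB)"
    using SA(2) walk_fst[of "near R (snd pB)", OF okB] by (simp add: q_def cols T)
  then have qB: "q = walk (near R (snd pB)) Z K pB" using rows by (simp add: q_def prod_eq_iff)
  have B1: "walk (near R (snd pB)) Z T pB = w u"
  proof -
    have e: "walk (near R (snd pB)) Z T pB = walk (near R (snd pB)) Z u q"
      unfolding qB T add.commute[of u K] by (rule walk_add)
    show ?thesis using walk_free[of "near R (snd pB)" Z u q] SB(1) by (simp add: e w_def)
  qed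
  have A2: "near U (snd q) (snd (walk (near U (snd q)) Z U q))" "first_mark (near U (snd q)) Z U q = Some a"
    using A by (auto simp: stage_def Let_def q_def split: if_splits)
  have B2: "near U (snd (w u)) (snd (walk (near U (snd (w u))) Z U (w u)))" "first_mark (near U (snd (w u))) Z U (w u) = Some b"
    using B by (auto simp: stage_def Let_def B1 split: if_splits)
  have fA: "first_mark (\<lambda>_. True) Z U q = Some a" using first_mark_free[of "near U (snd q)", OF A2(1)] A2(2) by simp
  have fB: "first_mark (\<lambda>_. True) Z U (w u) = Some b" using first_mark_free[of "near U (snd (w u))", OF B2(1)] B2(2) by simp
  have unmarked: "snd (Z (w j)) \<noteq> 0" if "j < min u U" for j
  proof -
    have n: "near U (snd q) (snd (walk (near U (snd q)) Z j q))"
      using A2(1) by (rule walk_ok_mono) (use that in simp)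
    then show ?thesis
      using early that walk_free[of "near U (snd q)", OF n] unfolding early_mark_def q_def[symmetric] w_def by metis
  qed
  have split: "first_mark (\<lambda>_. True) Z (m + k) q = first_mark (\<lambda>_. True) Z k (w m)" if "m \<le> min u U" for m k
    unfolding w_def using that unmarked by (intro first_mark_add) (auto simp: w_def)
  show ?thesis
  proof (cases "u \<le> U")
    case True
    then have "first_mark (\<lambda>_. True) Z (U - u) (w u) = Some a" using split[of u "U - u"] fA by simp
    from first_mark_mono[OF this, of U] fB show ?thesis by simp
  next
    \<comment> \<open>For \<open>u > U\<close> the search from \<open>q\<close> would meet unmarked
      cells only, contradicting \<open>fA\<close>.\<close>
    case False
    then show ?thesis using split[of U 0] fA by simp
  qed
qed

text \<open>A triangle inequality through row \<open>r\<close>, later the row of the walk from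
  \<open>pB\<close> in the column where the walk from \<open>pA\<close> ends. Of
  \<open>3 * U\<close>, one part is due to columns and two to the rows of the searches.\<close>

lemma stages_dist:
  assumes A: "stage T R U Z pA = Some a" and B: "stage T R U Z pB = Some b"
    and cols: "fst pB = fst pA + int u"
  shows "grid_dist a b \<le> real u + 3 * real U + real_of_int \<bar>snd (walk (near R (snd pA)) Z T pA) - r\<bar>
    + real_of_int \<bar>snd (walk (near R (snd pB)) Z T pB) - r\<bar>"
proof -
  have "\<bar>fst a - fst b\<bar> + \<bar>snd a - snd b\<bar> \<le> int u + 3 * int U
      + \<bar>snd (walk (near R (snd pA)) Z T pA) - r\<bar> + \<bar>snd (walk (near R (snd pB)) Z T pB) - r\<bar>"
    using stage_SomeD(3-5)[OF A] stage_SomeD(3-5)[OF B] cols by linarith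
  then show ?thesis unfolding grid_dist_def by linarith
qed

context uniform_field
begin

text \<open>The walk from \<open>pA\<close> needs \<open>u\<close> columns to reach the column of
  \<open>pB\<close>. By \<open>abs_le_sq\<close> this adds at most u/2 + L^2/2 to the expected row
  distance, so 18 L^2 becomes 19 L^2.\<close>

lemma alone_then_pair:
  assumes RegA: "strip T R pA \<subseteq> Reg" and cols: "fst pB = fst pA + int u" and T: "T = u + K" and \<alpha>: "0 \<le> \<alpha>"
    and pair: "\<And>a. near R (snd pA) a \<Longrightarrow>
      E (\<lambda>Z. pair_cost (near R (snd pA)) okB f (walk (near R (snd pA)) Z K (fst pB, a)) (walk okB Z K pB))
      \<le> \<alpha> * (\<bar>real_of_int (a - snd pB)\<bar> + 18 * (real L)\<^sup>2)"
  shows "E (\<lambda>Z. pair_cost (near R (snd pA)) okB f (walk (near R (snd pA)) Z T pA) (walk okB Z K pB))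
    \<le> \<alpha> * (\<bar>real_of_int (snd pA - snd pB)\<bar> + real u / 2 + 19 * (real L)\<^sup>2)"
proof -
  let ?ok = "near R (snd pA)"
  define V where "V j r = \<alpha> * ((real_of_int (r - snd pA))\<^sup>2 / (2 * (real L)\<^sup>2)
      + (\<bar>real_of_int (snd pA - snd pB)\<bar> + real j / 2 + 19 * (real L)\<^sup>2))" for j :: nat and r
  have "E (\<lambda>Z. pair_cost ?ok okB f (walk ?ok Z K (walk ?ok Z u pA)) (walk okB Z K pB)) \<le> V u (snd pA)"
  proof (rule walk_supermartingale[where f = "\<lambda>q Z. pair_cost ?ok okB f (walk ?ok Z K q) (walk okB Z K pB)" and ca = "fst pA" and cb = "fst pB"])
    show "(c, r) \<in> Reg" if "?ok r" "fst pA \<le> c" "c < fst pB" for r c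
      using that cols T by (intro subsetD[OF RegA]) (auto simp: strip_def near_def)
    show "pair_cost ?ok okB f (walk ?ok (Z(q := \<tau>)) K p) (walk okB (Z(q := \<tau>)) K pB)
        = pair_cost ?ok okB f (walk ?ok Z K p) (walk okB Z K pB)" if "fst q < fst p" "fst p \<le> fst pB" for p q \<tau> Z
      using that by (simp add: walk_upd)
    show "E (\<lambda>Z. pair_cost ?ok okB f (walk ?ok Z K (fst pB, r)) (walk okB Z K pB)) \<le> V 0 r" if "?ok r" for r
    proof -
      have "\<bar>real_of_int (r - snd pB)\<bar> \<le> \<bar>real_of_int (r - snd pA)\<bar> + \<bar>real_of_int (snd pA - snd pB)\<bar>" by linarith
      then have "\<bar>real_of_int (r - snd pB)\<bar> + 18 * (real L)\<^sup>2 \<le> (real_of_int (r - snd pA))\<^sup>2 / (2 * (real L)\<^sup>2)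
          + (\<bar>real_of_int (snd pA - snd pB)\<bar> + real 0 / 2 + 19 * (real L)\<^sup>2)"
        using abs_le_sq[of "real_of_int (r - snd pA)"] zero_le_power2[of "real L"] by linarith
      from order_trans[OF pair[OF that] mult_left_mono[OF this \<alpha>]] show ?thesis unfolding V_def .
    qed
    show "E (\<lambda>Z. pair_cost ?ok okB f (walk ?ok Z K p) (walk okB Z K pB)) \<le> V j (snd p)" if "\<not> ?ok (snd p)" for p j
      using that \<alpha> by (simp add: pair_cost_def walk_frozen E_const V_def)
    show "avg (steps L) (\<lambda>\<xi>. V j (r + \<xi>)) \<le> V (Suc j) r" for r j
    proof -
      let ?b = "\<bar>real_of_int (snd pA - snd pB)\<bar> + real j / 2 + 19 * (real L)\<^sup>2"
      have "avg (steps L) (\<lambda>\<xi>. (real_of_int (r + \<xi> - snd pA))\<^sup>2 / (2 * (real L)\<^sup>2) + ?b)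
          \<le> (real_of_int (r - snd pA))\<^sup>2 / (2 * (real L)\<^sup>2) + 1 / 2 + ?b"
        using avg_steps_energy[of "r - snd pA" ?b] by (simp add: algebra_simps)
      from mult_left_mono[OF this \<alpha>] show ?thesis
        unfolding V_def avg_cmult by (simp add: add_divide_distrib algebra_simps)
    qed
  qed (use cols in auto)
  also have "V u (snd pA) = \<alpha> * (\<bar>real_of_int (snd pA - snd pB)\<bar> + real u / 2 + 19 * (real L)\<^sup>2)" by (simp add: V_def)
  finally show ?thesis by (simp only: T walk_add)
qed

text \<open>Accounts for the last \<open>u\<close> columns of the walk from \<open>pB\<close>,
  covered after its row has been compared with the end of the other walk.\<close>

lemma late_displacement:
  assumes Reg: "strip T R p \<subseteq> Reg" and T: "T = u + K"
  shows "E (\<lambda>Z. real_of_int \<bar>snd (walk (near R (snd p)) Z T p) - snd (walk (near R (snd p)) Z K p)\<bar>)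
    \<le> real u / 2 + (real L)\<^sup>2 / 2"
proof -
  let ?ok = "near R (snd p)"
  have "E (\<lambda>Z. real_of_int \<bar>snd (walk ?ok Z u (walk ?ok Z K p)) - snd (walk ?ok Z K p)\<bar>) \<le> real u / 2 + (real L)\<^sup>2 / 2"
  proof (rule walk_supermartingale[where f = "\<lambda>q Z. real_of_int \<bar>snd (walk ?ok Z u q) - snd q\<bar>"
      and V = "\<lambda>_ _. real u / 2 + (real L)\<^sup>2 / 2" and ca = "fst p" and cb = "fst p + int K"])
    show "(c, r) \<in> Reg" if "?ok r" "fst p \<le> c" "c < fst p + int K" for r c
      using that T by (intro subsetD[OF Reg]) (auto simp: strip_def near_def)
    show "E (\<lambda>Z. real_of_int \<bar>snd (walk ?ok Z u (fst p + int K, r)) - snd (fst p + int K, r)\<bar>) \<le> real u / 2 + (real L)\<^sup>2 / 2" for r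
      by (rule displacement_bound, rule subsetD[OF Reg]) (auto simp: strip_def near_def T)
  qed (auto simp: walk_upd walk_frozen E_const avg_const)
  then show ?thesis by (simp only: T add.commute[of u K] walk_add)
qed

lemma stage_pair_bound_aux:
  fixes s :: nat
  assumes RegA: "strip (T + U) (R + U) pA \<subseteq> Reg" and RegB: "strip (T + U) (R + U) pB \<subseteq> Reg"
    and cols: "fst pB = fst pA + int u" and T: "T = s\<^sup>2" "2 * u \<le> T" and s: "s \<ge> 1"
    and nn: "0 \<le> \<alpha>" "0 \<le> \<beta>"
  shows "E (\<lambda>Z. out_cost \<alpha> \<beta> (stage T R U Z pA) (stage T R U Z pB))
    \<le> (\<alpha> + 3 * \<beta> * real U) * (228 / (real L * real s) * (grid_dist pA pB + (real L)\<^sup>2) + grid_dist pA pB / real M)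
      + 20 * \<beta> * (grid_dist pA pB + (real L)\<^sup>2)"
proof -
  define K where "K = T - u"
  have TK: "T = u + K" "K \<le> s\<^sup>2" "s\<^sup>2 \<le> 2 * K" using T by (auto simp: K_def)
  let ?okA = "near R (snd pA)" and ?okB = "near R (snd pB)"
  let ?A = "\<lambda>Z. walk ?okA Z T pA" and ?B = "\<lambda>Z. walk ?okB Z K pB"
  define X1 where "X1 Z = pair_cost ?okA ?okB (\<lambda>w. of_bool (w \<noteq> 0)) (?A Z) (?B Z)" for Z
  define X2 where "X2 Z = pair_cost ?okA ?okB (\<lambda>w. \<bar>real_of_int w\<bar>) (?A Z) (?B Z)" for Z
  define X3 where "X3 Z = (of_bool (?okA (snd (?A Z)) \<and> early_mark u U Z (?A Z)) :: real)" for Z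
  define X4 where "X4 Z = real_of_int \<bar>snd (walk ?okB Z T pB) - snd (?B Z)\<bar>" for Z
  define D where "D = grid_dist pA pB"
  have D: "D = \<bar>real_of_int (snd pA - snd pB)\<bar> + real u" "0 \<le> D" using cols by (simp_all add: D_def grid_dist_def)
  have RA: "strip T R pA \<subseteq> Reg" and RB: "strip T R pB \<subseteq> Reg" using RegA RegB by (auto simp: strip_def)
  have L1: "real L \<ge> 1" using L by simp
  have cellA: "(c, r) \<in> Reg" if "?okA r" "fst pB \<le> c" "c < fst pB + int K" for c r
    using that cols TK by (intro subsetD[OF RA]) (auto simp: strip_def near_def)
  have cellB: "(c, r) \<in> Reg" if "?okB r" "fst pB \<le> c" "c < fst pB + int K" for c r
    using that cols TK by (intro subsetD[OF RB]) (auto simp: strip_def near_def)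
  have "E X1 \<le> 12 / (real L * real s) * (\<bar>real_of_int (snd pA - snd pB)\<bar> + real u / 2 + 19 * (real L)\<^sup>2)"
    unfolding X1_def
  proof (rule alone_then_pair[OF RA cols TK(1)])
    show "E (\<lambda>Z. pair_cost ?okA ?okB (\<lambda>w. of_bool (w \<noteq> 0)) (walk ?okA Z K (fst pB, a)) (walk ?okB Z K pB))
        \<le> 12 / (real L * real s) * (\<bar>real_of_int (a - snd pB)\<bar> + 18 * (real L)\<^sup>2)" for a
      using pair_unmerged_bound[of ?okA "fst pB" K ?okB s a "snd pB"] cellA cellB s TK by simp
  qed simp
  also have "\<dots> \<le> 12 / (real L * real s) * (19 * (D + (real L)\<^sup>2))" using D by (intro mult_left_mono) auto
  finally have E1: "E X1 \<le> 228 / (real L * real s) * (D + (real L)\<^sup>2)" by simp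
  have "E X2 \<le> 1 * (\<bar>real_of_int (snd pA - snd pB)\<bar> + real u / 2 + 19 * (real L)\<^sup>2)"
    unfolding X2_def
  proof (rule alone_then_pair[OF RA cols TK(1)])
    show "E (\<lambda>Z. pair_cost ?okA ?okB (\<lambda>w. \<bar>real_of_int w\<bar>) (walk ?okA Z K (fst pB, a)) (walk ?okB Z K pB))
        \<le> 1 * (\<bar>real_of_int (a - snd pB)\<bar> + 18 * (real L)\<^sup>2)" for a
    proof -
      have "potential L (a - snd pB) \<le> \<bar>real_of_int (a - snd pB)\<bar> + 18 * (real L)\<^sup>2" by (simp add: potential_def)
      then show ?thesis
        using pair_distance_bound[of ?okA "fst pB" K ?okB a "snd pB"] cellA cellB by simp
    qed
  qed simp
  then have E2: "E X2 \<le> D + 19 * (real L)\<^sup>2 - real u / 2" using D by simp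
  have E3: "E X3 \<le> D / real M"
  proof -
    have "E X3 \<le> real u / real M"
      using early_mark_prob[OF RegA, of u] by (simp add: X3_def[abs_def] early_mark_def Let_def)
    also have "\<dots> \<le> D / real M" using D by (intro divide_right_mono) auto
    finally show ?thesis .
  qed
  have E4: "E X4 \<le> real u / 2 + (real L)\<^sup>2 / 2"
    unfolding X4_def by (rule late_displacement[OF RB TK(1)])
  \<comment> \<open>Different outputs require unmerged walks (\<open>X1\<close>) or an early mark
    (\<open>X3\<close>), while \<open>X2\<close> and \<open>X4\<close> measure row distances. The
    detour of up to 3U made by the searches is charged only on this event, as an unconditional
    charge could exceed D + L^2.\<close>
  have pointwise: "out_cost \<alpha> \<beta> (stage T R U Z pA) (stage T R U Z pB)
      \<le> (\<alpha> + 3 * \<beta> * real U) * (X1 Z + X3 Z) + \<beta> * (real u + (X2 Z + X4 Z))" for Z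
  proof -
    have X: "0 \<le> X1 Z" "0 \<le> X2 Z" "0 \<le> X3 Z" "0 \<le> X4 Z" by (simp_all add: X1_def X2_def X3_def X4_def pair_cost_def)
    show ?thesis
    proof (cases "\<exists>a b. stage T R U Z pA = Some a \<and> stage T R U Z pB = Some b \<and> a \<noteq> b")
      case True
      then obtain a b where ab: "stage T R U Z pA = Some a" "stage T R U Z pB = Some b" "a \<noteq> b" by blast
      have okA: "?okA (snd (?A Z))" using stage_SomeD(1)[OF ab(1)] .
      have okB: "?okB (snd (?B Z))"
        using stage_SomeD(1)[OF ab(2)] by (rule walk_ok_mono) (simp add: TK)
      have "1 \<le> X1 Z + X3 Z"
        using stages_agree[OF ab(1,2) cols TK(1)] ab(3) okA okB by (auto simp: X1_def X3_def pair_cost_def)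
      then have "(\<alpha> + 3 * \<beta> * real U) * 1 \<le> (\<alpha> + 3 * \<beta> * real U) * (X1 Z + X3 Z)"
        using nn by (intro mult_left_mono) auto
      moreover have "grid_dist a b \<le> real u + 3 * real U + X2 Z + X4 Z"
        using stages_dist[OF ab(1,2) cols, of "snd (?B Z)"] okA okB by (simp add: X2_def X4_def pair_cost_def)
      then have "\<beta> * grid_dist a b \<le> \<beta> * (real u + 3 * real U + X2 Z + X4 Z)" using nn by (intro mult_left_mono)
      ultimately show ?thesis using ab by (simp add: algebra_simps)
    next
      case False
      then have "out_cost \<alpha> \<beta> (stage T R U Z pA) (stage T R U Z pB) = 0"
        by (cases "stage T R U Z pA"; cases "stage T R U Z pB") auto
      then show ?thesis using X nn by simp
    qed
  qed
  have "E (\<lambda>Z. out_cost \<alpha> \<beta> (stage T R U Z pA) (stage T R U Z pB))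
      \<le> E (\<lambda>Z. (\<alpha> + 3 * \<beta> * real U) * (X1 Z + X3 Z) + \<beta> * (real u + (X2 Z + X4 Z)))"
    by (rule field_avg_mono) (rule pointwise)
  also have "\<dots> = (\<alpha> + 3 * \<beta> * real U) * (E X1 + E X3) + \<beta> * (real u + (E X2 + E X4))"
    by (simp only: field_avg_add field_avg_cmult E_const)
  also have "\<dots> \<le> (\<alpha> + 3 * \<beta> * real U) * (228 / (real L * real s) * (D + (real L)\<^sup>2) + D / real M) + \<beta> * (20 * (D + (real L)\<^sup>2))"
  proof (intro add_mono mult_left_mono)
    have "real u \<le> D" using D(1) by simp
    then show "real u + (E X2 + E X4) \<le> 20 * (D + (real L)\<^sup>2)"
      using E2 E4 D(2) zero_le_power2[of "real L"] unfolding distrib_left by linarith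
  qed (use E1 E3 nn in auto)
  finally show ?thesis by (simp add: D_def mult_ac)
qed

text \<open>The failure probability is of order (D + L^2) / M, so the search length
  \<open>U = \<kappa> * M\<close> is cancelled by it and the new cost is again linear in the
  distance. The constants: 228 = 12 * 19 and 687 = 3 * 229.\<close>

lemma stage_pair_bound:
  fixes s \<tau> \<kappa> :: nat
  assumes RegA: "strip (T + U) (R + U) pA \<subseteq> Reg" and RegB: "strip (T + U) (R + U) pB \<subseteq> Reg"
    and T: "T = s\<^sup>2" "2 * \<bar>fst pA - fst pB\<bar> \<le> int T"
    and par: "1 \<le> \<tau>" "\<tau> \<le> s" "M = L * \<tau>" "U = \<kappa> * M" "1 \<le> \<kappa>"
    and nn: "0 \<le> \<alpha>" "0 \<le> \<beta>"
  shows "E (\<lambda>Z. out_cost \<alpha> \<beta> (stage T R U Z pA) (stage T R U Z pB))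
    \<le> 708 * real \<kappa> * (\<alpha> / real M + \<beta>) * (grid_dist pA pB + (real L)\<^sup>2)"
proof -
  define D where "D = grid_dist pA pB"
  have D: "0 \<le> D" by (simp add: D_def grid_dist_nonneg)
  have s: "s \<ge> 1" using par by simp
  have u: "2 * nat (fst pB - fst pA) \<le> T" "2 * nat (fst pA - fst pB) \<le> T"
  proof -
    have "int (2 * nat (fst pB - fst pA)) \<le> int T" "int (2 * nat (fst pA - fst pB)) \<le> int T"
      using T(2) by auto
    then show "2 * nat (fst pB - fst pA) \<le> T" "2 * nat (fst pA - fst pB) \<le> T" by (simp_all only: of_nat_le_iff)
  qed
  have "E (\<lambda>Z. out_cost \<alpha> \<beta> (stage T R U Z pA) (stage T R U Z pB))
    \<le> (\<alpha> + 3 * \<beta> * real U) * (228 / (real L * real s) * (D + (real L)\<^sup>2) + D / real M)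
      + 20 * \<beta> * (D + (real L)\<^sup>2)"
  proof (cases "fst pA \<le> fst pB")
    case True
    then show ?thesis
      unfolding D_def using T(1) u nn s
      by (intro stage_pair_bound_aux[OF RegA RegB, of "nat (fst pB - fst pA)"]) auto
  next
    case False
    then show ?thesis
      unfolding D_def grid_dist_commute[of pA] out_cost_commute[of _ _ "stage T R U _ pA"] using T(1) u nn s
      by (intro stage_pair_bound_aux[OF RegB RegA, of "nat (fst pA - fst pB)"]) auto
  qed
  also have "\<dots> \<le> (\<alpha> + 3 * \<beta> * real U) * (229 / real M * (D + (real L)\<^sup>2)) + 20 * \<beta> * (D + (real L)\<^sup>2)"
  proof (intro add_right_mono mult_left_mono)
    have "228 / (real L * real s) \<le> 228 / real M"
      using L par by (intro divide_left_mono) (auto intro!: mult_left_mono)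
    then have "228 / (real L * real s) * (D + (real L)\<^sup>2) \<le> 228 / real M * (D + (real L)\<^sup>2)"
      using D by (intro mult_right_mono) auto
    moreover have "D / real M \<le> 1 / real M * (D + (real L)\<^sup>2)" using M by (simp add: divide_right_mono)
    ultimately show "228 / (real L * real s) * (D + (real L)\<^sup>2) + D / real M \<le> 229 / real M * (D + (real L)\<^sup>2)"
      by (simp only: add_divide_distrib[symmetric] times_divide_eq_left)
  qed (use nn in simp)
  also have "\<dots> = (229 * \<alpha> / real M + (687 * real \<kappa> + 20) * \<beta>) * (D + (real L)\<^sup>2)"
    using M par by (simp add: field_simps)
  also have "\<dots> \<le> (708 * real \<kappa> * (\<alpha> / real M + \<beta>)) * (D + (real L)\<^sup>2)"
  proof (intro mult_right_mono)
    have k: "1 \<le> real \<kappa>" using par by simp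
    have "229 * (\<alpha> / real M) \<le> (708 * real \<kappa>) * (\<alpha> / real M)" using k nn by (intro mult_right_mono) auto
    moreover have "(687 * real \<kappa> + 20) * \<beta> \<le> (708 * real \<kappa>) * \<beta>" using k nn by (intro mult_right_mono) auto
    ultimately show "229 * \<alpha> / real M + (687 * real \<kappa> + 20) * \<beta> \<le> 708 * real \<kappa> * (\<alpha> / real M + \<beta>)"
      by (simp add: distrib_left)
  qed (use D in simp)
  finally show ?thesis by (simp add: D_def)
qed

end

section \<open>Three stages\<close>

text \<open>The factor 3 makes room for column offsets: with y = \<Lambda>^2 t^8 the offset before
  the last stage can be 1 + 2y, and its double must not exceed the run length 9y.\<close>

definition run_length :: "nat \<Rightarrow> nat \<Rightarrow> nat" where
  "run_length t \<Lambda> = (3 * \<Lambda> * t ^ 4)\<^sup>2"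

text \<open>The first band is \<Lambda> times the scale L sqrt T of the walk; the search length is
  \<Lambda>^2 times the mean spacing L t^4 of marks.\<close>

definition hop :: "nat \<Rightarrow> nat \<Rightarrow> nat \<Rightarrow> (index \<Rightarrow> symbol) \<Rightarrow> index \<Rightarrow> index option" where
  "hop t \<Lambda> L = stage (run_length t \<Lambda>) (\<Lambda> * L * (3 * \<Lambda> * t ^ 4)) (\<Lambda>\<^sup>2 * (L * t ^ 4))"

definition hops :: "nat \<Rightarrow> nat \<Rightarrow> (index \<Rightarrow> symbol) \<Rightarrow> (index \<Rightarrow> symbol) \<Rightarrow> (index \<Rightarrow> symbol) \<Rightarrow> index \<Rightarrow> index option" where
  "hops t \<Lambda> Z1 Z2 Z3 p =
    Option.bind (Option.bind (hop t \<Lambda> 1 Z1 p) (hop t \<Lambda> (t\<^sup>2) Z2)) (hop t \<Lambda> (t ^ 3) Z3)"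

definition width :: "nat \<Rightarrow> nat \<Rightarrow> nat" where
  "width t \<Lambda> = 10 * (\<Lambda>\<^sup>2 * t ^ 8)"

definition half_height :: "nat \<Rightarrow> nat \<Rightarrow> nat" where
  "half_height t \<Lambda> = 4 * (\<Lambda>\<^sup>2 * t ^ 8)"

lemma run_length_eq: "run_length t \<Lambda> = 9 * (\<Lambda>\<^sup>2 * t ^ 8)"
  by (simp add: run_length_def power_mult_distrib flip: power_mult)

lemma hop_sizes:
  assumes t: "t \<ge> 1" and L: "L \<le> t ^ 3"
  shows "run_length t \<Lambda> + \<Lambda>\<^sup>2 * (L * t ^ 4) \<le> width t \<Lambda>"
    and "\<Lambda> * L * (3 * \<Lambda> * t ^ 4) + \<Lambda>\<^sup>2 * (L * t ^ 4) \<le> half_height t \<Lambda>"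
proof -
  have "L * t ^ 4 \<le> t ^ 3 * t ^ 4" using L by (rule mult_le_mono1)
  also have "\<dots> \<le> t ^ 8" using t by (simp flip: power_add add: power_increasing)
  finally have b: "\<Lambda>\<^sup>2 * (L * t ^ 4) \<le> \<Lambda>\<^sup>2 * t ^ 8" by simp
  show "run_length t \<Lambda> + \<Lambda>\<^sup>2 * (L * t ^ 4) \<le> width t \<Lambda>" using b by (simp add: run_length_eq width_def)
  have "\<Lambda> * L * (3 * \<Lambda> * t ^ 4) = 3 * (\<Lambda>\<^sup>2 * (L * t ^ 4))" by (simp add: power2_eq_square)
  then show "\<Lambda> * L * (3 * \<Lambda> * t ^ 4) + \<Lambda>\<^sup>2 * (L * t ^ 4) \<le> half_height t \<Lambda>"
    using b unfolding half_height_def by linarith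
qed

lemma strip_mono: "w \<le> w' \<Longrightarrow> v \<le> v' \<Longrightarrow> strip w v p \<subseteq> strip w' v' p"
  by (auto simp: strip_def)

lemma hop_strip:
  assumes "t \<ge> 1" "L \<le> t ^ 3"
  shows "strip (run_length t \<Lambda> + \<Lambda>\<^sup>2 * (L * t ^ 4)) (\<Lambda> * L * (3 * \<Lambda> * t ^ 4) + \<Lambda>\<^sup>2 * (L * t ^ 4)) p
    \<subseteq> strip (width t \<Lambda>) (half_height t \<Lambda>) p"
  by (rule strip_mono[OF hop_sizes[OF assms]])

lemma hop_cong:
  assumes "t \<ge> 1" "L \<le> t ^ 3" "\<And>q. q \<in> strip (width t \<Lambda>) (half_height t \<Lambda>) p \<Longrightarrow> Z q = Z' q"
  shows "hop t \<Lambda> L Z p = hop t \<Lambda> L Z' p"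
  unfolding hop_def by (intro stage_cong assms(3) subsetD[OF hop_strip[OF assms(1,2)]])

lemma hop_translate: "map_option (\<lambda>p. p + e) (hop t \<Lambda> L (translate e Z) p) = hop t \<Lambda> L Z (p + e)"
  unfolding hop_def by (rule stage_translate)

lemma hop_SomeD:
  assumes "hop t \<Lambda> L Z p = Some a" "t \<ge> 1" "L \<le> t ^ 3"
  shows "fst p + int (run_length t \<Lambda>) \<le> fst a" "fst a < fst p + int (run_length t \<Lambda>) + int (\<Lambda>\<^sup>2 * (L * t ^ 4))"
    and "fst p \<le> fst a" "fst a < fst p + int (width t \<Lambda>)" "\<bar>snd a - snd p\<bar> \<le> int (half_height t \<Lambda>)"
proof -
  note S = stage_SomeD[OF assms(1)[unfolded hop_def]] and sizes = hop_sizes[OF assms(2,3), of \<Lambda>]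
  show 1: "fst p + int (run_length t \<Lambda>) \<le> fst a" "fst a < fst p + int (run_length t \<Lambda>) + int (\<Lambda>\<^sup>2 * (L * t ^ 4))"
    using S(3,4) .
  show "fst p \<le> fst a" using 1(1) by linarith
  have "int (run_length t \<Lambda>) + int (\<Lambda>\<^sup>2 * (L * t ^ 4)) \<le> int (width t \<Lambda>)" using sizes(1) by linarith
  then show "fst a < fst p + int (width t \<Lambda>)" using 1(2) by linarith
  show "\<bar>snd a - snd p\<bar> \<le> int (half_height t \<Lambda>)" using S(6) sizes(2) by linarith
qed

text \<open>Each rejection is exponentially rare: R / (L sqrt T) = \<Lambda>; L^2 \<le> M gives sqrt
  U / L \<ge> \<Lambda>; and U / M = \<Lambda>^2. The coefficients add up to 6 + 6 + 1.\<close>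

lemma hop_None_prob:
  assumes fin: "finite Reg" and t: "t \<ge> 1" and Lb: "1 \<le> L" "L \<le> t ^ 3" and \<Lambda>: "\<Lambda> \<ge> 1"
    and Reg: "strip (width t \<Lambda>) (half_height t \<Lambda>) p \<subseteq> Reg"
  shows "field_avg Reg L (L * t ^ 4) (\<lambda>Z. of_bool (hop t \<Lambda> L Z p = None)) \<le> 13 * exp (- real \<Lambda>)"
proof -
  define M where "M = L * t ^ 4"
  define U where "U = \<Lambda>\<^sup>2 * M"
  have t4: "1 \<le> t ^ 4" "t ^ 3 \<le> t ^ 4" using t by (auto simp: power_increasing)
  have M1: "1 \<le> M" using mult_le_mono[OF Lb(1) t4(1)] by (simp add: M_def)
  have LM: "L\<^sup>2 \<le> M" using Lb t4 by (simp add: M_def power2_eq_square)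
  interpret uniform_field Reg L M using fin Lb(1) M1 by unfold_locales
  have L1: "real L \<ge> 1" using Lb(1) by simp
  have sub: "strip (run_length t \<Lambda> + U) (\<Lambda> * L * (3 * \<Lambda> * t ^ 4) + U) p \<subseteq> Reg"
    using order_trans[OF hop_strip[OF t Lb(2)] Reg] by (simp only: U_def M_def)
  have "1 * 1 \<le> \<Lambda> * t ^ 4" using mult_le_mono[OF \<Lambda> t4(1)] by simp
  then have s1: "1 \<le> real (3 * \<Lambda> * t ^ 4)" by linarith
  have "1 * 1 \<le> \<Lambda>\<^sup>2 * M" using \<Lambda> M1 by (intro mult_le_mono) auto
  then have U1: "1 \<le> real U" unfolding U_def by linarith
  have bound: "E (\<lambda>Z. of_bool (hop t \<Lambda> L Z p = None))
      \<le> 6 * exp (- real (\<Lambda> * L * (3 * \<Lambda> * t ^ 4)) / (real L * real (3 * \<Lambda> * t ^ 4)))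
        + (6 * exp (- real U / (real L * sqrt (real U))) + (1 - 1 / real M) ^ U)"
    unfolding hop_def M_def[symmetric] U_def[symmetric]
    using s1 U1 by (intro stage_None_prob[OF sub]) (auto simp: run_length_def)
  have e1: "- real (\<Lambda> * L * (3 * \<Lambda> * t ^ 4)) / (real L * real (3 * \<Lambda> * t ^ 4)) = - real \<Lambda>"
    using s1 L1 t by simp
  have "real \<Lambda> \<le> real U / (real L * sqrt (real U))"
  proof -
    have "(real \<Lambda> * real L)\<^sup>2 \<le> real U"
      unfolding U_def power_mult_distrib of_nat_mult of_nat_power
      using LM by (intro mult_left_mono) (simp_all flip: of_nat_power)
    then have "real \<Lambda> * real L \<le> sqrt (real U)" by (rule real_le_rsqrt)
    also have "\<dots> = real U / sqrt (real U)" by (simp add: real_div_sqrt)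
    finally have "real \<Lambda> \<le> real U / sqrt (real U) / real L" using L1 by (subst pos_le_divide_eq) auto
    also have "\<dots> = real U / (real L * sqrt (real U))" by simp
    finally show ?thesis .
  qed
  then have e2: "exp (- real U / (real L * sqrt (real U))) \<le> exp (- real \<Lambda>)" by simp
  have e3: "(1 - 1 / real M) ^ U \<le> exp (- real \<Lambda>)"
  proof -
    have "(1 - 1 / real M) ^ U \<le> exp (- 1 / real M) ^ U"
      using M1 exp_ge_add_one_self[of "- 1 / real M"] by (intro power_mono) auto
    also have "\<dots> = exp (- (real U / real M))" by (simp add: exp_of_nat_mult[symmetric])
    also have "real U / real M = (real \<Lambda>)\<^sup>2" using M1 by (simp add: U_def)
    also have "exp (- (real \<Lambda>)\<^sup>2) \<le> exp (- real \<Lambda>)" using \<Lambda> by (simp add: power2_eq_square)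
    finally show ?thesis .
  qed
  show ?thesis using bound e2 e3 unfolding e1 M_def[symmetric] by linarith
qed

lemma hop_bind_None:
  assumes fin: "finite Reg" and t: "t \<ge> 1" and Lb: "1 \<le> L" "L \<le> t ^ 3" and \<Lambda>: "\<Lambda> \<ge> 1"
    and Reg: "\<And>a. p = Some a \<Longrightarrow> strip (width t \<Lambda>) (half_height t \<Lambda>) a \<subseteq> Reg"
  shows "field_avg Reg L (L * t ^ 4) (\<lambda>Z. of_bool (Option.bind p (hop t \<Lambda> L Z) = None)) \<le> of_bool (p = None) + 13 * exp (- real \<Lambda>)"
proof -
  have "1 * 1 \<le> L * t ^ 4" using Lb t by (intro mult_le_mono) auto
  then interpret uniform_field Reg L "L * t ^ 4" using fin Lb(1) by unfold_locales auto
  show ?thesis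
  proof (cases p)
    case None
    then show ?thesis by (simp add: E_const)
  next
    case (Some a)
    then show ?thesis using hop_None_prob[OF fin t Lb \<Lambda> Reg[OF Some]] by simp
  qed
qed

text \<open>One step of the backward recursion for costs. Equal or missing starting points cost
  nothing on both sides.\<close>

lemma hop_bind_pair:
  assumes fin: "finite Reg" and t: "t \<ge> 1" and Lb: "1 \<le> L" "L \<le> t ^ 3" and \<Lambda>: "\<Lambda> \<ge> 1"
    and Reg: "\<And>a. p = Some a \<or> q = Some a \<Longrightarrow> strip (width t \<Lambda>) (half_height t \<Lambda>) a \<subseteq> Reg"
    and cols: "\<And>a b. p = Some a \<Longrightarrow> q = Some b \<Longrightarrow> 2 * \<bar>fst a - fst b\<bar> \<le> int (run_length t \<Lambda>)"
    and nn: "0 \<le> \<alpha>" "0 \<le> \<beta>" and \<kappa>: "\<kappa> = 708 * real (\<Lambda>\<^sup>2) * (\<alpha> / real (L * t ^ 4) + \<beta>)"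
  shows "field_avg Reg L (L * t ^ 4) (\<lambda>Z. out_cost \<alpha> \<beta> (Option.bind p (hop t \<Lambda> L Z)) (Option.bind q (hop t \<Lambda> L Z)))
    \<le> out_cost (\<kappa> * (real L)\<^sup>2) \<kappa> p q"
proof -
  have "1 * 1 \<le> L * t ^ 4" using Lb t by (intro mult_le_mono) auto
  then interpret uniform_field Reg L "L * t ^ 4" using fin Lb(1) by unfold_locales auto
  have self: "out_cost \<alpha> \<beta> r r = 0" for r by (cases r) auto
  show ?thesis
  proof (cases "\<exists>a b. p = Some a \<and> q = Some b \<and> a \<noteq> b")
    case True
    then obtain a b where ab: "p = Some a" "q = Some b" "a \<noteq> b" by blast
    have sub: "strip (run_length t \<Lambda> + \<Lambda>\<^sup>2 * (L * t ^ 4)) (\<Lambda> * L * (3 * \<Lambda> * t ^ 4) + \<Lambda>\<^sup>2 * (L * t ^ 4)) c \<subseteq> Reg"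
      if "c = a \<or> c = b" for c
      using ab that by (intro order_trans[OF hop_strip[OF t Lb(2)] Reg]) auto
    have "1 * t ^ 4 \<le> 3 * \<Lambda> * t ^ 4" using \<Lambda> by (intro mult_le_mono) auto
    then have "E (\<lambda>Z. out_cost \<alpha> \<beta> (hop t \<Lambda> L Z a) (hop t \<Lambda> L Z b)) \<le> \<kappa> * (grid_dist a b + (real L)\<^sup>2)"
      unfolding hop_def \<kappa> using cols[OF ab(1,2)] t \<Lambda> nn
      by (intro stage_pair_bound[OF sub sub, where s = "3 * \<Lambda> * t ^ 4" and \<tau> = "t ^ 4"]) (auto simp: run_length_def)
    then show ?thesis using ab by (simp add: algebra_simps)
  next
    case False
    then have "p = None \<or> q = None \<or> p = q" by (cases p; cases q) auto
    moreover have "0 \<le> out_cost (\<kappa> * (real L)\<^sup>2) \<kappa> p q" using False by (cases p; cases q) auto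
    ultimately show ?thesis by (auto simp: self E_const bind_eq_None_conv)
  qed
qed

lemma power_facts:
  fixes t :: nat
  assumes "t \<ge> 1"
  shows "1 \<le> t\<^sup>2" "t\<^sup>2 \<le> t ^ 3" "1 \<le> t ^ 3" "1 \<le> t ^ 4" "t ^ 3 \<le> t ^ 3"
  using assms by (auto simp: power_increasing)

lemma hops_strip:
  assumes t: "t \<ge> 1"
  shows "strip (width t \<Lambda>) (half_height t \<Lambda>) p \<subseteq> strip (3 * width t \<Lambda>) (3 * half_height t \<Lambda>) p"
    and "hop t \<Lambda> 1 Z1 p = Some a \<Longrightarrow> strip (width t \<Lambda>) (half_height t \<Lambda>) a \<subseteq> strip (3 * width t \<Lambda>) (3 * half_height t \<Lambda>) p"
    and "Option.bind (hop t \<Lambda> 1 Z1 p) (hop t \<Lambda> (t\<^sup>2) Z2) = Some b \<Longrightarrow> strip (width t \<Lambda>) (half_height t \<Lambda>) b \<subseteq> strip (3 * width t \<Lambda>) (3 * half_height t \<Lambda>) p"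
    and "hops t \<Lambda> Z1 Z2 Z3 p = Some c \<Longrightarrow> c \<in> strip (3 * width t \<Lambda>) (3 * half_height t \<Lambda>) p"
proof -
  note P = power_facts[OF t]
  let ?w = "width t \<Lambda>" and ?v = "half_height t \<Lambda>"
  show "strip ?w ?v p \<subseteq> strip (3 * ?w) (3 * ?v) p" by (intro strip_mono) auto
  show "strip ?w ?v a \<subseteq> strip (3 * ?w) (3 * ?v) p" if a: "hop t \<Lambda> 1 Z1 p = Some a" for a
    using hop_SomeD(3-5)[OF a t P(3)] by (auto simp: strip_def)
  show "strip ?w ?v b \<subseteq> strip (3 * ?w) (3 * ?v) p" if b: "Option.bind (hop t \<Lambda> 1 Z1 p) (hop t \<Lambda> (t\<^sup>2) Z2) = Some b" for b
  proof -
    obtain a where a: "hop t \<Lambda> 1 Z1 p = Some a" "hop t \<Lambda> (t\<^sup>2) Z2 a = Some b" using b by (auto simp: bind_eq_Some_conv)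
    show ?thesis using hop_SomeD(3-5)[OF a(1) t P(3)] hop_SomeD(3-5)[OF a(2) t P(2)] by (auto simp: strip_def)
  qed
  show "c \<in> strip (3 * ?w) (3 * ?v) p" if c: "hops t \<Lambda> Z1 Z2 Z3 p = Some c"
  proof -
    obtain a b where a: "hop t \<Lambda> 1 Z1 p = Some a" "hop t \<Lambda> (t\<^sup>2) Z2 a = Some b" "hop t \<Lambda> (t ^ 3) Z3 b = Some c"
      using c by (auto simp: hops_def bind_eq_Some_conv)
    show ?thesis using hop_SomeD(3-5)[OF a(1) t P(3)] hop_SomeD(3-5)[OF a(2) t P(2)] hop_SomeD(3-5)[OF a(3) t P(5)]
      by (cases c) (auto simp: strip_def)
  qed
qed

section \<open>Three independent fields, one for each stage\<close>

definition field_avg3 :: "index set \<Rightarrow> nat \<Rightarrow> ((index \<Rightarrow> symbol) \<Rightarrow> (index \<Rightarrow> symbol) \<Rightarrow> (index \<Rightarrow> symbol) \<Rightarrow> real) \<Rightarrow> real" where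
  "field_avg3 Reg t f = field_avg Reg 1 (1 * t ^ 4) (\<lambda>Z1. field_avg Reg (t\<^sup>2) (t\<^sup>2 * t ^ 4) (\<lambda>Z2. field_avg Reg (t ^ 3) (t ^ 3 * t ^ 4) (f Z1 Z2)))"

lemma field_avg3_mono: "(\<And>Z1 Z2 Z3. f Z1 Z2 Z3 \<le> g Z1 Z2 Z3) \<Longrightarrow> field_avg3 Reg t f \<le> field_avg3 Reg t g"
  unfolding field_avg3_def by (intro field_avg_mono)

lemma field_avg3_add: "field_avg3 Reg t (\<lambda>Z1 Z2 Z3. f Z1 Z2 Z3 + g Z1 Z2 Z3) = field_avg3 Reg t f + field_avg3 Reg t g"
  unfolding field_avg3_def by (simp only: field_avg_add)

context
  fixes Reg :: "index set" and t \<Lambda> :: nat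
  assumes fin: "finite Reg" and t: "t \<ge> 1" and \<Lambda>: "\<Lambda> \<ge> 1"
begin

lemma uniform_fields:
  "uniform_field Reg 1 (1 * t ^ 4)" "uniform_field Reg (t\<^sup>2) (t\<^sup>2 * t ^ 4)" "uniform_field Reg (t ^ 3) (t ^ 3 * t ^ 4)"
  using fin power_facts[OF t] t by (unfold_locales, auto)

lemma after_hops:
  assumes Reg: "strip (3 * width t \<Lambda>) (3 * half_height t \<Lambda>) p \<subseteq> Reg"
  shows "strip (width t \<Lambda>) (half_height t \<Lambda>) p \<subseteq> Reg"
    and "hop t \<Lambda> 1 Z1 p = Some a \<Longrightarrow> strip (width t \<Lambda>) (half_height t \<Lambda>) a \<subseteq> Reg"
    and "Option.bind (hop t \<Lambda> 1 Z1 p) (hop t \<Lambda> (t\<^sup>2) Z2) = Some b \<Longrightarrow> strip (width t \<Lambda>) (half_height t \<Lambda>) b \<subseteq> Reg"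
  using hops_strip(1-3)[OF t] Reg by (meson order_trans)+

lemma hops_None_prob:
  assumes Reg: "strip (3 * width t \<Lambda>) (3 * half_height t \<Lambda>) p \<subseteq> Reg"
  shows "field_avg3 Reg t (\<lambda>Z1 Z2 Z3. of_bool (hops t \<Lambda> Z1 Z2 Z3 p = None)) \<le> 39 * exp (- real \<Lambda>)"
proof -
  interpret F1: uniform_field Reg 1 "1 * t ^ 4" by (rule uniform_fields)
  interpret F2: uniform_field Reg "t\<^sup>2" "t\<^sup>2 * t ^ 4" by (rule uniform_fields)
  let ?e = "13 * exp (- real \<Lambda>)"
  let ?o1 = "\<lambda>Z1. hop t \<Lambda> 1 Z1 p"
  let ?o2 = "\<lambda>Z1 Z2. Option.bind (?o1 Z1) (hop t \<Lambda> (t\<^sup>2) Z2)"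
  have "field_avg3 Reg t (\<lambda>Z1 Z2 Z3. of_bool (hops t \<Lambda> Z1 Z2 Z3 p = None))
      \<le> F1.E (\<lambda>Z1. F2.E (\<lambda>Z2. of_bool (?o2 Z1 Z2 = None) + ?e))"
    unfolding field_avg3_def hops_def
    by (intro field_avg_mono hop_bind_None[OF fin t power_facts(3,5)[OF t] \<Lambda>] after_hops(3)[OF Reg])
  also have "\<dots> = F1.E (\<lambda>Z1. F2.E (\<lambda>Z2. of_bool (?o2 Z1 Z2 = None)) + ?e)"
    by (simp only: field_avg_add F2.E_const)
  also have "\<dots> \<le> F1.E (\<lambda>Z1. (of_bool (?o1 Z1 = None) + ?e) + ?e)"
    by (intro add_right_mono field_avg_mono hop_bind_None[OF fin t power_facts(1,2)[OF t] \<Lambda>] after_hops(2)[OF Reg])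
  also have "\<dots> \<le> ?e + ?e + ?e"
    unfolding field_avg_add F1.E_const
    using hop_None_prob[OF fin t _ power_facts(3)[OF t] \<Lambda> after_hops(1)[OF Reg]] by simp
  finally show ?thesis by simp
qed

lemma hops_pair_cost:
  assumes RegA: "strip (3 * width t \<Lambda>) (3 * half_height t \<Lambda>) pA \<subseteq> Reg"
    and RegB: "strip (3 * width t \<Lambda>) (3 * half_height t \<Lambda>) pB \<subseteq> Reg"
    and near: "grid_dist pA pB \<le> 1"
  shows "field_avg3 Reg t (\<lambda>Z1 Z2 Z3. out_cost 1 0 (hops t \<Lambda> Z1 Z2 Z3 pA) (hops t \<Lambda> Z1 Z2 Z3 pB))
    \<le> 8 * 708 ^ 3 * real \<Lambda> ^ 6 / real t ^ 7"
proof -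
  interpret F1: uniform_field Reg 1 "1 * t ^ 4" by (rule uniform_fields)
  interpret F2: uniform_field Reg "t\<^sup>2" "t\<^sup>2 * t ^ 4" by (rule uniform_fields)
  \<comment> \<open>The last stage comes first. As (t^3)^2 = t^2 * t^4 and (t^2)^2 = t^4, the two
    summands in \<open>\<kappa>2\<close> agree, and so do those in \<open>\<kappa>1\<close>; hence
    the earlier stages cost only factors 2 * 708 \<Lambda>^2, and t^-7 comes from the mark density
    of the last stage.\<close>
  define \<kappa>3 where "\<kappa>3 = 708 * real (\<Lambda>\<^sup>2) * (1 / real (t ^ 3 * t ^ 4) + 0)"
  define \<kappa>2 where "\<kappa>2 = 708 * real (\<Lambda>\<^sup>2) * (\<kappa>3 * (real (t ^ 3))\<^sup>2 / real (t\<^sup>2 * t ^ 4) + \<kappa>3)"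
  define \<kappa>1 where "\<kappa>1 = 708 * real (\<Lambda>\<^sup>2) * (\<kappa>2 * (real (t\<^sup>2))\<^sup>2 / real (1 * t ^ 4) + \<kappa>2)"
  have nn: "0 \<le> \<kappa>3" "0 \<le> \<kappa>2" "0 \<le> \<kappa>1" by (simp_all add: \<kappa>3_def \<kappa>2_def \<kappa>1_def)
  let ?o1 = "\<lambda>p Z1. hop t \<Lambda> 1 Z1 p"
  let ?o2 = "\<lambda>p Z1 Z2. Option.bind (?o1 p Z1) (hop t \<Lambda> (t\<^sup>2) Z2)"
  have cAB: "\<bar>fst pA - fst pB\<bar> \<le> 1" using near unfolding grid_dist_def by linarith
  define y where "y = int (\<Lambda>\<^sup>2 * t ^ 8)"
  have U: "int (\<Lambda>\<^sup>2 * (1 * t ^ 4)) \<le> y" "int (\<Lambda>\<^sup>2 * (t\<^sup>2 * t ^ 4)) \<le> y"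
    unfolding y_def of_nat_le_iff using t by (intro mult_le_mono order_refl; simp add: power_increasing flip: power_add)+
  have "1 * 1 \<le> \<Lambda>\<^sup>2 * t ^ 8" using t \<Lambda> by (intro mult_le_mono) auto
  then have one: "1 \<le> y" unfolding y_def by linarith
  have len: "int (run_length t \<Lambda>) = 9 * y" by (simp add: run_length_eq y_def)
  have c1: "\<bar>fst a - fst b\<bar> \<le> 1 + y" if "?o1 pA Z1 = Some a" "?o1 pB Z1 = Some b" for Z1 a b
    using hop_SomeD(1,2)[OF that(1) t power_facts(3)[OF t]] hop_SomeD(1,2)[OF that(2) t power_facts(3)[OF t]] cAB U(1) by linarith
  have c2: "\<bar>fst a - fst b\<bar> \<le> 1 + 2 * y" if o2: "?o2 pA Z1 Z2 = Some a" "?o2 pB Z1 Z2 = Some b" for Z1 Z2 a b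
  proof -
    obtain a' b' where 1: "?o1 pA Z1 = Some a'" "?o1 pB Z1 = Some b'"
      and 2: "hop t \<Lambda> (t\<^sup>2) Z2 a' = Some a" "hop t \<Lambda> (t\<^sup>2) Z2 b' = Some b"
      using o2 by (auto simp: bind_eq_Some_conv)
    show ?thesis
      using hop_SomeD(1,2)[OF 2(1) t power_facts(2)[OF t]] hop_SomeD(1,2)[OF 2(2) t power_facts(2)[OF t]] c1[OF 1] U(2) by linarith
  qed
  have "field_avg3 Reg t (\<lambda>Z1 Z2 Z3. out_cost 1 0 (hops t \<Lambda> Z1 Z2 Z3 pA) (hops t \<Lambda> Z1 Z2 Z3 pB))
      \<le> F1.E (\<lambda>Z1. F2.E (\<lambda>Z2. out_cost (\<kappa>3 * (real (t ^ 3))\<^sup>2) \<kappa>3 (?o2 pA Z1 Z2) (?o2 pB Z1 Z2)))"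
    unfolding field_avg3_def hops_def
  proof (intro field_avg_mono hop_bind_pair[OF fin t power_facts(3,5)[OF t] \<Lambda>])
    show "2 * \<bar>fst a - fst b\<bar> \<le> int (run_length t \<Lambda>)" if "?o2 pA Z1 Z2 = Some a" "?o2 pB Z1 Z2 = Some b" for Z1 Z2 a b
    proof -
      have "2 * \<bar>fst a - fst b\<bar> \<le> 2 * (1 + 2 * y)" using c2[OF that] by simp
      also have "\<dots> \<le> 9 * y" using one by simp
      finally show ?thesis by (simp only: len)
    qed
    show "strip (width t \<Lambda>) (half_height t \<Lambda>) a \<subseteq> Reg" if "?o2 pA Z1 Z2 = Some a \<or> ?o2 pB Z1 Z2 = Some a" for Z1 Z2 a
      using that after_hops(3)[OF RegA] after_hops(3)[OF RegB] by blast
  qed (simp_all add: \<kappa>3_def)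
  also have "\<dots> \<le> F1.E (\<lambda>Z1. out_cost (\<kappa>2 * (real (t\<^sup>2))\<^sup>2) \<kappa>2 (?o1 pA Z1) (?o1 pB Z1))"
  proof (intro field_avg_mono hop_bind_pair[OF fin t power_facts(1,2)[OF t] \<Lambda>])
    show "2 * \<bar>fst a - fst b\<bar> \<le> int (run_length t \<Lambda>)" if "?o1 pA Z1 = Some a" "?o1 pB Z1 = Some b" for Z1 a b
    proof -
      have "2 * \<bar>fst a - fst b\<bar> \<le> 2 * (1 + y)" using c1[OF that] by simp
      also have "\<dots> \<le> 9 * y" using one by simp
      finally show ?thesis by (simp only: len)
    qed
    show "strip (width t \<Lambda>) (half_height t \<Lambda>) a \<subseteq> Reg" if "?o1 pA Z1 = Some a \<or> ?o1 pB Z1 = Some a" for Z1 a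
      using that after_hops(2)[OF RegA] after_hops(2)[OF RegB] by blast
  qed (use nn in \<open>simp_all add: \<kappa>2_def\<close>)
  also have "\<dots> \<le> out_cost (\<kappa>1 * (real 1)\<^sup>2) \<kappa>1 (Some pA) (Some pB)"
  proof -
    have "F1.E (\<lambda>Z1. out_cost (\<kappa>2 * (real (t\<^sup>2))\<^sup>2) \<kappa>2 (Option.bind (Some pA) (hop t \<Lambda> 1 Z1)) (Option.bind (Some pB) (hop t \<Lambda> 1 Z1)))
        \<le> out_cost (\<kappa>1 * (real 1)\<^sup>2) \<kappa>1 (Some pA) (Some pB)"
    proof (rule hop_bind_pair[OF fin t order_refl power_facts(3)[OF t] \<Lambda>])
      show "2 * \<bar>fst a - fst b\<bar> \<le> int (run_length t \<Lambda>)" if "Some pA = Some a" "Some pB = Some b" for a b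
        using cAB one len that by auto
      show "strip (width t \<Lambda>) (half_height t \<Lambda>) a \<subseteq> Reg" if "Some pA = Some a \<or> Some pB = Some a" for a
        using that after_hops(1)[OF RegA] after_hops(1)[OF RegB] by blast
    qed (use nn in \<open>simp_all add: \<kappa>1_def\<close>)
    then show ?thesis by simp
  qed
  also have "\<dots> \<le> \<kappa>1 * 2"
    using near nn mult_left_mono[OF near nn(3)] by (simp add: grid_dist_nonneg)
  also have "\<kappa>1 * 2 = 8 * 708 ^ 3 * real \<Lambda> ^ 6 / real t ^ 7"
  proof -
    have "real t > 0" using t by simp
    then have "\<kappa>2 = 708 * real \<Lambda> ^ 2 * (2 * \<kappa>3)" "\<kappa>1 = 708 * real \<Lambda> ^ 2 * (2 * \<kappa>2)"
      by (simp_all add: \<kappa>1_def \<kappa>2_def flip: power_add power_mult)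
    moreover have "\<kappa>3 = 708 * real \<Lambda> ^ 2 / real t ^ 7" by (simp add: \<kappa>3_def flip: power_add)
    ultimately show ?thesis by (simp add: power_eq_if)
  qed
  finally show ?thesis .
qed

lemma hops_fail_prob:
  assumes RegA: "strip (3 * width t \<Lambda>) (3 * half_height t \<Lambda>) pA \<subseteq> Reg"
    and RegB: "strip (3 * width t \<Lambda>) (3 * half_height t \<Lambda>) pB \<subseteq> Reg"
    and near: "grid_dist pA pB \<le> 1"
  shows "field_avg3 Reg t (\<lambda>Z1 Z2 Z3. of_bool (hops t \<Lambda> Z1 Z2 Z3 pA = None \<or> hops t \<Lambda> Z1 Z2 Z3 pA \<noteq> hops t \<Lambda> Z1 Z2 Z3 pB))
    \<le> 78 * exp (- real \<Lambda>) + 8 * 708 ^ 3 * real \<Lambda> ^ 6 / real t ^ 7"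
proof -
  have "of_bool (a = None \<or> a \<noteq> b) \<le> (of_bool (a = None) + of_bool (b = None)) + out_cost 1 0 a b" for a b
    by (cases a; cases b) auto
  then have "field_avg3 Reg t (\<lambda>Z1 Z2 Z3. of_bool (hops t \<Lambda> Z1 Z2 Z3 pA = None \<or> hops t \<Lambda> Z1 Z2 Z3 pA \<noteq> hops t \<Lambda> Z1 Z2 Z3 pB))
    \<le> field_avg3 Reg t (\<lambda>Z1 Z2 Z3. (of_bool (hops t \<Lambda> Z1 Z2 Z3 pA = None) + of_bool (hops t \<Lambda> Z1 Z2 Z3 pB = None))
        + out_cost 1 0 (hops t \<Lambda> Z1 Z2 Z3 pA) (hops t \<Lambda> Z1 Z2 Z3 pB))"
    by (intro field_avg3_mono)
  also have "\<dots> \<le> (39 * exp (- real \<Lambda>) + 39 * exp (- real \<Lambda>)) + 8 * 708 ^ 3 * real \<Lambda> ^ 6 / real t ^ 7"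
    unfolding field_avg3_add by (intro add_mono hops_None_prob hops_pair_cost assms)
  finally show ?thesis by simp
qed

end

section \<open>Decision trees\<close>

definition cells :: "nat \<Rightarrow> index \<Rightarrow> index list" where
  "cells l p = map (\<lambda>m. p + (int m, 0)) [0..<l]"

definition window_field :: "nat \<Rightarrow> (bool list list \<Rightarrow> symbol) \<Rightarrow> input \<Rightarrow> index \<Rightarrow> symbol" where
  "window_field l G x p = G (map x (cells l p))"

type_synonym tree = "(index, bool list, index) query_tree"

primrec ask :: "index list \<Rightarrow> (bool list list \<Rightarrow> tree) \<Rightarrow> tree" where
  "ask [] \<kappa> = \<kappa> []"
| "ask (p # ps) \<kappa> = Query p (\<lambda>a. ask ps (\<lambda>as. \<kappa> (a # as)))"

text \<open>Continuation-passing style: phases compose by passing on what to do with the result,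
  without a bind operation on trees.\<close>

primrec walk_tree :: "nat \<Rightarrow> (bool list list \<Rightarrow> symbol) \<Rightarrow> (int \<Rightarrow> bool) \<Rightarrow> nat \<Rightarrow> index \<Rightarrow> (index \<Rightarrow> tree) \<Rightarrow> tree" where
  "walk_tree l G ok 0 = (\<lambda>p \<kappa>. \<kappa> p)"
| "walk_tree l G ok (Suc k) = (\<lambda>p \<kappa>. if ok (snd p)
     then ask (cells l p) (\<lambda>ws. walk_tree l G ok k (fst p + 1, snd p + fst (G ws)) \<kappa>) else \<kappa> p)"

primrec mark_tree :: "nat \<Rightarrow> (bool list list \<Rightarrow> symbol) \<Rightarrow> (int \<Rightarrow> bool) \<Rightarrow> nat \<Rightarrow> index \<Rightarrow> (index option \<Rightarrow> tree) \<Rightarrow> tree" where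
  "mark_tree l G ok 0 = (\<lambda>p \<kappa>. \<kappa> None)"
| "mark_tree l G ok (Suc k) = (\<lambda>p \<kappa>. if ok (snd p)
     then ask (cells l p) (\<lambda>ws. if snd (G ws) = 0 then \<kappa> (Some p)
       else mark_tree l G ok k (fst p + 1, snd p + fst (G ws)) \<kappa>) else \<kappa> None)"

definition stage_tree :: "nat \<Rightarrow> nat \<Rightarrow> nat \<Rightarrow> nat \<Rightarrow> (bool list list \<Rightarrow> symbol) \<Rightarrow> index \<Rightarrow> (index option \<Rightarrow> tree) \<Rightarrow> tree" where
  "stage_tree l T R U G p \<kappa> = walk_tree l G (near R (snd p)) T p (\<lambda>p1.
     if near R (snd p) (snd p1) then
       walk_tree l G (near U (snd p1)) U p1 (\<lambda>p2.
         if near U (snd p1) (snd p2) then mark_tree l G (near U (snd p1)) U p1 \<kappa> else \<kappa> None)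
     else \<kappa> None)"

definition leads_to :: "input \<Rightarrow> nat \<Rightarrow> index set \<Rightarrow> tree \<Rightarrow> tree \<Rightarrow> bool" where
  "leads_to x m D t t' \<longleftrightarrow> run t x = run t' x \<and>
     (\<exists>qs. queries t x = qs @ queries t' x \<and> length qs \<le> m \<and> set qs \<subseteq> D)"

lemma leads_to_refl: "leads_to x m D t t"
  by (auto simp: leads_to_def)

lemma leads_to_trans: "leads_to x m D t t' \<Longrightarrow> leads_to x m' D t' t'' \<Longrightarrow> leads_to x (m + m') D t t''"
  unfolding leads_to_def by (fastforce intro: add_mono)

lemma leads_to_mono: "leads_to x m D t t' \<Longrightarrow> m \<le> m' \<Longrightarrow> leads_to x m' D t t'"
  unfolding leads_to_def by fastforce

lemma leads_to_ask:
  assumes "set ps \<subseteq> D"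
  shows "leads_to x (length ps) D (ask ps \<kappa>) (\<kappa> (map x ps))"
proof -
  have "run (ask ps \<kappa>) x = run (\<kappa> (map x ps)) x \<and> queries (ask ps \<kappa>) x = ps @ queries (\<kappa> (map x ps)) x"
    by (induction ps arbitrary: \<kappa>) auto
  then show ?thesis using assms by (auto simp: leads_to_def)
qed

lemma length_cells [simp]: "length (cells l p) = l"
  by (simp add: cells_def)

lemma leads_to_walk:
  assumes "\<And>c r. fst p \<le> c \<Longrightarrow> c < fst p + int k \<Longrightarrow> ok r \<Longrightarrow> set (cells l (c, r)) \<subseteq> D"
  shows "leads_to x (l * k) D (walk_tree l G ok k p \<kappa>) (\<kappa> (walk ok (window_field l G x) k p))"
  using assms
proof (induction k arbitrary: p)
  case (Suc k)
  show ?case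
  proof (cases "ok (snd p)")
    case True
    let ?p = "(fst p + 1, snd p + fst (G (map x (cells l p))))"
    have "set (cells l p) \<subseteq> D" using Suc.prems[of "fst p" "snd p"] True by simp
    from leads_to_ask[OF this, of x "\<lambda>ws. walk_tree l G ok k (fst p + 1, snd p + fst (G ws)) \<kappa>"]
    have "leads_to x l D (walk_tree l G ok (Suc k) p \<kappa>) (walk_tree l G ok k ?p \<kappa>)" using True by simp
    moreover have "leads_to x (l * k) D (walk_tree l G ok k ?p \<kappa>) (\<kappa> (walk ok (window_field l G x) k ?p))"
      using Suc.prems by (intro Suc.IH) auto
    ultimately have "leads_to x (l + l * k) D (walk_tree l G ok (Suc k) p \<kappa>) (\<kappa> (walk ok (window_field l G x) k ?p))"
      by (rule leads_to_trans)
    then show ?thesis using True by (simp add: window_field_def[of l G x p])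
  qed (simp add: leads_to_refl)
qed (simp add: leads_to_refl)

lemma leads_to_mark:
  assumes "\<And>c r. fst p \<le> c \<Longrightarrow> c < fst p + int k \<Longrightarrow> ok r \<Longrightarrow> set (cells l (c, r)) \<subseteq> D"
  shows "leads_to x (l * k) D (mark_tree l G ok k p \<kappa>) (\<kappa> (first_mark ok (window_field l G x) k p))"
  using assms
proof (induction k arbitrary: p)
  case (Suc k)
  show ?case
  proof (cases "ok (snd p)")
    case True
    let ?ws = "map x (cells l p)"
    let ?p = "(fst p + 1, snd p + fst (G ?ws))"
    have "set (cells l p) \<subseteq> D" using Suc.prems[of "fst p" "snd p"] True by simp
    from leads_to_ask[OF this, of x "\<lambda>ws. if snd (G ws) = 0 then \<kappa> (Some p)
       else mark_tree l G ok k (fst p + 1, snd p + fst (G ws)) \<kappa>"]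
    have "leads_to x l D (mark_tree l G ok (Suc k) p \<kappa>) (if snd (G ?ws) = 0 then \<kappa> (Some p) else mark_tree l G ok k ?p \<kappa>)"
      using True by simp
    moreover have "leads_to x (l * k) D (if snd (G ?ws) = 0 then \<kappa> (Some p) else mark_tree l G ok k ?p \<kappa>)
        (if snd (G ?ws) = 0 then \<kappa> (Some p) else \<kappa> (first_mark ok (window_field l G x) k ?p))"
      using Suc.prems Suc.IH[of ?p] by (auto simp: leads_to_refl)
    ultimately have "leads_to x (l + l * k) D (mark_tree l G ok (Suc k) p \<kappa>)
        (if snd (G ?ws) = 0 then \<kappa> (Some p) else \<kappa> (first_mark ok (window_field l G x) k ?p))"
      by (rule leads_to_trans)
    then show ?thesis using True by (simp add: window_field_def[of l G x p] if_distrib)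
  qed (simp add: leads_to_refl)
qed (simp add: leads_to_refl)

text \<open>The \<open>2 * U\<close> arises because the second phase is walked twice, once for the
  band check and once for the search.\<close>

lemma leads_to_stage:
  assumes D: "\<And>q. q \<in> strip (T + U) (R + U) p \<Longrightarrow> set (cells l q) \<subseteq> D"
  shows "leads_to x (l * (T + 2 * U)) D (stage_tree l T R U G p \<kappa>) (\<kappa> (stage T R U (window_field l G x) p))"
proof -
  let ?Z = "window_field l G x"
  define p1 where "p1 = walk (near R (snd p)) ?Z T p"
  define p2 where "p2 = walk (near U (snd p1)) ?Z U p1"
  define t2 where "t2 q = (if near U (snd p1) (snd q) then mark_tree l G (near U (snd p1)) U p1 \<kappa> else \<kappa> None)" for q :: index
  define t1 where "t1 q = (if near R (snd p) (snd q) then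
       walk_tree l G (near U (snd q)) U q (\<lambda>p2.
         if near U (snd q) (snd p2) then mark_tree l G (near U (snd q)) U q \<kappa> else \<kappa> None)
     else \<kappa> None)" for q
  have 1: "leads_to x (l * T) D (stage_tree l T R U G p \<kappa>) (t1 p1)"
    unfolding stage_tree_def t1_def[symmetric] p1_def
    by (intro leads_to_walk D) (auto simp: strip_def near_def)
  show ?thesis
  proof (cases "near R (snd p) (snd p1)")
    case False
    then have "stage T R U ?Z p = None" "t1 p1 = \<kappa> None" by (simp_all add: stage_def t1_def p1_def)
    then show ?thesis using leads_to_mono[OF 1] by simp
  next
    case True
    then have "fst p1 = fst p + int T" unfolding p1_def by (rule walk_fst)
    then have D1: "set (cells l (c, r)) \<subseteq> D" if "fst p1 \<le> c" "c < fst p1 + int U" "near U (snd p1) r" for c r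
      using that True by (intro D) (auto simp: strip_def near_def)
    have "t1 p1 = walk_tree l G (near U (snd p1)) U p1 t2" using True by (simp add: t1_def t2_def[abs_def])
    then have 2: "leads_to x (l * U) D (t1 p1) (t2 p2)"
      unfolding p2_def by (simp only:) (rule leads_to_walk[OF D1])
    have 3: "leads_to x (l * U) D (t2 p2) (\<kappa> (stage T R U ?Z p))"
    proof (cases "near U (snd p1) (snd p2)")
      case ok2: True
      then have "stage T R U ?Z p = first_mark (near U (snd p1)) ?Z U p1" "t2 p2 = mark_tree l G (near U (snd p1)) U p1 \<kappa>"
        using True by (simp_all add: stage_def t2_def p1_def p2_def Let_def)
      then show ?thesis using leads_to_mark[of p1 U "near U (snd p1)", OF D1] by simp
    next
      case False
      then have "stage T R U ?Z p = None" "t2 p2 = \<kappa> None" by (simp_all add: stage_def t2_def p1_def p2_def Let_def)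
      then show ?thesis by (simp add: leads_to_refl)
    qed
    show ?thesis
      by (rule leads_to_mono[OF leads_to_trans[OF leads_to_trans[OF 1 2] 3]]) (simp add: algebra_simps)
  qed
qed

definition hop_tree :: "nat \<Rightarrow> nat \<Rightarrow> nat \<Rightarrow> nat \<Rightarrow> (bool list list \<Rightarrow> symbol) \<Rightarrow> index \<Rightarrow> (index option \<Rightarrow> tree) \<Rightarrow> tree" where
  "hop_tree t \<Lambda> L l = stage_tree l (run_length t \<Lambda>) (\<Lambda> * L * (3 * \<Lambda> * t ^ 4)) (\<Lambda>\<^sup>2 * (L * t ^ 4))"

definition then_tree :: "(index \<Rightarrow> (index option \<Rightarrow> tree) \<Rightarrow> tree) \<Rightarrow> (index option \<Rightarrow> tree) \<Rightarrow> index option \<Rightarrow> tree" where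
  "then_tree f \<kappa> p = (case p of None \<Rightarrow> \<kappa> None | Some a \<Rightarrow> f a \<kappa>)"

text \<open>High enough for the bands of three stages to stay in nonnegative rows; columns only
  increase.\<close>

definition start :: "nat \<Rightarrow> nat \<Rightarrow> index" where
  "start t \<Lambda> = (0, 3 * int (half_height t \<Lambda>))"

text \<open>The value on rejection only has to lie in the grid: \<open>fails\<close> counts every
  rejection as an error.\<close>

definition shift_hash :: "nat \<Rightarrow> nat \<Rightarrow> nat \<Rightarrow> (bool list list \<Rightarrow> symbol) \<Rightarrow> (bool list list \<Rightarrow> symbol) \<Rightarrow> (bool list list \<Rightarrow> symbol) \<Rightarrow> input \<Rightarrow> index" where
  "shift_hash t \<Lambda> l G1 G2 G3 x =
    (case hops t \<Lambda> (window_field l G1 x) (window_field l G2 x) (window_field l G3 x) (start t \<Lambda>) of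
       None \<Rightarrow> (0, 0) | Some a \<Rightarrow> a)"

lemma leads_to_hop:
  assumes t: "t \<ge> 1" and L: "L \<le> t ^ 3" and D: "\<And>q. q \<in> strip (width t \<Lambda>) (half_height t \<Lambda>) p \<Longrightarrow> set (cells l q) \<subseteq> D"
  shows "leads_to x (l * (11 * (\<Lambda>\<^sup>2 * t ^ 8))) D (hop_tree t \<Lambda> L l G p \<kappa>) (\<kappa> (hop t \<Lambda> L (window_field l G x) p))"
proof (rule leads_to_mono)
  show "leads_to x (l * (run_length t \<Lambda> + 2 * (\<Lambda>\<^sup>2 * (L * t ^ 4)))) D (hop_tree t \<Lambda> L l G p \<kappa>) (\<kappa> (hop t \<Lambda> L (window_field l G x) p))"
    unfolding hop_tree_def hop_def by (rule leads_to_stage, rule D, rule subsetD[OF hop_strip[OF t L]])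
  show "l * (run_length t \<Lambda> + 2 * (\<Lambda>\<^sup>2 * (L * t ^ 4))) \<le> l * (11 * (\<Lambda>\<^sup>2 * t ^ 8))"
    using hop_sizes(1)[OF t L, of \<Lambda>] by (intro mult_le_mono2) (simp add: run_length_eq width_def)
qed

text \<open>With y = \<Lambda>^2 t^8, three stages span 30y columns and a window fewer than 8y
  further ones, since \<Lambda> \<le> y.\<close>

lemma cells_grid:
  assumes n: "40 * (\<Lambda>\<^sup>2 * t ^ 8) \<le> n" and t: "t \<ge> 1" and \<Lambda>: "\<Lambda> \<ge> 1" and l: "l = 8 * \<Lambda>"
    and q: "0 \<le> fst q" "fst q \<le> 3 * int (width t \<Lambda>)" "0 \<le> snd q" "snd q \<le> 6 * int (half_height t \<Lambda>) + 1"
  shows "set (cells l q) \<subseteq> grid n"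
proof
  fix c assume "c \<in> set (cells l q)"
  then obtain m where m: "m < l" "c = q + (int m, 0)" by (auto simp: cells_def)
  define y where "y = \<Lambda>\<^sup>2 * t ^ 8"
  have "\<Lambda> * 1 \<le> \<Lambda> * (\<Lambda> * t ^ 8)" using t \<Lambda> by (intro mult_le_mono2) simp
  then have y: "\<Lambda> \<le> y" by (simp add: y_def power2_eq_square mult.assoc)
  have "fst c < int n"
    using m q(2) l n y \<Lambda> by (simp add: width_def flip: y_def)
  moreover have "snd c < int n"
    using m q(4) n y \<Lambda> by (simp add: half_height_def flip: y_def)
  moreover have "0 \<le> fst c" "0 \<le> snd c" using m q by auto
  ultimately show "c \<in> grid n" by (cases c) (simp add: grid_def)
qed

section \<open>The hash function\<close>

lemma leads_to_then:
  assumes "\<And>a. p = Some a \<Longrightarrow> leads_to x m D (f a \<kappa>) (\<kappa> (g a))"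
  shows "leads_to x m D (then_tree f \<kappa> p) (\<kappa> (Option.bind p g))"
  using assms by (cases p) (auto simp: then_tree_def leads_to_refl)

definition result_tree :: "index option \<Rightarrow> tree" where
  "result_tree p = Output (case p of None \<Rightarrow> (0, 0) | Some a \<Rightarrow> a)"

definition hash_tree :: "nat \<Rightarrow> nat \<Rightarrow> nat \<Rightarrow> (bool list list \<Rightarrow> symbol) \<Rightarrow> (bool list list \<Rightarrow> symbol) \<Rightarrow> (bool list list \<Rightarrow> symbol) \<Rightarrow> tree" where
  "hash_tree t \<Lambda> l G1 G2 G3 = hop_tree t \<Lambda> 1 l G1 (start t \<Lambda>)
     (then_tree (hop_tree t \<Lambda> (t\<^sup>2) l G2) (then_tree (hop_tree t \<Lambda> (t ^ 3) l G3) result_tree))"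

text \<open>The inclusive column bound and the extra row make room for the starts moved by a unit
  vector.\<close>

definition region :: "nat \<Rightarrow> nat \<Rightarrow> index set" where
  "region t \<Lambda> = {0..3 * int (width t \<Lambda>)} \<times> {0..6 * int (half_height t \<Lambda>) + 1}"

lemma region_iff:
  "q \<in> region t \<Lambda> \<longleftrightarrow> 0 \<le> fst q \<and> fst q \<le> 3 * int (width t \<Lambda>) \<and> 0 \<le> snd q \<and> snd q \<le> 6 * int (half_height t \<Lambda>) + 1"
  by (cases q) (simp add: region_def)

lemma start_strip:
  assumes "e = (0, 0) \<or> e \<in> unit_vectors"
  shows "strip (3 * width t \<Lambda>) (3 * half_height t \<Lambda>) (start t \<Lambda> + e) \<subseteq> region t \<Lambda>"
  using assms by (auto simp: strip_def start_def region_def unit_vectors_def)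

lemma shift_hash_computable:
  assumes n: "40 * (\<Lambda>\<^sup>2 * t ^ 8) \<le> n" and t: "t \<ge> 1" and \<Lambda>: "\<Lambda> \<ge> 1" and d: "264 * (\<Lambda> ^ 3 * t ^ 8) \<le> d"
  shows "computable_with_queries n b d (shift_hash t \<Lambda> (8 * \<Lambda>) G1 G2 G3)"
  unfolding computable_with_queries_def
proof (intro exI[of _ "hash_tree t \<Lambda> (8 * \<Lambda>) G1 G2 G3"] ballI)
  fix x
  let ?l = "8 * \<Lambda>"
  let ?o1 = "hop t \<Lambda> 1 (window_field ?l G1 x) (start t \<Lambda>)"
  let ?o2 = "Option.bind ?o1 (hop t \<Lambda> (t\<^sup>2) (window_field ?l G2 x))"
  let ?o3 = "Option.bind ?o2 (hop t \<Lambda> (t ^ 3) (window_field ?l G3 x))"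
  let ?m = "?l * (11 * (\<Lambda>\<^sup>2 * t ^ 8))"
  have R: "strip (3 * width t \<Lambda>) (3 * half_height t \<Lambda>) (start t \<Lambda>) \<subseteq> region t \<Lambda>"
    using start_strip[of "(0, 0)" t \<Lambda>] by (simp add: zero_prod_def[symmetric])
  have D: "set (cells ?l q) \<subseteq> grid n" if "q \<in> strip (width t \<Lambda>) (half_height t \<Lambda>) p"
    "strip (width t \<Lambda>) (half_height t \<Lambda>) p \<subseteq> strip (3 * width t \<Lambda>) (3 * half_height t \<Lambda>) (start t \<Lambda>)" for p q
  proof -
    have "q \<in> region t \<Lambda>" using that R by blast
    then show ?thesis by (intro cells_grid[OF n t \<Lambda> refl]) (auto simp: region_def)
  qed
  note S = hops_strip[OF t, where \<Lambda> = \<Lambda> and p = "start t \<Lambda>"]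
  have 1: "leads_to x ?m (grid n) (hash_tree t \<Lambda> ?l G1 G2 G3)
      (then_tree (hop_tree t \<Lambda> (t\<^sup>2) ?l G2) (then_tree (hop_tree t \<Lambda> (t ^ 3) ?l G3) result_tree) ?o1)"
    unfolding hash_tree_def by (rule leads_to_hop[OF t power_facts(3)[OF t] D[OF _ S(1)]])
  have 2: "leads_to x ?m (grid n)
      (then_tree (hop_tree t \<Lambda> (t\<^sup>2) ?l G2) (then_tree (hop_tree t \<Lambda> (t ^ 3) ?l G3) result_tree) ?o1)
      (then_tree (hop_tree t \<Lambda> (t ^ 3) ?l G3) result_tree ?o2)"
    by (rule leads_to_then, rule leads_to_hop[OF t power_facts(2)[OF t] D[OF _ S(2)]])
  have 3: "leads_to x ?m (grid n) (then_tree (hop_tree t \<Lambda> (t ^ 3) ?l G3) result_tree ?o2) (result_tree ?o3)"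
    by (rule leads_to_then, rule leads_to_hop[OF t power_facts(5)[OF t] D[OF _ S(3)]])
  have "?m + ?m + ?m = 264 * (\<Lambda> ^ 3 * t ^ 8)" by (simp add: power3_eq_cube power2_eq_square)
  then have "?m + ?m + ?m \<le> d" using d by (simp only:)
  with leads_to_trans[OF leads_to_trans[OF 1 2] 3]
  have "leads_to x d (grid n) (hash_tree t \<Lambda> ?l G1 G2 G3) (result_tree ?o3)" by (rule leads_to_mono)
  then show "run (hash_tree t \<Lambda> ?l G1 G2 G3) x = shift_hash t \<Lambda> ?l G1 G2 G3 x \<and>
      length (queries (hash_tree t \<Lambda> ?l G1 G2 G3) x) \<le> d \<and> set (queries (hash_tree t \<Lambda> ?l G1 G2 G3) x) \<subseteq> grid n"
    by (auto simp: leads_to_def result_tree_def shift_hash_def hops_def)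
qed

section \<open>Locality of the hash function and its behaviour under shifts\<close>

lemma hops_cong:
  assumes t: "t \<ge> 1"
    and eq: "\<And>q. q \<in> strip (3 * width t \<Lambda>) (3 * half_height t \<Lambda>) p \<Longrightarrow> Z1 q = Z1' q \<and> Z2 q = Z2' q \<and> Z3 q = Z3' q"
  shows "hops t \<Lambda> Z1 Z2 Z3 p = hops t \<Lambda> Z1' Z2' Z3' p"
proof -
  note S = hops_strip[OF t, where \<Lambda> = \<Lambda> and p = p] and P = power_facts[OF t]
  have 1: "hop t \<Lambda> 1 Z1 p = hop t \<Lambda> 1 Z1' p"
    using S(1) eq by (intro hop_cong[OF t P(3)]) blast
  have 2: "Option.bind (hop t \<Lambda> 1 Z1 p) (hop t \<Lambda> (t\<^sup>2) Z2) = Option.bind (hop t \<Lambda> 1 Z1 p) (hop t \<Lambda> (t\<^sup>2) Z2')"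
    by (rule Option.bind_cong[OF refl], rule hop_cong[OF t P(2)]) (use S(2) eq in blast)
  have 3: "Option.bind (Option.bind (hop t \<Lambda> 1 Z1 p) (hop t \<Lambda> (t\<^sup>2) Z2)) (hop t \<Lambda> (t ^ 3) Z3)
      = Option.bind (Option.bind (hop t \<Lambda> 1 Z1 p) (hop t \<Lambda> (t\<^sup>2) Z2)) (hop t \<Lambda> (t ^ 3) Z3')"
    by (rule Option.bind_cong[OF refl], rule hop_cong[OF t P(5)]) (use S(3) eq in blast)
  show ?thesis unfolding hops_def 1[symmetric] 2[symmetric] by (rule 3)
qed

lemma hops_translate:
  "map_option (\<lambda>p. p + e) (hops t \<Lambda> (translate e Z1) (translate e Z2) (translate e Z3) p) = hops t \<Lambda> Z1 Z2 Z3 (p + e)"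
  unfolding hops_def hop_translate[symmetric]
  by (cases "hop t \<Lambda> 1 (translate e Z1) p"; simp add: hop_translate[symmetric])
    (rename_tac a, case_tac "hop t \<Lambda> (t\<^sup>2) (translate e Z2) a"; simp add: hop_translate[symmetric])

lemma shift_hash_bounds:
  assumes t: "t \<ge> 1"
  shows "0 \<le> fst (shift_hash t \<Lambda> l G1 G2 G3 x)" "fst (shift_hash t \<Lambda> l G1 G2 G3 x) \<le> 3 * int (width t \<Lambda>)"
    "0 \<le> snd (shift_hash t \<Lambda> l G1 G2 G3 x)" "snd (shift_hash t \<Lambda> l G1 G2 G3 x) \<le> 6 * int (half_height t \<Lambda>)"
  using hops_strip(4)[OF t, of \<Lambda> "window_field l G1 x" "window_field l G2 x" "window_field l G3 x" "start t \<Lambda>"]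
  unfolding shift_hash_def by (auto simp: strip_def start_def split: option.split)

text \<open>By translation, the shifted input amounts to a second starting point on the same field.\<close>

definition fails :: "nat \<Rightarrow> nat \<Rightarrow> index \<Rightarrow> (index \<Rightarrow> symbol) \<Rightarrow> (index \<Rightarrow> symbol) \<Rightarrow> (index \<Rightarrow> symbol) \<Rightarrow> bool" where
  "fails t \<Lambda> e Z1 Z2 Z3 \<longleftrightarrow> hops t \<Lambda> Z1 Z2 Z3 (start t \<Lambda>) = None \<or>
     hops t \<Lambda> Z1 Z2 Z3 (start t \<Lambda>) \<noteq> hops t \<Lambda> Z1 Z2 Z3 (start t \<Lambda> + e)"

text \<open>All windows read from either start fit in the grid, so only cells with both
  \<open>q\<close> and \<open>q + e\<close> in the grid are compared. Cyclic and non-cyclic shifts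
  both satisfy the premise on \<open>x'\<close>, and wrapped or fresh cells are never seen. The
  identity holds over the integers.\<close>

lemma shift_hash_shift:
  assumes n: "40 * (\<Lambda>\<^sup>2 * t ^ 8) \<le> n" and t: "t \<ge> 1" and \<Lambda>: "\<Lambda> \<ge> 1" and l: "l = 8 * \<Lambda>"
    and e: "e \<in> unit_vectors" and x': "\<And>q. q \<in> grid n \<Longrightarrow> q + e \<in> grid n \<Longrightarrow> x' q = x (q + e)"
    and ok: "\<not> fails t \<Lambda> e (window_field l G1 x) (window_field l G2 x) (window_field l G3 x)"
  shows "shift_hash t \<Lambda> l G1 G2 G3 x = shift_hash t \<Lambda> l G1 G2 G3 x' + e"
proof -
  have f: "window_field l G x' q = translate e (window_field l G x) q"
    if q: "q \<in> strip (3 * width t \<Lambda>) (3 * half_height t \<Lambda>) (start t \<Lambda>)" for G q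
  proof -
    have "q \<in> region t \<Lambda>"
      using q start_strip[of "(0, 0)" t \<Lambda>] by (auto simp: zero_prod_def[symmetric])
    then have c: "set (cells l q) \<subseteq> grid n"
      by (intro cells_grid[OF n t \<Lambda> l]) (simp_all only: region_iff)
    have "q + e \<in> strip (3 * width t \<Lambda>) (3 * half_height t \<Lambda>) (start t \<Lambda> + e)"
      using q by (cases q; cases e) (auto simp: strip_def)
    then have "q + e \<in> region t \<Lambda>" using start_strip[of e t \<Lambda>] e by auto
    then have c': "set (cells l (q + e)) \<subseteq> grid n"
      by (intro cells_grid[OF n t \<Lambda> l]) (simp_all only: region_iff)
    have "map x' (cells l q) = map x (cells l (q + e))"
      unfolding cells_def map_map
    proof (rule map_cong[OF refl])
      fix m assume "m \<in> set [0..<l]"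
      then have "q + (int m, 0) \<in> grid n" "q + e + (int m, 0) \<in> grid n"
        using c c' by (auto simp: cells_def)
      then show "(x' \<circ> (\<lambda>m. q + (int m, 0))) m = (x \<circ> (\<lambda>m. q + e + (int m, 0))) m"
        using x'[of "q + (int m, 0)"] by (simp add: add.assoc add.commute add.left_commute)
    qed
    then show ?thesis by (simp add: window_field_def translate_def)
  qed
  let ?h = "\<lambda>x. hops t \<Lambda> (window_field l G1 x) (window_field l G2 x) (window_field l G3 x)"
  have "map_option (\<lambda>p. p + e) (?h x' (start t \<Lambda>)) = ?h x (start t \<Lambda> + e)"
    unfolding hops_translate[symmetric] by (rule arg_cong[OF hops_cong[OF t]]) (simp add: f)
  then show ?thesis
    using ok by (auto simp: fails_def shift_hash_def split: option.splits)
qed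

lemma fails_restrict:
  assumes t: "t \<ge> 1" and e: "e \<in> unit_vectors"
  shows "fails t \<Lambda> e (restrict Z1 (region t \<Lambda>)) (restrict Z2 (region t \<Lambda>)) (restrict Z3 (region t \<Lambda>)) = fails t \<Lambda> e Z1 Z2 Z3"
proof -
  have "hops t \<Lambda> (restrict Z1 (region t \<Lambda>)) (restrict Z2 (region t \<Lambda>)) (restrict Z3 (region t \<Lambda>)) (start t \<Lambda> + u)
      = hops t \<Lambda> Z1 Z2 Z3 (start t \<Lambda> + u)" if "u = (0, 0) \<or> u = e" for u
  proof (rule hops_cong[OF t])
    fix q assume "q \<in> strip (3 * width t \<Lambda>) (3 * half_height t \<Lambda>) (start t \<Lambda> + u)"
    then have "q \<in> region t \<Lambda>" using start_strip[of u t \<Lambda>] that e by auto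
    then show "restrict Z1 (region t \<Lambda>) q = Z1 q \<and> restrict Z2 (region t \<Lambda>) q = Z2 q \<and> restrict Z3 (region t \<Lambda>) q = Z3 q" by simp
  qed
  from this[of "(0, 0)"] this[of e] show ?thesis by (simp add: fails_def zero_prod_def[symmetric])
qed

lemma fails_prob:
  assumes t: "t \<ge> 1" and \<Lambda>: "\<Lambda> \<ge> 1" and e: "e \<in> unit_vectors"
  shows "field_avg3 (region t \<Lambda>) t (\<lambda>Z1 Z2 Z3. of_bool (fails t \<Lambda> e Z1 Z2 Z3)) \<le> 78 * exp (- real \<Lambda>) + 8 * 708 ^ 3 * real \<Lambda> ^ 6 / real t ^ 7"
  unfolding fails_def
proof (rule hops_fail_prob[OF _ t \<Lambda>])
  show "finite (region t \<Lambda>)" by (simp add: region_def)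
  show "strip (3 * width t \<Lambda>) (3 * half_height t \<Lambda>) (start t \<Lambda>) \<subseteq> region t \<Lambda>"
    using start_strip[of "(0, 0)" t \<Lambda>] by (simp add: zero_prod_def[symmetric])
  show "strip (3 * width t \<Lambda>) (3 * half_height t \<Lambda>) (start t \<Lambda> + e) \<subseteq> region t \<Lambda>" using start_strip e by blast
  show "grid_dist (start t \<Lambda>) (start t \<Lambda> + e) \<le> 1" using e by (auto simp: grid_dist_def unit_vectors_def)
qed

section \<open>Collisions of windows and choice of parameters\<close>

definition words :: "nat \<Rightarrow> nat \<Rightarrow> bool list list set" where
  "words l b = {ws. set ws \<subseteq> alphabet b \<and> length ws = l}"

lemma finite_alphabet: "finite (alphabet b)" and card_alphabet: "card (alphabet b) = 2 ^ b"
  using finite_lists_length_eq[of "UNIV :: bool set" b] card_lists_length_eq[of "UNIV :: bool set" b]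
  by (simp_all add: alphabet_def)

lemma alphabet_nonempty: "alphabet b \<noteq> {}"
  using card_alphabet[of b] by auto

lemma finite_words: "finite (words l b)"
  unfolding words_def by (rule finite_lists_length_eq[OF finite_alphabet])

lemma inputs_finite: "finite (inputs n b)" "inputs n b \<noteq> {}"
  by (auto simp: inputs_def grid_def finite_alphabet alphabet_nonempty PiE_eq_empty_iff intro!: finite_PiE)

lemma window_word: "x \<in> inputs n b \<Longrightarrow> set (cells l q) \<subseteq> grid n \<Longrightarrow> map x (cells l q) \<in> words l b"
  by (auto simp: words_def inputs_def)

lemma cells_Suc: "cells (Suc l) p = cells l p @ [p + (int l, 0)]"
  by (simp add: cells_def)

text \<open>The last cell of the window at \<open>q\<close> belongs to no shorter part of either window,
  so each position contributes a factor of at most \<open>1/2\<close>, even for overlapping windows.\<close>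

lemma window_collision:
  assumes b: "b \<ge> 1" and pq: "snd p \<noteq> snd q \<or> fst p < fst q" and q: "set (cells l q) \<subseteq> grid n"
  shows "avg (inputs n b) (\<lambda>x. of_bool (map x (cells l p) = map x (cells l q))) \<le> (1 / 2) ^ l"
  using q
proof (induction l)
  case 0
  then show ?case using inputs_finite by (simp add: cells_def avg_const)
next
  case (Suc l)
  let ?p = "p + (int l, 0)" and ?q = "q + (int l, 0)"
  define g where "g x = (of_bool (map x (cells l p) = map x (cells l q)) :: real)" for x :: input
  define F where "F \<sigma> x = g x * of_bool (x ?p = \<sigma>)" for \<sigma> and x :: input
  have "?q \<noteq> ?p" using pq by (cases p; cases q) auto
  moreover have "?q \<notin> set (cells l p)" "?q \<notin> set (cells l q)"
    using pq by (cases p; cases q; auto simp: cells_def)+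
  ultimately have upd: "F \<sigma> (x(?q := \<tau>)) = F \<sigma> x" for \<sigma> \<tau> x
    by (auto simp: F_def g_def map_fun_upd)
  have half: "avg (alphabet b) (\<lambda>\<sigma>. of_bool (a = \<sigma>)) \<le> 1 / 2" for a
  proof -
    have "(\<Sum>\<sigma>\<in>alphabet b. of_bool (a = \<sigma>) :: real) \<le> 1"
      using finite_alphabet[of b] by (simp add: of_bool_def sum.delta)
    moreover have "(2::real) \<le> 2 ^ b" using power_increasing[OF b, of "2::real"] by simp
    ultimately show ?thesis
      unfolding avg_def card_alphabet by (simp add: frac_le[of 1 _ 2])
  qed
  have "?q \<in> grid n" using Suc.prems by (simp add: cells_Suc)
  then have "avg (inputs n b) (\<lambda>x. F (x ?q) x) = avg (alphabet b) (\<lambda>\<sigma>. avg (inputs n b) (F \<sigma>))"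
    unfolding inputs_def using finite_alphabet alphabet_nonempty upd by (intro avg_reveal) auto
  also have "\<dots> = avg (inputs n b) (\<lambda>x. avg (alphabet b) (\<lambda>\<sigma>. F \<sigma> x))" by (rule avg_swap)
  also have "\<dots> \<le> avg (inputs n b) (\<lambda>x. 1 / 2 * g x)"
  proof (rule avg_mono)
    fix x
    show "avg (alphabet b) (\<lambda>\<sigma>. F \<sigma> x) \<le> 1 / 2 * g x"
      using half[of "x ?p"] by (auto simp: F_def avg_cmult g_def)
  qed
  also have "\<dots> \<le> 1 / 2 * (1 / 2) ^ l"
    unfolding avg_cmult g_def using Suc by (intro mult_left_mono Suc.IH) (auto simp: cells_Suc)
  also have "(\<lambda>x. F (x ?q) x) = (\<lambda>x. of_bool (map x (cells (Suc l) p) = map x (cells (Suc l) q)))"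
    by (auto simp: F_def g_def cells_Suc fun_eq_iff)
  finally show ?case by simp
qed

lemma windows_not_inj:
  assumes b: "b \<ge> 1" and Reg: "finite Reg" "\<And>q. q \<in> Reg \<Longrightarrow> set (cells l q) \<subseteq> grid n"
  shows "avg (inputs n b) (\<lambda>x. of_bool (\<not> inj_on (\<lambda>q. map x (cells l q)) Reg)) \<le> real (card Reg) ^ 2 * (1 / 2) ^ l"
proof -
  \<comment> \<open>For two cells of one row only the order with \<open>q\<close> on the right is
    kept, as \<open>window_collision\<close> demands.\<close>
  define P where "P = {(p, q) \<in> Reg \<times> Reg. snd p \<noteq> snd q \<or> fst p < fst q}"
  have P: "finite P" "card P \<le> card Reg ^ 2"
    using Reg(1) card_mono[of "Reg \<times> Reg" P] finite_subset[of P "Reg \<times> Reg"]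
    by (auto simp: P_def power2_eq_square card_cartesian_product)
  have bound: "of_bool (\<not> inj_on (\<lambda>q. map x (cells l q)) Reg)
      \<le> (\<Sum>r\<in>P. of_bool (map x (cells l (fst r)) = map x (cells l (snd r))) :: real)" for x
  proof (cases "inj_on (\<lambda>q. map x (cells l q)) Reg")
    case True
    then show ?thesis by (simp add: sum_nonneg)
  next
    case False
    then obtain p q where pq: "p \<in> Reg" "q \<in> Reg" "p \<noteq> q" "map x (cells l p) = map x (cells l q)"
      unfolding inj_on_def by blast
    have "(p, q) \<in> P \<or> (q, p) \<in> P" using pq by (cases p; cases q) (auto simp: P_def)
    then obtain r where r: "r \<in> P" "map x (cells l (fst r)) = map x (cells l (snd r))" using pq(4) by (metis fst_conv snd_conv)
    then have "1 \<le> (\<Sum>r\<in>P. of_bool (map x (cells l (fst r)) = map x (cells l (snd r))) :: real)"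
      using member_le_sum[of r P "\<lambda>r. of_bool (map x (cells l (fst r)) = map x (cells l (snd r))) :: real"] P by simp
    then show ?thesis using False by simp
  qed
  have "avg (inputs n b) (\<lambda>x. of_bool (\<not> inj_on (\<lambda>q. map x (cells l q)) Reg))
      \<le> avg (inputs n b) (\<lambda>x. \<Sum>r\<in>P. of_bool (map x (cells l (fst r)) = map x (cells l (snd r))))"
    by (intro avg_mono bound)
  also have "\<dots> = (\<Sum>r\<in>P. avg (inputs n b) (\<lambda>x. of_bool (map x (cells l (fst r)) = map x (cells l (snd r)))))"
    by (rule avg_sum)
  also have "\<dots> \<le> (\<Sum>r\<in>P. (1 / 2) ^ l)"
    by (intro sum_mono window_collision[OF b] Reg(2)) (auto simp: P_def)
  also have "\<dots> \<le> real (card Reg) ^ 2 * (1 / 2) ^ l"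
    using P(2) by (simp flip: of_nat_power)
  finally show ?thesis .
qed

section \<open>Random hashing of windows and the failure bound\<close>

definition hashers :: "nat \<Rightarrow> nat \<Rightarrow> nat \<Rightarrow> nat \<Rightarrow> (bool list list \<Rightarrow> symbol) set" where
  "hashers l b L M = (\<Pi>\<^sub>E ws \<in> words l b. symbols L M)"

lemma hashers_finite: "finite (hashers l b L M)" "M \<ge> 1 \<Longrightarrow> hashers l b L M \<noteq> {}"
  by (auto simp: hashers_def finite_words PiE_eq_empty_iff intro!: finite_PiE)

definition hash_dist :: "nat \<Rightarrow> nat \<Rightarrow> nat \<Rightarrow> (input \<Rightarrow> index) pmf" where
  "hash_dist t \<Lambda> b = do {
     G1 \<leftarrow> pmf_of_set (hashers (8 * \<Lambda>) b 1 (1 * t ^ 4));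
     G2 \<leftarrow> pmf_of_set (hashers (8 * \<Lambda>) b (t\<^sup>2) (t\<^sup>2 * t ^ 4));
     G3 \<leftarrow> pmf_of_set (hashers (8 * \<Lambda>) b (t ^ 3) (t ^ 3 * t ^ 4));
     return_pmf (shift_hash t \<Lambda> (8 * \<Lambda>) G1 G2 G3) }"

context
  fixes t \<Lambda> n b d :: nat
  assumes t: "t \<ge> 1" and \<Lambda>: "\<Lambda> \<ge> 1" and b: "b \<ge> 1"
    and n: "40 * (\<Lambda>\<^sup>2 * t ^ 8) \<le> n" and d: "264 * (\<Lambda> ^ 3 * t ^ 8) \<le> d"
begin

definition failure :: real where
  "failure = 78 * exp (- real \<Lambda>) + 8 * 708 ^ 3 * real \<Lambda> ^ 6 / real t ^ 7 + real (card (region t \<Lambda>)) ^ 2 * (1 / 2) ^ (8 * \<Lambda>)"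

text \<open>For a fixed input with distinct windows all randomness comes from the hashers. Read
  through the windows, they are exactly uniform fields on the region, so \<open>fails_prob\<close>
  applies.\<close>

lemma window_fails_prob:
  assumes e: "e \<in> unit_vectors" and x: "x \<in> inputs n b"
    and inj: "inj_on (\<lambda>q. map x (cells (8 * \<Lambda>) q)) (region t \<Lambda>)"
  shows "avg (hashers (8 * \<Lambda>) b 1 (1 * t ^ 4)) (\<lambda>G1. avg (hashers (8 * \<Lambda>) b (t\<^sup>2) (t\<^sup>2 * t ^ 4)) (\<lambda>G2.
      avg (hashers (8 * \<Lambda>) b (t ^ 3) (t ^ 3 * t ^ 4)) (\<lambda>G3. of_bool (fails t \<Lambda> e
        (window_field (8 * \<Lambda>) G1 x) (window_field (8 * \<Lambda>) G2 x) (window_field (8 * \<Lambda>) G3 x)))))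
    \<le> 78 * exp (- real \<Lambda>) + 8 * 708 ^ 3 * real \<Lambda> ^ 6 / real t ^ 7"
proof -
  let ?l = "8 * \<Lambda>" and ?Reg = "region t \<Lambda>"
  define w where "w q = map x (cells ?l q)" for q
  define r where "r G = (\<lambda>q\<in>?Reg. G (w q))" for G :: "bool list list \<Rightarrow> symbol"
  have r: "restrict (window_field ?l G x) ?Reg = r G" for G
    by (auto simp: window_field_def r_def w_def)
  have W: "w ` ?Reg \<subseteq> words ?l b"
  proof
    fix ws assume "ws \<in> w ` ?Reg"
    then obtain q where q: "q \<in> ?Reg" "ws = w q" by blast
    have "set (cells ?l q) \<subseteq> grid n"
      using q by (intro cells_grid[OF n t \<Lambda> refl]) (simp_all only: region_iff)
    then show "ws \<in> words ?l b" using window_word[OF x] q by (simp add: w_def)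
  qed
  have pull: "avg (hashers ?l b L M) (\<lambda>G. f (r G)) = field_avg ?Reg L M f" if "M \<ge> 1" for L M f
    unfolding hashers_def r_def field_avg_def
    using W inj that by (intro avg_PiE_pullback) (auto simp: finite_words w_def)
  have M: "1 * t ^ 4 \<ge> 1" "t\<^sup>2 * t ^ 4 \<ge> 1" "t ^ 3 * t ^ 4 \<ge> 1" using t by simp_all
  have f: "fails t \<Lambda> e (window_field ?l G1 x) (window_field ?l G2 x) (window_field ?l G3 x) = fails t \<Lambda> e (r G1) (r G2) (r G3)" for G1 G2 G3
    unfolding r[symmetric] by (rule fails_restrict[OF t e, symmetric])
  show ?thesis
    unfolding f pull[OF M(3), of _ "\<lambda>Z. of_bool (fails t \<Lambda> e _ _ Z)"]
      pull[OF M(2), of _ "\<lambda>Z2. field_avg ?Reg (t ^ 3) (t ^ 3 * t ^ 4) (\<lambda>Z. of_bool (fails t \<Lambda> e _ Z2 Z))"]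
      pull[OF M(1), of _ "\<lambda>Z1. field_avg ?Reg (t\<^sup>2) (t\<^sup>2 * t ^ 4) (\<lambda>Z2. field_avg ?Reg (t ^ 3) (t ^ 3 * t ^ 4) (\<lambda>Z. of_bool (fails t \<Lambda> e Z1 Z2 Z)))"]
    using fails_prob[OF t \<Lambda> e] unfolding field_avg3_def .
qed

text \<open>\<open>Q\<close> stands for the cyclic or the non-cyclic test, including any randomness
  of the shift; it may report an error only where \<open>fails\<close> holds. Swapping the averages
  fixes the input before the hashers are drawn.\<close>

lemma hash_dist_prob:
  fixes Q :: "(input \<Rightarrow> index) \<Rightarrow> input \<Rightarrow> bool pmf"
  assumes e: "e \<in> unit_vectors"
    and Q: "\<And>G1 G2 G3 x. x \<in> inputs n b \<Longrightarrow> \<not> fails t \<Lambda> e (window_field (8 * \<Lambda>) G1 x) (window_field (8 * \<Lambda>) G2 x) (window_field (8 * \<Lambda>) G3 x)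
      \<Longrightarrow> pmf (Q (shift_hash t \<Lambda> (8 * \<Lambda>) G1 G2 G3) x) True = 0"
  shows "pmf (do { h \<leftarrow> hash_dist t \<Lambda> b; x \<leftarrow> pmf_of_set (inputs n b); Q h x }) True \<le> failure"
proof -
  let ?l = "8 * \<Lambda>"
  define A1 where "A1 = hashers ?l b 1 (1 * t ^ 4)"
  define A2 where "A2 = hashers ?l b (t\<^sup>2) (t\<^sup>2 * t ^ 4)"
  define A3 where "A3 = hashers ?l b (t ^ 3) (t ^ 3 * t ^ 4)"
  define B where "B G1 G2 G3 x = (of_bool (fails t \<Lambda> e (window_field ?l G1 x) (window_field ?l G2 x) (window_field ?l G3 x)) :: real)" for G1 G2 G3 x
  have A: "finite A1" "A1 \<noteq> {}" "finite A2" "A2 \<noteq> {}" "finite A3" "A3 \<noteq> {}"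
    using t by (simp_all add: A1_def A2_def A3_def hashers_finite)
  have "pmf (do { h \<leftarrow> hash_dist t \<Lambda> b; x \<leftarrow> pmf_of_set (inputs n b); Q h x }) True
      = avg A1 (\<lambda>G1. avg A2 (\<lambda>G2. avg A3 (\<lambda>G3. avg (inputs n b) (\<lambda>x. pmf (Q (shift_hash t \<Lambda> ?l G1 G2 G3) x) True))))"
    unfolding hash_dist_def A1_def[symmetric] A2_def[symmetric] A3_def[symmetric]
    by (simp add: bind_assoc_pmf bind_return_pmf pmf_bind_of_set_avg A inputs_finite)
  also have "\<dots> \<le> avg A1 (\<lambda>G1. avg A2 (\<lambda>G2. avg A3 (\<lambda>G3. avg (inputs n b) (B G1 G2 G3))))"
  proof (intro avg_mono)
    fix G1 G2 G3 x assume "x \<in> inputs n b"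
    then show "pmf (Q (shift_hash t \<Lambda> ?l G1 G2 G3) x) True \<le> B G1 G2 G3 x"
      using Q[of x G1 G2 G3] by (cases "B G1 G2 G3 x = 0") (auto simp: B_def pmf_le_1)
  qed
  also have "\<dots> = avg (inputs n b) (\<lambda>x. avg A1 (\<lambda>G1. avg A2 (\<lambda>G2. avg A3 (\<lambda>G3. B G1 G2 G3 x))))"
    by (simp only: avg_swap[of _ "inputs n b"])
  also have "\<dots> \<le> avg (inputs n b) (\<lambda>x. (78 * exp (- real \<Lambda>) + 8 * 708 ^ 3 * real \<Lambda> ^ 6 / real t ^ 7)
      + of_bool (\<not> inj_on (\<lambda>q. map x (cells ?l q)) (region t \<Lambda>)))"
  proof (rule avg_mono)
    fix x assume x: "x \<in> inputs n b"
    show "avg A1 (\<lambda>G1. avg A2 (\<lambda>G2. avg A3 (\<lambda>G3. B G1 G2 G3 x))) \<le> (78 * exp (- real \<Lambda>) + 8 * 708 ^ 3 * real \<Lambda> ^ 6 / real t ^ 7)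
      + of_bool (\<not> inj_on (\<lambda>q. map x (cells ?l q)) (region t \<Lambda>))"
    proof (cases "inj_on (\<lambda>q. map x (cells ?l q)) (region t \<Lambda>)")
      case True
      then show ?thesis using window_fails_prob[OF e x True] by (simp add: B_def A1_def A2_def A3_def)
    next
      case False
      have "avg A1 (\<lambda>G1. avg A2 (\<lambda>G2. avg A3 (\<lambda>G3. B G1 G2 G3 x))) \<le> 1"
        by (intro avg_le_const A) (simp add: B_def)
      moreover have "0 \<le> 78 * exp (- real \<Lambda>) + 8 * 708 ^ 3 * real \<Lambda> ^ 6 / real t ^ 7" by simp
      ultimately show ?thesis by (simp only: False not_False_eq_True of_bool_eq)
    qed
  qed
  also have "\<dots> \<le> failure"
    unfolding avg_add failure_def avg_const[OF inputs_finite]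
  proof (intro add_left_mono windows_not_inj[OF b])
    show "finite (region t \<Lambda>)" by (simp add: region_def)
    show "set (cells ?l q) \<subseteq> grid n" if "q \<in> region t \<Lambda>" for q
      using that by (intro cells_grid[OF n t \<Lambda> refl]) (simp_all only: region_iff)
  qed
  finally show ?thesis .
qed

lemma set_hash_dist:
  assumes "h \<in> set_pmf (hash_dist t \<Lambda> b)"
  obtains G1 G2 G3 where "h = shift_hash t \<Lambda> (8 * \<Lambda>) G1 G2 G3"
  using assms unfolding hash_dist_def by auto

lemma shift_hash_grid: "shift_hash t \<Lambda> (8 * \<Lambda>) G1 G2 G3 x \<in> grid n"
proof -
  have "1 * 1 \<le> \<Lambda>\<^sup>2 * t ^ 8" using t \<Lambda> by (intro mult_le_mono) auto
  then have "3 * width t \<Lambda> < n" "6 * half_height t \<Lambda> < n"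
    using n unfolding width_def half_height_def by linarith+
  then show ?thesis
    using shift_hash_bounds[OF t, where \<Lambda> = \<Lambda> and l = "8 * \<Lambda>" and x = x and ?G1.0 = G1 and ?G2.0 = G2 and ?G3.0 = G3]
    by (cases "shift_hash t \<Lambda> (8 * \<Lambda>) G1 G2 G3 x") (simp add: grid_def)
qed

lemma wrap_grid: "p \<in> grid n \<Longrightarrow> wrap n p = p"
  by (auto simp: wrap_def grid_def)

lemma hash_dist_cyclic: "cyclic_lphs n b d failure (hash_dist t \<Lambda> b)"
  unfolding cyclic_lphs_def
proof (intro conjI ballI)
  fix h assume "h \<in> set_pmf (hash_dist t \<Lambda> b)"
  then obtain G1 G2 G3 where h: "h = shift_hash t \<Lambda> (8 * \<Lambda>) G1 G2 G3" by (rule set_hash_dist)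
  show "computable_with_queries n b d h" unfolding h by (rule shift_hash_computable[OF n t \<Lambda> d])
  show "h x \<in> grid n" for x unfolding h by (rule shift_hash_grid)
next
  fix e assume e: "e \<in> unit_vectors"
  show "pmf (do { h \<leftarrow> hash_dist t \<Lambda> b; x \<leftarrow> pmf_of_set (inputs n b);
      return_pmf (h x \<noteq> wrap n (h (cyclic_shift n e x) + e)) }) True \<le> failure"
  proof (rule hash_dist_prob[OF e])
    fix G1 G2 G3 x
    let ?h = "shift_hash t \<Lambda> (8 * \<Lambda>) G1 G2 G3"
    assume ok: "\<not> fails t \<Lambda> e (window_field (8 * \<Lambda>) G1 x) (window_field (8 * \<Lambda>) G2 x) (window_field (8 * \<Lambda>) G3 x)"
    have "?h x = ?h (cyclic_shift n e x) + e"
      using ok by (intro shift_hash_shift[OF n t \<Lambda> refl e]) (auto simp: cyclic_shift_def wrap_grid)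
    \<comment> \<open>The left side lies in the grid, so reduction modulo \<open>n\<close> does not
      change the integer identity.\<close>
    then have "?h x = wrap n (?h (cyclic_shift n e x) + e)"
      using wrap_grid[OF shift_hash_grid[of G1 G2 G3 x]] by simp
    then show "pmf (return_pmf (?h x \<noteq> wrap n (?h (cyclic_shift n e x) + e))) True = 0" by simp
  qed
qed

lemma hash_dist_noncyclic: "noncyclic_lphs n b d failure (hash_dist t \<Lambda> b)"
  unfolding noncyclic_lphs_def
proof (intro conjI ballI)
  fix h assume "h \<in> set_pmf (hash_dist t \<Lambda> b)"
  then obtain G1 G2 G3 where h: "h = shift_hash t \<Lambda> (8 * \<Lambda>) G1 G2 G3" by (rule set_hash_dist)
  show "computable_with_queries n b d h" unfolding h by (rule shift_hash_computable[OF n t \<Lambda> d])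
next
  fix e assume e: "e \<in> unit_vectors"
  show "pmf (do { h \<leftarrow> hash_dist t \<Lambda> b; x \<leftarrow> pmf_of_set (inputs n b); x' \<leftarrow> noncyclic_shift n b e x;
      return_pmf (h x \<noteq> h x' + e) }) True \<le> failure"
  proof (rule hash_dist_prob[OF e])
    fix G1 G2 G3 x
    let ?h = "shift_hash t \<Lambda> (8 * \<Lambda>) G1 G2 G3"
    assume ok: "\<not> fails t \<Lambda> e (window_field (8 * \<Lambda>) G1 x) (window_field (8 * \<Lambda>) G2 x) (window_field (8 * \<Lambda>) G3 x)"
    have "?h x = ?h x' + e" if "x' \<in> set_pmf (noncyclic_shift n b e x)" for x'
      using ok that
      by (intro shift_hash_shift[OF n t \<Lambda> refl e]) (auto simp: noncyclic_shift_def fresh_cells_def)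
    then have "True \<notin> set_pmf (do { x' \<leftarrow> noncyclic_shift n b e x; return_pmf (?h x \<noteq> ?h x' + e) })"
      by auto
    then show "pmf (do { x' \<leftarrow> noncyclic_shift n b e x; return_pmf (?h x \<noteq> ?h x' + e) }) True = 0"
      by (simp only: set_pmf_iff not_not)
  qed
qed

text \<open>Rejections have probability of order 1/d \<le> t^-7. For collisions, the region has at
  most d^2 cells, and e^5 \<le> 2^8 makes windows of 8\<Lambda> entries long enough: 2^(8\<Lambda>)
  \<ge> d^5.\<close>

lemma failure_le:
  assumes "real d \<le> exp (real \<Lambda>)"
  shows "failure \<le> (8 * 708 ^ 3 + 79) * real \<Lambda> ^ 6 / real t ^ 7"
proof -
  have y: "1 * 1 \<le> \<Lambda>\<^sup>2 * t ^ 8" using t \<Lambda> by (intro mult_le_mono) auto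
  have "1 * (1 * t ^ 8) \<le> \<Lambda> ^ 3 * t ^ 8" "\<Lambda>\<^sup>2 * t ^ 8 \<le> \<Lambda> ^ 3 * t ^ 8"
    using \<Lambda> by (auto intro!: mult_le_mono1 power_increasing)
  then have td: "t ^ 8 \<le> d" and yd: "40 * (\<Lambda>\<^sup>2 * t ^ 8) \<le> d" using d by linarith+
  have "1 \<le> t ^ 8" using t by simp
  then have d1: "1 \<le> real d" using td by linarith
  have "t ^ 7 \<le> t ^ 8" using t by (simp add: power_increasing)
  then have "t ^ 7 \<le> d" using td by linarith
  then have td7: "1 / real d \<le> 1 / real t ^ 7"
    using t d1 by (intro divide_left_mono) (simp_all flip: of_nat_power)
  have e1: "exp (- real \<Lambda>) \<le> 1 / real d"
    using assms d1 by (simp add: exp_minus inverse_eq_divide frac_le)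
  have "card (region t \<Lambda>) = (3 * width t \<Lambda> + 1) * (6 * half_height t \<Lambda> + 2)"
    by (simp add: region_def card_cartesian_product nat_add_distrib nat_mult_distrib)
  also have "\<dots> \<le> d * d"
    using y yd unfolding width_def half_height_def by (intro mult_le_mono) linarith+
  finally have "real (card (region t \<Lambda>)) \<le> real d ^ 2"
    by (simp add: power2_eq_square flip: of_nat_mult)
  then have c: "real (card (region t \<Lambda>)) ^ 2 \<le> real d ^ 4"
    using power_mono[of "real (card (region t \<Lambda>))" "real d ^ 2" 2] by (simp flip: power_mult)
  have "exp (1::real) ^ 5 \<le> (272 / 100) ^ 5" using e_less_272 by (intro power_mono) auto
  also have "\<dots> \<le> (2::real) ^ 8" by (simp add: power_divide)
  finally have "(exp 1 ^ 5) ^ \<Lambda> \<le> ((2::real) ^ 8) ^ \<Lambda>" by (intro power_mono) auto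
  moreover have "exp (real \<Lambda>) = exp 1 ^ \<Lambda>" using exp_of_nat_mult[of \<Lambda> "1::real"] by simp
  ultimately have "(exp (real \<Lambda>)) ^ 5 \<le> (2::real) ^ (8 * \<Lambda>)"
    by (simp only: power_mult[symmetric] mult.commute[of \<Lambda>])
  then have "real d ^ 5 \<le> 2 ^ (8 * \<Lambda>)"
    using power_mono[OF assms, of 5] by (meson of_nat_0_le_iff order_trans)
  then have "real (card (region t \<Lambda>)) ^ 2 * (1 / 2) ^ (8 * \<Lambda>) \<le> real d ^ 4 * (1 / real d ^ 5)"
    using c d1 by (intro mult_mono) (auto simp: power_one_over frac_le)
  also have "\<dots> = 1 / real d" using d1 by (simp add: power_eq_if)
  finally have "failure \<le> 79 * (1 / real t ^ 7) + 8 * 708 ^ 3 * real \<Lambda> ^ 6 / real t ^ 7"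
    using e1 td7 unfolding failure_def by linarith
  also have "\<dots> \<le> 79 * (real \<Lambda> ^ 6 / real t ^ 7) + 8 * 708 ^ 3 * real \<Lambda> ^ 6 / real t ^ 7"
    using \<Lambda> by (intro add_right_mono mult_left_mono divide_right_mono) auto
  also have "\<dots> = (8 * 708 ^ 3 + 79) * real \<Lambda> ^ 6 / real t ^ 7" by (simp add: field_simps)
  finally show ?thesis .
qed

end

section \<open>Choice of parameters\<close>

lemma cyclic_lphs_mono: "cyclic_lphs n b d \<delta> H \<Longrightarrow> \<delta> \<le> \<delta>' \<Longrightarrow> cyclic_lphs n b d \<delta>' H"
  unfolding cyclic_lphs_def by (meson order_trans)

lemma noncyclic_lphs_mono: "noncyclic_lphs n b d \<delta> H \<Longrightarrow> \<delta> \<le> \<delta>' \<Longrightarrow> noncyclic_lphs n b d \<delta>' H"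
  unfolding noncyclic_lphs_def by (meson order_trans)

lemma trivial_lphs:
  assumes "n \<ge> 1" "\<delta> \<ge> 1"
  shows "cyclic_lphs n b d \<delta> (return_pmf (\<lambda>_. (0, 0)))" "noncyclic_lphs n b d \<delta> (return_pmf (\<lambda>_. (0, 0)))"
proof -
  have "computable_with_queries n b d (\<lambda>_. (0, 0))"
    unfolding computable_with_queries_def by (rule exI[of _ "Output (0, 0)"]) simp
  then show "cyclic_lphs n b d \<delta> (return_pmf (\<lambda>_. (0, 0)))" "noncyclic_lphs n b d \<delta> (return_pmf (\<lambda>_. (0, 0)))"
    unfolding cyclic_lphs_def noncyclic_lphs_def
    using assms by (auto simp: grid_def intro!: order_trans[OF pmf_le_1])
qed


theorem theorem2:
  fixes c :: real and k :: nat
  assumes "c > 0"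
  shows "\<exists>(C::real) (m::nat). \<forall>(b::nat) (n::nat) (d::nat).
    b \<ge> 1 \<longrightarrow> d \<ge> 1 \<longrightarrow> real n \<ge> c * real d / (1 + ln (real d)) ^ k \<longrightarrow>
      (\<exists>H. cyclic_lphs n b d (C * real d powr (-7/8) * (1 + ln (real d)) ^ m) H) \<and>
      (\<exists>H. noncyclic_lphs n b d (C * real d powr (-7/8) * (1 + ln (real d)) ^ m) H)"
proof -
  \<comment> \<open>2112 = 264 * 8: at most 264 \<Lambda>^3 t^8 queries are made, and \<Lambda>^3
    \<le> 8 y^3. The minimum makes this number fit below both \<open>d\<close> and
    \<open>n\<close>.\<close>
  define c1 where "c1 = min 1 c / 2112"
  have c1: "c1 > 0" "2112 * c1 \<le> 1" "2112 * c1 \<le> c" using assms by (simp_all add: c1_def)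
  \<comment> \<open>64 = 2^6 is due to \<Lambda> \<le> 2y; the factor 128 = 2^7 in \<open>C\<close>
    is due to t \<ge> z/2.\<close>
  define C0 where "C0 = 64 * (8 * 708 ^ 3 + 79 :: real)"
  define C where "C = C0 * 128 * c1 powr (- 7/8)"
  show ?thesis
  \<comment> \<open>The exponent is (k + 3) + 6: the first part comes from \<open>z\<close>, the
    second from \<Lambda>^6.\<close>
  proof (intro exI[of _ C] exI[of _ "k + 9"] allI impI)
    fix b n d :: nat
    assume b: "b \<ge> 1" and d: "d \<ge> 1" and n: "real n \<ge> c * real d / (1 + ln (real d)) ^ k"
    define y where "y = 1 + ln (real d)"
    have y: "y \<ge> 1" using d by (simp add: y_def)
    \<comment> \<open>\<open>t\<close> will be the integer part of \<open>z\<close>. The factor y^k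
      pays for the lower bound on \<open>n\<close>, and y^3 for \<Lambda>^3 in the query
      count.\<close>
    define z where "z = (c1 * real d / y ^ (k + 3)) powr (1 / 8)"
    have X: "c1 * real d / y ^ (k + 3) > 0" using c1 d y by simp
    have z: "z > 0" using c1 d y by (auto simp: z_def)
    have z8: "z ^ 8 = c1 * real d / y ^ (k + 3)"
      using X c1 d y by (simp add: z_def powr_power)
    have z7: "z powr (- 7) \<le> c1 powr (- 7/8) * real d powr (- 7/8) * y ^ (k + 3)"
    proof -
      have "z powr (- 7) = (c1 * real d / y ^ (k + 3)) powr (- 7/8)" by (simp add: z_def powr_powr)
      also have "\<dots> = c1 powr (- 7/8) * real d powr (- 7/8) * (y ^ (k + 3)) powr (7/8)"
        using c1 d y by (simp add: powr_divide powr_mult powr_minus_divide)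
      also have "(y ^ (k + 3)) powr (7/8) \<le> (y ^ (k + 3)) powr 1"
        using y by (intro powr_mono) auto
      also have "(y ^ (k + 3)) powr 1 = y ^ (k + 3)" using y by simp
      finally show ?thesis using c1 by (simp add: mult_left_mono)
    qed
    define \<delta> where "\<delta> = C * real d powr (- 7/8) * y ^ (k + 9)"
    have \<delta>: "C0 * 128 * z powr (- 7) * y ^ 6 \<le> \<delta>"
    proof -
      have "C0 * 128 * z powr (- 7) * y ^ 6 \<le> C0 * 128 * (c1 powr (- 7/8) * real d powr (- 7/8) * y ^ (k + 3)) * y ^ 6"
        using z7 y by (intro mult_right_mono mult_left_mono) (auto simp: C0_def)
      also have "\<dots> = \<delta>" by (simp add: \<delta>_def C_def power_add mult_ac eval_nat_numeral)
      finally show ?thesis .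
    qed
    have "0 < c * real d / y ^ k" using assms d y by simp
    then have n1: "n \<ge> 1" using n[folded y_def] by (cases n) auto
    have "(\<exists>H. cyclic_lphs n b d \<delta> H) \<and> (\<exists>H. noncyclic_lphs n b d \<delta> H)"
    proof (cases "z < 1")
      case True
      \<comment> \<open>There is no room for \<open>t = 1\<close> here, but the claimed error bound
        is at least 1, so a constant function suffices.\<close>
      have "1 * 1 * 1 \<le> C0 * 128 * z powr (- 7) * y ^ 6"
      proof (intro mult_mono)
        have "z ^ 7 \<le> 1" using z True by (intro power_le_one) auto
        then show "1 \<le> z powr (- 7)" using z by (simp add: powr_minus powr_realpow one_le_inverse)
        show "1 \<le> y ^ 6" using y by simp
      qed (use z in \<open>auto simp: C0_def\<close>)
      then have "\<delta> \<ge> 1" using \<delta> by simp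
      then show ?thesis using trivial_lphs[OF n1] by blast
    next
      case False
      define t where "t = nat \<lfloor>z\<rfloor>"
      have fl: "1 \<le> \<lfloor>z\<rfloor>" using False by simp
      then have tz: "real t = real_of_int \<lfloor>z\<rfloor>" by (simp add: t_def)
      have "1 \<le> real_of_int \<lfloor>z\<rfloor>" using fl by linarith
      then have "z \<le> 2 * real_of_int \<lfloor>z\<rfloor>" using real_of_int_floor_add_one_ge[of z] by linarith
      then have t: "t \<ge> 1" "real t \<le> z" "z \<le> 2 * real t"
        using fl False by (simp_all add: tz) (simp add: t_def)
      define \<Lambda> where "\<Lambda> = nat \<lceil>y\<rceil>"
      have \<Lambda>: "\<Lambda> \<ge> 1" "y \<le> real \<Lambda>" "real \<Lambda> \<le> 2 * y" using y by (auto simp: \<Lambda>_def) linarith+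
      have "real t ^ 8 \<le> z ^ 8" using t by (intro power_mono) auto
      then have t8: "real t ^ 8 \<le> c1 * real d / y ^ (k + 3)" by (simp add: z8)
      have "real \<Lambda> ^ 3 \<le> (2 * y) ^ 3" using \<Lambda> by (intro power_mono) auto
      then have "264 * (real \<Lambda> ^ 3 * real t ^ 8) \<le> 264 * ((2 * y) ^ 3 * (c1 * real d / y ^ (k + 3)))"
        using t8 y by (intro mult_left_mono mult_mono) auto
      also have "\<dots> = 2112 * c1 * (real d / y ^ k)"
        using y by (simp add: power_add power_mult_distrib field_simps)
      finally have size: "264 * (real \<Lambda> ^ 3 * real t ^ 8) \<le> 2112 * c1 * (real d / y ^ k)" .
      have dk: "0 \<le> real d / y ^ k" "real d / y ^ k \<le> real d"
        using y by (auto simp: divide_le_eq mult_le_cancel_left1)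
      have "2112 * c1 * (real d / y ^ k) \<le> 1 * (real d / y ^ k)" using c1 dk by (intro mult_right_mono)
      then have "real (264 * (\<Lambda> ^ 3 * t ^ 8)) \<le> real d" using size dk by simp
      then have qd: "264 * (\<Lambda> ^ 3 * t ^ 8) \<le> d" by (simp only: of_nat_le_iff)
      have "2112 * c1 * (real d / y ^ k) \<le> c * (real d / y ^ k)" using c1 dk by (intro mult_right_mono)
      then have "real (264 * (\<Lambda> ^ 3 * t ^ 8)) \<le> real n" using size n by (simp add: y_def)
      then have "264 * (\<Lambda> ^ 3 * t ^ 8) \<le> n" by (simp only: of_nat_le_iff)
      moreover have "\<Lambda>\<^sup>2 * t ^ 8 \<le> \<Lambda> ^ 3 * t ^ 8"
        using \<Lambda> by (auto intro!: mult_le_mono1 power_increasing)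
      ultimately have qn: "40 * (\<Lambda>\<^sup>2 * t ^ 8) \<le> n" by linarith
      have "real d = exp (ln (real d))" using d by simp
      also have "\<dots> \<le> exp (real \<Lambda>)" using \<Lambda>(2) by (simp add: y_def)
      finally have "failure t \<Lambda> \<le> (8 * 708 ^ 3 + 79) * real \<Lambda> ^ 6 / real t ^ 7"
        by (rule failure_le[OF t(1) \<Lambda>(1) b qn qd])
      also have "\<dots> \<le> (8 * 708 ^ 3 + 79) * (2 * y) ^ 6 / (z / 2) ^ 7"
        using \<Lambda> t z by (intro frac_le mult_left_mono mult_nonneg_nonneg power_mono) auto
      also have "\<dots> = C0 * 128 * z powr (- 7) * y ^ 6"
        using z by (simp add: C0_def power_mult_distrib power_divide powr_minus powr_realpow field_simps)
      also note \<delta>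
      finally have "failure t \<Lambda> \<le> \<delta>" .
      then show ?thesis
        using hash_dist_cyclic[OF t(1) \<Lambda>(1) b qn qd] hash_dist_noncyclic[OF t(1) \<Lambda>(1) b qn qd]
        by (blast intro: cyclic_lphs_mono noncyclic_lphs_mono)
    qed
    then show "(\<exists>H. cyclic_lphs n b d (C * real d powr (-7/8) * (1 + ln (real d)) ^ (k + 9)) H) \<and>
      (\<exists>H. noncyclic_lphs n b d (C * real d powr (-7/8) * (1 + ln (real d)) ^ (k + 9)) H)"
      unfolding \<delta>_def y_def .
  qed
qed

end
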